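(* Let $G$ be a countable group with the relative property (T) over the infinite subgroup $H\leqslant G$. Then at most countably many ergodic-on-$H$ probability measure preserving actions of $G$ that are not conjugate on $H$ can be orbit equivalent. That is, if $(X,\mu)$ is a standard Borel probability space and $\mathcal F$ is a set of measure preserving $G$-actions on $(X,\mu)$, each of which is ergodic on $H$, such that any two elements of $\mathcal F$ are orbit equivalent and no two distinct elements of $\mathcal F$ are conjugate on $H$, then $\mathcal F$ is countable.
   Context: A countable group $G$ has the relative property (T) over a subgroup $H\leqslant G$ if there are a finite $Q\subseteq G$ and $\varepsilon>0$ such that whenever $\pi$ is a unitary representation of $G$ on a Hilbert space $\mathscr X$ with a unit vector $\xi\in\mathscr X$ satisfying $\|\pi(g)(\xi)-\xi\|<\varepsilon$ for all $g\in Q$, then there is a non-zero $H$-invariant vector in $\pi$. A measure preserving $G$-action $\sigma$ on $(X,\mu)$ is ergodic on $H$ if its restriction $\sigma|H$ is an ergodic $H$-action. Two measure preserving $G$-actions $\sigma,\tau$ on $(X,\mu)$ are conjugate on $H$ if there is a measure preserving transformation $T\in\mathrm{Aut}(X,\mu)$ such that on a measure one set of $x$ we have $T(\sigma(h)(x))=\tau(h)(T(x))$ for all $h\in H$. They are orbit equivalent if there is $T\in\mathrm{Aut}(X,\mu)$ such that, almost everywhere, $xE_\sigma y\iff T(x)E_\tau T(y)$, where $E_\sigma,E_\tau$ are the orbit equivalence relations. Actions are identified when they agree almost everywhere. *)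

theory Defs
  imports
    "HOL-Probability.Probability"
    "HOL-Algebra.Module"
    "HOL-Algebra.Group_Action"
begin

section \<open>Complex Hilbert spaces and unitary representations\<close>

definition complex_scalars :: "complex ring" where
  "complex_scalars =
    \<lparr>carrier = UNIV, monoid.mult = (*), one = 1, ring.zero = 0, add = (+)\<rparr>"

text \<open>
  The fields \<open>mult\<close> and \<open>one\<close> that every \<open>module\<close> record inherits from \<open>ring\<close> play no role.
\<close>

record 'v hilbert = "(complex, 'v) module" +
  ip :: "'v \<Rightarrow> 'v \<Rightarrow> complex"

definition hnorm :: "'v hilbert \<Rightarrow> 'v \<Rightarrow> real" where
  "hnorm V x = sqrt (Re (ip V x x))"

locale hilbert_space = Module.module complex_scalars V
  for V :: "'v hilbert" (structure) +
  assumes ip_add_left: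
      "\<lbrakk>x \<in> carrier V; y \<in> carrier V; z \<in> carrier V\<rbrakk> \<Longrightarrow> ip V (x \<oplus> y) z = ip V x z + ip V y z"
    and ip_scale_left:
      "\<lbrakk>x \<in> carrier V; y \<in> carrier V\<rbrakk> \<Longrightarrow> ip V (c \<odot> x) y = c * ip V x y"
    and ip_cnj:
      "\<lbrakk>x \<in> carrier V; y \<in> carrier V\<rbrakk> \<Longrightarrow> ip V y x = cnj (ip V x y)"
    and ip_pos:
      "\<lbrakk>x \<in> carrier V; x \<noteq> \<zero>\<rbrakk> \<Longrightarrow> 0 < Re (ip V x x)"
    and complete:
      "Metric_space.mcomplete (carrier V) (\<lambda>x y. hnorm V (x \<ominus> y))"

definition unitary_representation ::
  "('g, 'b) monoid_scheme \<Rightarrow> 'v hilbert \<Rightarrow> ('g \<Rightarrow> 'v \<Rightarrow> 'v) \<Rightarrow> bool" where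
  "unitary_representation G V \<pi> \<longleftrightarrow>
     group_action G (carrier V) \<pi> \<and>
     (\<forall>g\<in>carrier G. \<forall>x\<in>carrier V. \<forall>y\<in>carrier V.
        \<pi> g (x \<oplus>\<^bsub>V\<^esub> y) = \<pi> g x \<oplus>\<^bsub>V\<^esub> \<pi> g y \<and>
        (\<forall>c. \<pi> g (c \<odot>\<^bsub>V\<^esub> x) = c \<odot>\<^bsub>V\<^esub> \<pi> g x) \<and>
        ip V (\<pi> g x) (\<pi> g y) = ip V x y)"

text \<open>
  HOL cannot quantify over all types within a formula, so the type \<open>'v\<close> housing the underlying
  sets of the Hilbert spaces is a parameter.  For a countable group \<open>G\<close>, the type
  \<open>nat \<Rightarrow> complex\<close> is large enough to give the unrestricted notion: the closed linear
  span of the orbit of \<open>\<xi>\<close> is an invariant separable subspace, so has at most continuum many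
  elements, and hence is unitarily isomorphic to a Hilbert space whose underlying set is a subset
  of \<open>nat \<Rightarrow> complex\<close>; an \<open>H\<close>-invariant vector in that subspace is one in \<open>\<pi>\<close>.
\<close>

definition relative_property_T ::
  "'v itself \<Rightarrow> ('g, 'b) monoid_scheme \<Rightarrow> 'g set \<Rightarrow> bool" where
  "relative_property_T (_ :: 'v itself) G H \<longleftrightarrow>
     (\<exists>Q \<epsilon>. finite Q \<and> Q \<subseteq> carrier G \<and> (0::real) < \<epsilon> \<and>
        (\<forall>(V :: 'v hilbert) \<pi> \<xi>.
           hilbert_space V \<and> unitary_representation G V \<pi> \<and>
           \<xi> \<in> carrier V \<and> hnorm V \<xi> = 1 \<and> (\<forall>g\<in>Q. hnorm V (\<pi> g \<xi> \<ominus>\<^bsub>V\<^esub> \<xi>) < \<epsilon>) \<longrightarrow>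
           (\<exists>\<eta>\<in>carrier V. \<eta> \<noteq> \<zero>\<^bsub>V\<^esub> \<and> (\<forall>h\<in>H. \<pi> h \<eta> = \<eta>))))"


section \<open>Measure preserving actions and orbit equivalence\<close>

definition standard_borel :: "'x measure \<Rightarrow> bool" where
  "standard_borel M \<longleftrightarrow>
     (\<exists>X. topspace X = space M \<and> completely_metrizable_space X \<and> separable_space X \<and>
          sets M = sigma_sets (space M) {U. openin X U})"

definition mp_aut :: "'x measure \<Rightarrow> ('x \<Rightarrow> 'x) set" where
  "mp_aut M = {T \<in> Bij (space M).
     T \<in> M \<rightarrow>\<^sub>M M \<and> inv_into (space M) T \<in> M \<rightarrow>\<^sub>M M \<and> distr M M T = M}"

definition mp_action ::
  "('g, 'b) monoid_scheme \<Rightarrow> 'x measure \<Rightarrow> ('g \<Rightarrow> 'x \<Rightarrow> 'x) \<Rightarrow> bool" where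
  "mp_action G M \<sigma> \<longleftrightarrow>
     group_action G (space M) \<sigma> \<and> (\<forall>g\<in>carrier G. \<sigma> g \<in> mp_aut M)"

definition ae_equal_actions ::
  "('g, 'b) monoid_scheme \<Rightarrow> 'x measure \<Rightarrow> (('g \<Rightarrow> 'x \<Rightarrow> 'x) \<times> ('g \<Rightarrow> 'x \<Rightarrow> 'x)) set" where
  "ae_equal_actions G M = {(\<sigma>, \<tau>). \<forall>g\<in>carrier G. AE x in M. \<sigma> g x = \<tau> g x}"

definition ergodic_action ::
  "('g, 'b) monoid_scheme \<Rightarrow> 'x measure \<Rightarrow> ('g \<Rightarrow> 'x \<Rightarrow> 'x) \<Rightarrow> bool" where
  "ergodic_action G M \<sigma> \<longleftrightarrow>
     (\<forall>A\<in>sets M. (\<forall>g\<in>carrier G. \<sigma> g -` A \<inter> space M = A) \<longrightarrow>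
        measure M A = 0 \<or> measure M (space M - A) = 0)"

definition ergodic_on ::
  "('g, 'b) monoid_scheme \<Rightarrow> 'g set \<Rightarrow> 'x measure \<Rightarrow> ('g \<Rightarrow> 'x \<Rightarrow> 'x) \<Rightarrow> bool" where
  "ergodic_on G H M \<sigma> \<longleftrightarrow> ergodic_action (G\<lparr>carrier := H\<rparr>) M \<sigma>"

definition conjugate_on ::
  "'g set \<Rightarrow> 'x measure \<Rightarrow> ('g \<Rightarrow> 'x \<Rightarrow> 'x) \<Rightarrow> ('g \<Rightarrow> 'x \<Rightarrow> 'x) \<Rightarrow> bool" where
  "conjugate_on H M \<sigma> \<tau> \<longleftrightarrow>
     (\<exists>T\<in>mp_aut M. AE x in M. \<forall>h\<in>H. T (\<sigma> h x) = \<tau> h (T x))"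

definition orbit_rel ::
  "('g, 'b) monoid_scheme \<Rightarrow> 'x measure \<Rightarrow> ('g \<Rightarrow> 'x \<Rightarrow> 'x) \<Rightarrow> ('x \<times> 'x) set" where
  "orbit_rel G M \<sigma> = {(x, y). x \<in> space M \<and> y \<in> orbit G \<sigma> x}"

text \<open>
  ``Almost everywhere'' means off one null set of points, required of both \<open>x\<close> and \<open>y\<close>; it does
  not refer to the product measure, for which the orbit relations themselves are usually null.
\<close>

definition orbit_equivalent ::
  "('g, 'b) monoid_scheme \<Rightarrow> 'x measure \<Rightarrow> ('g \<Rightarrow> 'x \<Rightarrow> 'x) \<Rightarrow> ('g \<Rightarrow> 'x \<Rightarrow> 'x) \<Rightarrow> bool" where
  "orbit_equivalent G M \<sigma> \<tau> \<longleftrightarrow>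
     (\<exists>T\<in>mp_aut M. \<exists>N\<in>null_sets M. \<forall>x\<in>space M - N. \<forall>y\<in>space M - N.
        (x, y) \<in> orbit_rel G M \<sigma> \<longleftrightarrow> (T x, T y) \<in> orbit_rel G M \<tau>)"

end

theory Submission
  imports Defs
begin

text \<open>
  For two measure preserving actions \<open>\<sigma>, \<tau>\<close> of \<open>G\<close> put \<open>c\<^sub>g = \<tau>(g) \<circ> \<sigma>(g)\<inverse>\<close>. The coincidence kernel
  \<open>K(g, h) = \<mu> {x. c\<^sub>g x = c\<^sub>h x}\<close> is left invariant and positive definite, and \<open>1 - K\<close> is a
  pseudometric on \<open>G\<close>. Moreover \<open>K(g, 1) = \<mu> {x. \<sigma>(g) x = \<tau>(g) x}\<close>. The proof has three ingredients.

  Relative property (T) makes closeness uniform on \<open>H\<close> (\<open>relative_property_T_close\<close>): there are a finite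
  set \<open>Q\<close> and \<open>\<epsilon> > 0\<close> such that \<open>1 - K(g, 1) < \<epsilon>\<close> on \<open>Q\<close> forces \<open>K(h, 1) \<ge> 3/4\<close> for every \<open>h \<in> H\<close>.
  Property (T) as defined only provides some non-zero invariant vector, not one close to the given
  almost invariant vector, so one argues as follows. If the claim fails there are coincidence kernels
  \<open>K\<^sub>n\<close> tending to 1 pointwise, quickly, and elements \<open>h\<^sub>n \<in> H\<close> with \<open>K\<^sub>n(h\<^sub>n, 1) < 3/4\<close>. The product
  \<open>\<Phi> = \<Prod>n\<ge>N. K\<^sub>n\<^sup>n\<close> is again positive definite and left invariant, is as close to 1 on \<open>Q\<close> as desired if \<open>N\<close> is
  large, and \<open>\<Phi>(h\<^sub>n g, g') \<longlonglongrightarrow> 0\<close> for all \<open>g, g'\<close> by the triangle inequality for \<open>1 - K\<^sub>n\<close>. In the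
  representation of \<open>G\<close> on the Hilbert space of \<open>\<Phi>\<close> the elements \<open>h\<^sub>n\<close> therefore tend weakly to 0, which
  excludes a non-zero \<open>H\<close>-invariant vector. That Hilbert space is built here as a space of functions on
  the natural numbers, which enumerate \<open>G\<close>.

  Uniformly close ergodic actions are conjugate (\<open>conjugate_if_close\<close>): suppose \<open>K(h, 1) \<ge> 3/4\<close> for all \<open>h\<close>
  in the acting group. Attach to a convex combination \<open>w\<close> of group elements the function
  \<open>f\<^sub>w(x, y) = \<Sum>g. w(g) [c\<^sub>g x = y]\<close>, whose row and column sums are at most 1. Translating \<open>w\<close> by \<open>k\<close> amounts to
  composing \<open>f\<^sub>w\<close> with \<open>\<sigma>(k)\<inverse> \<times> \<tau>(k)\<inverse>\<close>. A sequence minimising the quadratic form of \<open>K\<close> over the convex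
  combinations is Cauchy and asymptotically invariant, hence, if it is chosen to
  converge fast, \<open>f\<^sub>w\<close> converges along it almost everywhere to
  a \<open>\<sigma> \<times> \<tau>\<close>-invariant \<open>f\<close> with \<open>\<integral> f(x, x) \<ge> 3/4\<close>. The set \<open>f > 1/2\<close> is an invariant graph of a partial
  injection; by ergodicity its domain and range are conull, and it is the graph of a conjugacy.

  Separability (\<open>separable_full_group\<close>): up to conjugation, all actions in the family move points inside
  the orbits of one fixed countable group action. The measure preserving maps with this property form
  a separable space for the distance \<open>\<mu> {x. S x \<noteq> S' x}\<close>, so an uncountable set of actions contains two
  different ones that are \<open>\<epsilon>\<close>-close on \<open>Q\<close>. By the first two ingredients these are conjugate on \<open>H\<close>.
\<close>

section \<open>Positive kernels and formal linear combinations\<close>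

text \<open>
  A finitely supported function \<open>I \<rightarrow> \<real>\<close> or \<open>I \<rightarrow> \<complex>\<close> is represented by a list of pairs (coefficient, index), an
  index being allowed to occur more than once. Addition is then concatenation, and no side conditions
  on supports arise. A real kernel \<open>K\<close> on \<open>I\<close> gives the form \<open>\<Sum> a\<^sub>i b\<^sub>j K i j\<close>, and its sesquilinear
  version \<open>cform\<close> for complex coefficients.
\<close>

definition rform :: "('i \<Rightarrow> 'i \<Rightarrow> real) \<Rightarrow> (real \<times> 'i) list \<Rightarrow> (real \<times> 'i) list \<Rightarrow> real" where
  "rform K xs ys = (\<Sum>x\<leftarrow>xs. \<Sum>y\<leftarrow>ys. fst x * fst y * K (snd x) (snd y))"

definition cform :: "('i \<Rightarrow> 'i \<Rightarrow> real) \<Rightarrow> (complex \<times> 'i) list \<Rightarrow> (complex \<times> 'i) list \<Rightarrow> complex" where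
  "cform K xs ys = (\<Sum>x\<leftarrow>xs. \<Sum>y\<leftarrow>ys. fst x * cnj (fst y) * of_real (K (snd x) (snd y)))"

definition scale_comb :: "'a::times \<Rightarrow> ('a \<times> 'i) list \<Rightarrow> ('a \<times> 'i) list" where
  "scale_comb c xs = map (\<lambda>x. (c * fst x, snd x)) xs"

text \<open>
  Push-forward of a formal combination along a map of the indices.
\<close>

definition relabel :: "('i \<Rightarrow> 'j) \<Rightarrow> ('a \<times> 'i) list \<Rightarrow> ('a \<times> 'j) list" where
  "relabel s xs = map (\<lambda>x. (fst x, s (snd x))) xs"

text \<open>
  Positive definiteness on a set of indices. Real coefficients suffice, since the kernels that occur
  are real: see \<open>Re_cform\<close>.
\<close>

definition positive_on :: "'i set \<Rightarrow> ('i \<Rightarrow> 'i \<Rightarrow> real) \<Rightarrow> bool" where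
  "positive_on I K \<longleftrightarrow> (\<forall>w. snd ` set w \<subseteq> I \<longrightarrow> 0 \<le> rform K w w)"

lemma set_scale [simp]: "snd ` set (scale_comb c xs) = snd ` set xs"
  by (force simp: scale_comb_def)

lemma set_shift [simp]: "snd ` set (relabel s xs) = s ` snd ` set xs"
  by (force simp: relabel_def)

lemma rform_append_left: "rform K (xs @ xs') ys = rform K xs ys + rform K xs' ys"
  by (simp add: rform_def)

lemma rform_append_right: "rform K xs (ys @ ys') = rform K xs ys + rform K xs ys'"
  by (simp add: rform_def sum_list_addf)

lemma rform_scale_left: "rform K (scale_comb c xs) ys = c * rform K xs ys"
  by (simp add: rform_def scale_comb_def o_def sum_list_const_mult mult.assoc)

lemma rform_scale_right: "rform K xs (scale_comb c ys) = c * rform K xs ys"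
  by (simp add: rform_def scale_comb_def o_def sum_list_const_mult mult.assoc mult.left_commute)

lemmas rform_linear = rform_append_left rform_append_right rform_scale_left rform_scale_right

lemma rform_shift: "rform K (relabel s xs) (relabel s ys) = rform (\<lambda>i j. K (s i) (s j)) xs ys"
  by (simp add: rform_def relabel_def o_def)

lemma rform_cong:
  assumes "\<And>i j. i \<in> snd ` set xs \<Longrightarrow> j \<in> snd ` set ys \<Longrightarrow> K i j = L i j"
  shows "rform K xs ys = rform L xs ys"
  unfolding rform_def by (intro arg_cong[where f=sum_list] map_cong refl) (use assms in auto)

lemma sum_sum_list: "(\<Sum>y\<in>Y. \<Sum>x\<leftarrow>xs. f y x) = (\<Sum>x\<leftarrow>xs. \<Sum>y\<in>Y. f y x)"
  for f :: "'b \<Rightarrow> 'a \<Rightarrow> 'c::comm_monoid_add"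
  by (induction xs) (simp_all add: sum.distrib)

lemma rform_sum: "(\<Sum>y\<in>Y. rform (K y) xs ys) = rform (\<lambda>i j. \<Sum>y\<in>Y. K y i j) xs ys"
  by (simp add: rform_def sum_sum_list sum_distrib_left)

lemma tendsto_sum_list:
  fixes f :: "'b \<Rightarrow> 'a \<Rightarrow> 'c::topological_monoid_add"
  assumes "\<And>x. x \<in> set xs \<Longrightarrow> ((\<lambda>m. f m x) \<longlongrightarrow> g x) F"
  shows "((\<lambda>m. \<Sum>x\<leftarrow>xs. f m x) \<longlongrightarrow> (\<Sum>x\<leftarrow>xs. g x)) F"
  using assms by (induction xs) (auto intro!: tendsto_add)

lemma rform_tendsto:
  assumes "\<And>i j. i \<in> snd ` set xs \<Longrightarrow> j \<in> snd ` set ys \<Longrightarrow> ((\<lambda>m. K m i j) \<longlongrightarrow> L i j) F"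
  shows "((\<lambda>m. rform (K m) xs ys) \<longlongrightarrow> rform L xs ys) F"
  unfolding rform_def by (intro tendsto_sum_list tendsto_intros) (use assms in auto)

lemma positive_on_limit:
  assumes "\<And>i j. i \<in> I \<Longrightarrow> j \<in> I \<Longrightarrow> (\<lambda>m. K m i j) \<longlonglongrightarrow> L i j"
    and "\<And>m::nat. positive_on I (K m)"
  shows "positive_on I L"
  unfolding positive_on_def
proof (intro allI impI)
  fix w :: "(real \<times> 'a) list" assume w: "snd ` set w \<subseteq> I"
  have "(\<lambda>m. rform (K m) w w) \<longlonglongrightarrow> rform L w w"
    by (rule rform_tendsto) (use assms(1) w in blast)
  then show "0 \<le> rform L w w"
    by (rule LIMSEQ_le_const) (use assms(2) w in \<open>auto simp: positive_on_def\<close>)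
qed

lemma positive_on_const: "positive_on I (\<lambda>i j. 1)"
proof -
  have "rform (\<lambda>i j. 1) w w = (\<Sum>x\<leftarrow>w. fst x)\<^sup>2" for w :: "(real \<times> 'a) list"
    by (simp add: rform_def sum_list_const_mult sum_list_mult_const power2_eq_square)
  then show ?thesis by (simp add: positive_on_def)
qed

lemma positive_on_rank_one:
  assumes "positive_on I L"
  shows "positive_on I (\<lambda>i j. u i * u j * L i j)"
proof -
  have "rform (\<lambda>i j. u i * u j * L i j) w w =
     rform L (map (\<lambda>x. (fst x * u (snd x), snd x)) w) (map (\<lambda>x. (fst x * u (snd x), snd x)) w)" for w
    by (simp add: rform_def o_def mult_ac)
  then show ?thesis
    using assms unfolding positive_on_def by (simp add: image_image)
qed

text \<open>
  The Schur product of a positive kernel with the kernel of an equivalence relation: the resulting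
  form is the sum of the forms of \<open>L\<close> over the equivalence classes.
\<close>

lemma positive_on_classes:
  assumes L: "positive_on I L"
  shows "positive_on I (\<lambda>i j. if c i = c j then L i j else 0)"
  unfolding positive_on_def
proof (intro allI impI)
  fix w :: "(real \<times> 'a) list" assume w: "snd ` set w \<subseteq> I"
  define Y where "Y = c ` snd ` set w"
  define u where "u y i = (if c i = y then 1 else 0 :: real)" for y i
  have fin: "finite Y" by (simp add: Y_def)
  have eq: "(\<Sum>y\<in>Y. u y i * u y j * L i j) = (if c i = c j then L i j else 0)"
    if "i \<in> snd ` set w" for i j
  proof -
    have "c i \<in> Y" using that by (auto simp: Y_def)
    have "(\<Sum>y\<in>Y. u y i * u y j * L i j) = (\<Sum>y\<in>Y. if y = c i then u y j * L i j else 0)"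
      by (rule sum.cong) (auto simp: u_def)
    also have "\<dots> = (if c i = c j then L i j else 0)"
      using \<open>c i \<in> Y\<close> fin by (simp add: u_def)
    finally show ?thesis .
  qed
  have "0 \<le> (\<Sum>y\<in>Y. rform (\<lambda>i j. u y i * u y j * L i j) w w)"
    using positive_on_rank_one[OF L] w by (intro sum_nonneg) (auto simp: positive_on_def)
  also have "\<dots> = rform (\<lambda>i j. if c i = c j then L i j else 0) w w"
    unfolding rform_sum by (rule rform_cong) (use eq in auto)
  finally show "0 \<le> rform (\<lambda>i j. if c i = c j then L i j else 0) w w" .
qed

lemma integral_sum_list:
  fixes f :: "'b \<Rightarrow> 'a \<Rightarrow> real"
  assumes "\<And>x. x \<in> set xs \<Longrightarrow> integrable M (f x)"
  shows "integrable M (\<lambda>z. \<Sum>x\<leftarrow>xs. f x z)" "(\<integral>z. (\<Sum>x\<leftarrow>xs. f x z) \<partial>M) = (\<Sum>x\<leftarrow>xs. \<integral>z. f x z \<partial>M)"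
  using assms by (induction xs) auto

lemma rform_integral:
  assumes "\<And>i j. i \<in> snd ` set xs \<Longrightarrow> j \<in> snd ` set ys \<Longrightarrow> integrable M (\<lambda>z. K z i j)"
  shows "integrable M (\<lambda>z. rform (K z) xs ys)"
    and "(\<integral>z. rform (K z) xs ys \<partial>M) = rform (\<lambda>i j. \<integral>z. K z i j \<partial>M) xs ys"
proof -
  have 1: "integrable M (\<lambda>z. \<Sum>y\<leftarrow>ys. fst x * fst y * K z (snd x) (snd y))"
    and 2: "(\<integral>z. (\<Sum>y\<leftarrow>ys. fst x * fst y * K z (snd x) (snd y)) \<partial>M) =
        (\<Sum>y\<leftarrow>ys. fst x * fst y * (\<integral>z. K z (snd x) (snd y) \<partial>M))" if "x \<in> set xs" for x
  proof -
    have *: "integrable M (\<lambda>z. fst x * fst y * K z (snd x) (snd y))" if "y \<in> set ys" for y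
      using assms[of "snd x" "snd y"] that \<open>x \<in> set xs\<close> by (intro integrable_mult_right) auto
    show "integrable M (\<lambda>z. \<Sum>y\<leftarrow>ys. fst x * fst y * K z (snd x) (snd y))"
      using * by (rule integral_sum_list)
    show "(\<integral>z. (\<Sum>y\<leftarrow>ys. fst x * fst y * K z (snd x) (snd y)) \<partial>M) =
        (\<Sum>y\<leftarrow>ys. fst x * fst y * (\<integral>z. K z (snd x) (snd y) \<partial>M))"
      by (subst integral_sum_list(2)) (use * in auto)
  qed
  show "integrable M (\<lambda>z. rform (K z) xs ys)"
    unfolding rform_def using 1 by (rule integral_sum_list)
  show "(\<integral>z. rform (K z) xs ys \<partial>M) = rform (\<lambda>i j. \<integral>z. K z i j \<partial>M) xs ys"
    unfolding rform_def
    by (subst integral_sum_list(2)) (use 1 2 in \<open>auto cong: map_cong\<close>)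
qed

lemma cform_append_left: "cform K (xs @ xs') ys = cform K xs ys + cform K xs' ys"
  by (simp add: cform_def)

lemma cform_append_right: "cform K xs (ys @ ys') = cform K xs ys + cform K xs ys'"
  by (simp add: cform_def sum_list_addf)

lemma cform_scale_left: "cform K (scale_comb c xs) ys = c * cform K xs ys"
  by (simp add: cform_def scale_comb_def o_def sum_list_const_mult mult.assoc)

lemma cform_scale_right: "cform K xs (scale_comb c ys) = cnj c * cform K xs ys"
  by (simp add: cform_def scale_comb_def o_def sum_list_const_mult mult.assoc mult.left_commute)

lemmas cform_linear = cform_append_left cform_append_right cform_scale_left cform_scale_right

lemma Re_sum_list: "Re (sum_list zs) = (\<Sum>z\<leftarrow>zs. Re z)"
  by (induction zs) auto

lemma cnj_sum_list: "cnj (sum_list zs) = (\<Sum>z\<leftarrow>zs. cnj z)"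
  by (induction zs) auto

lemma Re_cform:
  "Re (cform K xs xs) =
     rform K (map (\<lambda>x. (Re (fst x), snd x)) xs) (map (\<lambda>x. (Re (fst x), snd x)) xs) +
     rform K (map (\<lambda>x. (Im (fst x), snd x)) xs) (map (\<lambda>x. (Im (fst x), snd x)) xs)"
  by (simp add: cform_def rform_def Re_sum_list o_def sum_list_addf[symmetric] algebra_simps)

lemma cform_shift:
  "cform K (relabel s xs) ys = cform (\<lambda>i j. K (s i) j) xs ys"
  "cform K xs (relabel s ys) = cform (\<lambda>i j. K i (s j)) xs ys"
  by (simp_all add: cform_def relabel_def o_def)

section \<open>The Hilbert space of a positive definite kernel\<close>

text \<open>
  The Hilbert space is the completion of the formal combinations under the form of \<open>K\<close>. A Cauchy
  sequence \<open>p\<close> of combinations is recorded by the function \<open>i \<mapsto> lim \<langle>p n, i\<rangle>\<close>, called \<open>ev p\<close>. Two Cauchy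
  sequences with the same function differ by a null sequence (\<open>null_form\<close>), so these functions are the
  points of the completion, and the completion lives on functions of type \<open>'i \<Rightarrow> complex\<close>.
\<close>

locale kernel =
  fixes K :: "'i \<Rightarrow> 'i \<Rightarrow> real"
  assumes sym: "K i j = K j i"
    and pos: "positive_on UNIV K"
begin

abbreviation "F \<equiv> cform K"

text \<open>
  The seminorm of a formal combination.
\<close>

definition gnorm :: "(complex \<times> 'i) list \<Rightarrow> real" where
  "gnorm xs = sqrt (Re (F xs xs))"

definition minus_comb :: "(complex \<times> 'i) list \<Rightarrow> (complex \<times> 'i) list \<Rightarrow> (complex \<times> 'i) list" where
  "minus_comb xs ys = xs @ scale_comb (-1) ys"

lemma F_diff: "F (minus_comb xs ys) zs = F xs zs - F ys zs" "F zs (minus_comb xs ys) = F zs xs - F zs ys"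
  by (simp_all add: minus_comb_def cform_linear)

lemma F_cnj: "F ys xs = cnj (F xs ys)"
proof -
  have swap: "(\<Sum>x\<leftarrow>us. \<Sum>y\<leftarrow>vs. H x y) = (\<Sum>y\<leftarrow>vs. \<Sum>x\<leftarrow>us. H x y)"
    for H :: "complex \<times> 'i \<Rightarrow> complex \<times> 'i \<Rightarrow> complex" and us vs
    by (induction us) (simp_all add: sum_list_addf)
  have "cnj (F xs ys) = (\<Sum>x\<leftarrow>xs. \<Sum>y\<leftarrow>ys. cnj (fst x) * fst y * of_real (K (snd x) (snd y)))"
    by (simp add: cform_def cnj_sum_list o_def)
  also have "\<dots> = (\<Sum>y\<leftarrow>ys. \<Sum>x\<leftarrow>xs. cnj (fst x) * fst y * of_real (K (snd x) (snd y)))"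
    by (rule swap)
  also have "\<dots> = F ys xs"
    by (simp add: cform_def sym mult_ac)
  finally show ?thesis ..
qed

lemma F_self_nonneg: "0 \<le> Re (F xs xs)"
  unfolding Re_cform using pos by (simp add: positive_on_def)

lemma F_self_real: "F xs xs = of_real (Re (F xs xs))"
  using F_cnj[of xs xs] by (metis Reals_cnj_iff of_real_Re)

lemma gnorm_nonneg [simp]: "0 \<le> gnorm xs"
  by (simp add: gnorm_def F_self_nonneg)

lemma gnorm_sq: "(gnorm xs)\<^sup>2 = Re (F xs xs)"
  by (simp add: gnorm_def F_self_nonneg)

lemma F_self: "F xs xs = of_real ((gnorm xs)\<^sup>2)"
  using F_self_real by (simp add: gnorm_sq)

lemma Cauchy_Schwarz: "cmod (F xs ys) \<le> gnorm xs * gnorm ys"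
proof -
  define b where "b = F xs ys"
  have q: "0 \<le> (gnorm xs)\<^sup>2 - 2 * t * (cmod b)\<^sup>2 + t\<^sup>2 * (cmod b)\<^sup>2 * (gnorm ys)\<^sup>2" for t :: real
  proof -
    \<comment> \<open>The direction \<open>- b ys\<close> makes the mixed term of the quadratic polynomial in \<open>t\<close> real.\<close>
    let ?z = "xs @ scale_comb (- of_real t * b) ys"
    have "F ?z ?z = F xs xs - of_real t * (cnj b * b) - of_real t * (b * cnj b)
          + of_real t * of_real t * (b * cnj b) * F ys ys"
      by (simp add: cform_linear F_cnj[of ys xs] b_def[symmetric] algebra_simps)
    also have "\<dots> = of_real ((gnorm xs)\<^sup>2 - 2 * t * (cmod b)\<^sup>2 + t\<^sup>2 * (cmod b)\<^sup>2 * (gnorm ys)\<^sup>2)"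
      by (simp add: F_self complex_norm_square[symmetric] mult.commute[of "cnj b"] power2_eq_square algebra_simps
            del: of_real_power)
    finally show ?thesis using F_self_nonneg[of ?z] by simp
  qed
  have "cmod b ^ 2 \<le> (gnorm xs * gnorm ys)\<^sup>2"
  proof (cases "gnorm ys = 0")
    case True
    have "b = 0"
    proof (rule ccontr)
      assume "b \<noteq> 0"
      then have "((gnorm xs)\<^sup>2 + 1) / (cmod b)\<^sup>2 * (cmod b)\<^sup>2 = (gnorm xs)\<^sup>2 + 1" by simp
      with q[of "((gnorm xs)\<^sup>2 + 1) / (cmod b)\<^sup>2"] True have "0 \<le> (gnorm xs)\<^sup>2 - 2 * ((gnorm xs)\<^sup>2 + 1)"
        by (metis (no_types, lifting) add.right_neutral mult.assoc mult_zero_right power_zero_numeral)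
      then show False using zero_le_power2[of "gnorm xs"] by (simp add: algebra_simps del: zero_le_power2)
    qed
    then show ?thesis using True by simp
  next
    case False
    then have "gnorm ys ^ 2 > 0" by simp
    have "0 \<le> (gnorm xs)\<^sup>2 - (cmod b)\<^sup>2 / (gnorm ys)\<^sup>2"
      using q[of "1 / (gnorm ys)\<^sup>2"] False by (simp add: field_simps power2_eq_square)
    then show ?thesis using \<open>gnorm ys ^ 2 > 0\<close> by (simp add: field_simps)
  qed
  then have "cmod b \<le> gnorm xs * gnorm ys"
    by (rule power2_le_imp_le) simp
  then show ?thesis by (simp add: b_def)
qed

lemma gnorm_append: "gnorm (xs @ ys) \<le> gnorm xs + gnorm ys"
proof -
  have "(gnorm (xs @ ys))\<^sup>2 = (gnorm xs)\<^sup>2 + (gnorm ys)\<^sup>2 + 2 * Re (F xs ys)"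
    unfolding gnorm_sq by (simp add: cform_linear F_cnj[of ys xs])
  also have "Re (F xs ys) \<le> gnorm xs * gnorm ys"
    using Cauchy_Schwarz[of xs ys] complex_Re_le_cmod order_trans by blast
  finally have "(gnorm (xs @ ys))\<^sup>2 \<le> (gnorm xs + gnorm ys)\<^sup>2" by (simp add: power2_sum)
  then show ?thesis by (rule power2_le_imp_le) simp
qed

lemma gnorm_scale: "gnorm (scale_comb c xs) = cmod c * gnorm xs"
proof -
  have "F (scale_comb c xs) (scale_comb c xs) = of_real ((cmod c * gnorm xs)\<^sup>2)"
    using complex_norm_square[of c] by (simp add: cform_linear F_self power_mult_distrib mult.assoc[symmetric])
  then have "(gnorm (scale_comb c xs))\<^sup>2 = (cmod c * gnorm xs)\<^sup>2"
    unfolding gnorm_sq by (metis Re_complex_of_real)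
  then show ?thesis by (simp add: power2_eq_iff_nonneg)
qed

lemma gnorm_diff_sq: "(gnorm (minus_comb xs ys))\<^sup>2 = (gnorm xs)\<^sup>2 + (gnorm ys)\<^sup>2 - 2 * Re (F xs ys)"
  unfolding gnorm_sq by (simp add: F_diff F_cnj[of ys xs])

lemma gnorm_diff_commute: "gnorm (minus_comb xs ys) = gnorm (minus_comb ys xs)"
proof -
  have "(gnorm (minus_comb xs ys))\<^sup>2 = (gnorm (minus_comb ys xs))\<^sup>2"
    unfolding gnorm_diff_sq by (simp add: F_cnj[of ys xs])
  then show ?thesis by (simp add: power2_eq_iff_nonneg)
qed

lemma gnorm_diff_triangle: "gnorm (minus_comb xs zs) \<le> gnorm (minus_comb xs ys) + gnorm (minus_comb ys zs)"
proof -
  have "F (minus_comb xs zs) (minus_comb xs zs) = F (minus_comb xs ys @ minus_comb ys zs) (minus_comb xs ys @ minus_comb ys zs)"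
    by (simp add: F_diff cform_linear)
  then have "gnorm (minus_comb xs zs) = gnorm (minus_comb xs ys @ minus_comb ys zs)"
    by (simp add: gnorm_def)
  then show ?thesis using gnorm_append by metis
qed

lemma gnorm_le_diff: "gnorm xs \<le> gnorm ys + gnorm (minus_comb xs ys)"
proof -
  have "F xs xs = F (ys @ minus_comb xs ys) (ys @ minus_comb xs ys)"
    by (simp add: F_diff cform_linear)
  then have "gnorm xs = gnorm (ys @ minus_comb xs ys)" by (simp add: gnorm_def)
  then show ?thesis using gnorm_append by metis
qed

text \<open>
  Cauchy sequences of formal combinations, and the limit of the form along two of them.
\<close>

definition fcauchy :: "(nat \<Rightarrow> (complex \<times> 'i) list) \<Rightarrow> bool" where
  "fcauchy p \<longleftrightarrow> (\<forall>e>0. \<exists>M. \<forall>m\<ge>M. \<forall>n\<ge>M. gnorm (minus_comb (p m) (p n)) < e)"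

definition lim_form :: "(nat \<Rightarrow> (complex \<times> 'i) list) \<Rightarrow> (nat \<Rightarrow> (complex \<times> 'i) list) \<Rightarrow> complex" where
  "lim_form p q = lim (\<lambda>n. F (p n) (q n))"

text \<open>
  The function on the indices that represents the limit of the sequence \<open>p\<close>.
\<close>

definition ev :: "(nat \<Rightarrow> (complex \<times> 'i) list) \<Rightarrow> 'i \<Rightarrow> complex" where
  "ev p i = lim_form p (\<lambda>_. [(1, i)])"

lemma fcauchy_const: "fcauchy (\<lambda>_. xs)"
proof -
  have "gnorm (minus_comb xs xs) = 0" using gnorm_diff_sq[of xs xs] by (simp add: F_self)
  then show ?thesis by (simp add: fcauchy_def)
qed

lemma fcauchy_bounded:
  assumes "fcauchy p"
  obtains C where "C > 0" "\<And>n. gnorm (p n) \<le> C"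
proof -
  obtain M where M: "\<And>m n. m \<ge> M \<Longrightarrow> n \<ge> M \<Longrightarrow> gnorm (minus_comb (p m) (p n)) < 1"
    using assms unfolding fcauchy_def by (meson zero_less_one)
  define C where "C = Max ((\<lambda>n. gnorm (p n)) ` {..M}) + 1"
  have *: "gnorm (p n) \<le> Max ((\<lambda>n. gnorm (p n)) ` {..M})" if "n \<le> M" for n
    using that by (intro Max_ge) auto
  have "gnorm (p n) \<le> C" for n
  proof (cases "n \<le> M")
    case True then show ?thesis using *[OF True] unfolding C_def by linarith
  next
    case False
    then have "gnorm (p n) \<le> gnorm (p M) + 1"
      using gnorm_le_diff[of "p n" "p M"] M[of n M] by simp
    then show ?thesis using *[of M] unfolding C_def by linarith
  qed
  moreover have "C > 0" using *[of 0] gnorm_nonneg[of "p 0"] unfolding C_def by linarith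
  ultimately show ?thesis using that by blast
qed

lemma lim_form:
  assumes p: "fcauchy p" and q: "fcauchy q"
  shows "(\<lambda>n. F (p n) (q n)) \<longlonglongrightarrow> lim_form p q"
proof -
  obtain C where C: "C > 0" "\<And>n. gnorm (p n) \<le> C" using fcauchy_bounded[OF p] by blast
  obtain D where D: "D > 0" "\<And>n. gnorm (q n) \<le> D" using fcauchy_bounded[OF q] by blast
  have "Cauchy (\<lambda>n. F (p n) (q n))"
  proof (rule metric_CauchyI)
    fix e :: real assume "e > 0"
    obtain M1 where M1: "\<And>m n. m \<ge> M1 \<Longrightarrow> n \<ge> M1 \<Longrightarrow> gnorm (minus_comb (p m) (p n)) < e / (2 * D)"
      using p \<open>e > 0\<close> \<open>D > 0\<close> unfolding fcauchy_def
      by (metis divide_pos_pos mult_pos_pos zero_less_numeral)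
    obtain M2 where M2: "\<And>m n. m \<ge> M2 \<Longrightarrow> n \<ge> M2 \<Longrightarrow> gnorm (minus_comb (q m) (q n)) < e / (2 * C)"
      using q \<open>e > 0\<close> \<open>C > 0\<close> unfolding fcauchy_def
      by (metis divide_pos_pos mult_pos_pos zero_less_numeral)
    have "dist (F (p m) (q m)) (F (p n) (q n)) < e" if "m \<ge> max M1 M2" "n \<ge> max M1 M2" for m n
    proof -
      have "F (p m) (q m) - F (p n) (q n) = F (minus_comb (p m) (p n)) (q m) + F (p n) (minus_comb (q m) (q n))"
        by (simp add: F_diff)
      then have "cmod (F (p m) (q m) - F (p n) (q n)) \<le>
          gnorm (minus_comb (p m) (p n)) * gnorm (q m) + gnorm (p n) * gnorm (minus_comb (q m) (q n))"
        by (metis Cauchy_Schwarz add_mono norm_triangle_le)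
      also have "\<dots> \<le> gnorm (minus_comb (p m) (p n)) * D + C * gnorm (minus_comb (q m) (q n))"
        using C D by (intro add_mono mult_left_mono mult_right_mono) auto
      also have "\<dots> < e / (2 * D) * D + C * (e / (2 * C))"
        using M1[of m n] M2[of m n] that C(1) D(1)
        by (intro add_strict_mono mult_strict_right_mono mult_strict_left_mono) auto
      also have "\<dots> = e" using C(1) D(1) by simp
      finally show ?thesis by (simp add: dist_norm)
    qed
    then show "\<exists>M. \<forall>m\<ge>M. \<forall>n\<ge>M. dist (F (p m) (q m)) (F (p n) (q n)) < e" by blast
  qed
  then show ?thesis
    unfolding lim_form_def by (simp add: Cauchy_convergent_iff convergent_LIMSEQ_iff)
qed

lemma lim_formI: "fcauchy p \<Longrightarrow> fcauchy q \<Longrightarrow> (\<lambda>n. F (p n) (q n)) \<longlonglongrightarrow> l \<Longrightarrow> lim_form p q = l"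
  using lim_form LIMSEQ_unique by blast

lemma fcauchy_append:
  assumes "fcauchy p" "fcauchy q"
  shows "fcauchy (\<lambda>n. p n @ q n)"
  unfolding fcauchy_def
proof (intro allI impI)
  fix e :: real assume "e > 0"
  then obtain M1 M2 where M: "\<And>m n. m \<ge> M1 \<Longrightarrow> n \<ge> M1 \<Longrightarrow> gnorm (minus_comb (p m) (p n)) < e / 2"
    "\<And>m n. m \<ge> M2 \<Longrightarrow> n \<ge> M2 \<Longrightarrow> gnorm (minus_comb (q m) (q n)) < e / 2"
    using assms unfolding fcauchy_def by (metis half_gt_zero)
  have "gnorm (minus_comb (p m @ q m) (p n @ q n)) < e" if "m \<ge> max M1 M2" "n \<ge> max M1 M2" for m n
  proof -
    have "F (minus_comb (p m @ q m) (p n @ q n)) (minus_comb (p m @ q m) (p n @ q n)) =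
       F (minus_comb (p m) (p n) @ minus_comb (q m) (q n)) (minus_comb (p m) (p n) @ minus_comb (q m) (q n))"
      by (simp add: F_diff cform_linear)
    then have "gnorm (minus_comb (p m @ q m) (p n @ q n)) \<le> gnorm (minus_comb (p m) (p n)) + gnorm (minus_comb (q m) (q n))"
      using gnorm_append by (metis gnorm_def)
    then show ?thesis using M(1)[of m n] M(2)[of m n] that by simp
  qed
  then show "\<exists>M. \<forall>m\<ge>M. \<forall>n\<ge>M. gnorm (minus_comb (p m @ q m) (p n @ q n)) < e" by blast
qed

lemma fcauchy_scale:
  assumes "fcauchy p"
  shows "fcauchy (\<lambda>n. scale_comb c (p n))"
  unfolding fcauchy_def
proof (intro allI impI)
  fix e :: real assume "e > 0"
  then have "e / (cmod c + 1) > 0" by (simp add: add_nonneg_pos)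
  then obtain M where M: "\<And>m n. m \<ge> M \<Longrightarrow> n \<ge> M \<Longrightarrow> gnorm (minus_comb (p m) (p n)) < e / (cmod c + 1)"
    using assms unfolding fcauchy_def by metis
  have "gnorm (minus_comb (scale_comb c (p m)) (scale_comb c (p n))) < e" if "m \<ge> M" "n \<ge> M" for m n
  proof -
    have "F (minus_comb (scale_comb c (p m)) (scale_comb c (p n))) (minus_comb (scale_comb c (p m)) (scale_comb c (p n))) =
       F (scale_comb c (minus_comb (p m) (p n))) (scale_comb c (minus_comb (p m) (p n)))"
      by (simp add: F_diff cform_linear algebra_simps)
    then have "gnorm (minus_comb (scale_comb c (p m)) (scale_comb c (p n))) = cmod c * gnorm (minus_comb (p m) (p n))"
      using gnorm_scale by (metis gnorm_def)
    also have "\<dots> \<le> (cmod c + 1) * gnorm (minus_comb (p m) (p n))"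
      by (simp add: mult_right_mono)
    also have "\<dots> < (cmod c + 1) * (e / (cmod c + 1))"
      using M[OF that] by (intro mult_strict_left_mono) (auto simp: add_nonneg_pos)
    also have "\<dots> = e"
      using norm_ge_zero[of c] by (metis add_nonneg_pos less_irrefl nonzero_mult_div_cancel_left times_divide_eq_right zero_less_one)
    finally show ?thesis .
  qed
  then show "\<exists>M. \<forall>m\<ge>M. \<forall>n\<ge>M. gnorm (minus_comb (scale_comb c (p m)) (scale_comb c (p n))) < e" by blast
qed

lemma lim_form_append:
  assumes "fcauchy p" "fcauchy p'" "fcauchy q"
  shows "lim_form (\<lambda>n. p n @ p' n) q = lim_form p q + lim_form p' q"
  by (rule lim_formI) (use assms in \<open>auto intro!: fcauchy_append tendsto_add lim_form simp: cform_linear\<close>)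

lemma lim_form_scale:
  assumes "fcauchy p" "fcauchy q"
  shows "lim_form (\<lambda>n. scale_comb c (p n)) q = c * lim_form p q"
  by (rule lim_formI) (use assms in \<open>auto intro!: fcauchy_scale tendsto_mult_left lim_form simp: cform_linear\<close>)

lemma lim_form_cnj:
  assumes "fcauchy p" "fcauchy q"
  shows "lim_form q p = cnj (lim_form p q)"
proof (rule lim_formI[OF assms(2,1)])
  have "(\<lambda>n. cnj (F (p n) (q n))) \<longlonglongrightarrow> cnj (lim_form p q)"
    by (intro tendsto_cnj lim_form assms)
  then show "(\<lambda>n. F (q n) (p n)) \<longlonglongrightarrow> cnj (lim_form p q)"
    by (subst F_cnj)
qed

lemma lim_form_self:
  assumes "fcauchy p"
  shows "Im (lim_form p p) = 0" "0 \<le> Re (lim_form p p)"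
    "(\<lambda>n. (gnorm (p n))\<^sup>2) \<longlonglongrightarrow> Re (lim_form p p)"
proof -
  show 1: "(\<lambda>n. (gnorm (p n))\<^sup>2) \<longlonglongrightarrow> Re (lim_form p p)"
    unfolding gnorm_sq by (rule tendsto_Re[OF lim_form[OF assms assms]])
  then show "0 \<le> Re (lim_form p p)" by (rule LIMSEQ_le_const) auto
  show "Im (lim_form p p) = 0"
    using lim_form_cnj[OF assms assms] by (metis Reals_cnj_iff complex_is_Real_iff)
qed

lemma ev_lim: "fcauchy p \<Longrightarrow> (\<lambda>n. F (p n) [(1, i)]) \<longlonglongrightarrow> ev p i"
  unfolding ev_def by (rule lim_form) (auto intro: fcauchy_const)

lemma ev_form:
  assumes "fcauchy p"
  shows "(\<lambda>n. F (p n) xs) \<longlonglongrightarrow> (\<Sum>x\<leftarrow>xs. cnj (fst x) * ev p (snd x))"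
proof -
  have "F ys xs = (\<Sum>x\<leftarrow>xs. cnj (fst x) * F ys [(1, snd x)])" for ys
  proof (induction xs)
    case Nil show ?case by (simp add: cform_def)
  next
    case (Cons x xs)
    have "F ys (x # xs) = F ys (scale_comb (fst x) [(1, snd x)] @ xs)" by (simp add: scale_comb_def)
    then show ?case using Cons by (simp add: cform_append_right cform_scale_right)
  qed
  then show ?thesis
    using assms by (simp add: tendsto_sum_list tendsto_mult_left ev_lim)
qed

text \<open>
  A Cauchy sequence tending weakly to 0 against every index tends to 0 in norm:
  \<open>\<parallel>p n\<parallel>\<^sup>2 = \<langle>p n, p M\<rangle> + \<langle>p n, p n - p M\<rangle>\<close>, where the second term is small for large \<open>M\<close> and the first tends to 0.
\<close>

lemma null_form:
  assumes p: "fcauchy p" and 0: "\<And>i. ev p i = 0"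
  shows "(\<lambda>n. gnorm (p n)) \<longlonglongrightarrow> 0"
proof -
  obtain C where C: "C > 0" "\<And>n. gnorm (p n) \<le> C" using fcauchy_bounded[OF p] by blast
  have "Re (lim_form p p) \<le> 0 + e" if "e > 0" for e
  proof -
    obtain M where M: "\<And>m n. m \<ge> M \<Longrightarrow> n \<ge> M \<Longrightarrow> gnorm (minus_comb (p m) (p n)) < e / C"
      using p \<open>e > 0\<close> C(1) unfolding fcauchy_def by (metis divide_pos_pos)
    have "(\<lambda>n. F (p n) (p M)) \<longlonglongrightarrow> 0" using ev_form[OF p, of "p M"] 0 by simp
    then have "(\<lambda>n. cmod (F (p n) (p M)) + e) \<longlonglongrightarrow> 0 + e"
      by (intro tendsto_add tendsto_norm_zero) auto
    moreover have "\<forall>\<^sub>F n in sequentially. (gnorm (p n))\<^sup>2 \<le> cmod (F (p n) (p M)) + e"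
      unfolding eventually_sequentially
    proof (intro exI[of _ M] allI impI)
      fix n assume "n \<ge> M"
      have "F (p n) (p n) = F (p n) (p M) + F (p n) (minus_comb (p n) (p M))" by (simp add: F_diff)
      then have "cmod (F (p n) (p n)) \<le> cmod (F (p n) (p M)) + gnorm (p n) * gnorm (minus_comb (p n) (p M))"
        using norm_triangle_ineq Cauchy_Schwarz by (metis add_left_mono order_trans)
      also have "gnorm (p n) * gnorm (minus_comb (p n) (p M)) \<le> C * (e / C)"
        using C M[OF \<open>n \<ge> M\<close>, of M] by (intro mult_mono) auto
      finally show "(gnorm (p n))\<^sup>2 \<le> cmod (F (p n) (p M)) + e"
        using C(1) by (simp add: F_self norm_power)
    qed
    ultimately show ?thesis
      using tendsto_le[OF sequentially_bot _ lim_form_self(3)[OF p]] by blast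
  qed
  then have "Re (lim_form p p) \<le> 0" by (rule field_le_epsilon)
  then have "(\<lambda>n. (gnorm (p n))\<^sup>2) \<longlonglongrightarrow> 0"
    using lim_form_self[OF p] by simp
  then have "(\<lambda>n. sqrt ((gnorm (p n))\<^sup>2)) \<longlonglongrightarrow> sqrt 0" by (rule tendsto_real_sqrt)
  then show ?thesis by simp
qed

lemma ev_append:
  assumes "fcauchy p" "fcauchy q"
  shows "ev (\<lambda>n. p n @ q n) = (\<lambda>i. ev p i + ev q i)"
  using assms by (simp add: ev_def lim_form_append fcauchy_const fun_eq_iff)

lemma ev_scale:
  assumes "fcauchy p"
  shows "ev (\<lambda>n. scale_comb c (p n)) = (\<lambda>i. c * ev p i)"
  using assms by (simp add: ev_def lim_form_scale fcauchy_const fun_eq_iff)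

lemma fcauchy_diff: "fcauchy p \<Longrightarrow> fcauchy q \<Longrightarrow> fcauchy (\<lambda>n. minus_comb (p n) (q n))"
  unfolding minus_comb_def by (intro fcauchy_append fcauchy_scale)

lemma ev_diff:
  assumes "fcauchy p" "fcauchy q"
  shows "ev (\<lambda>n. minus_comb (p n) (q n)) = (\<lambda>i. ev p i - ev q i)"
  using assms by (simp add: minus_comb_def ev_append fcauchy_scale ev_scale fun_eq_iff)

lemma lim_form_cong_left:
  assumes p: "fcauchy p" and p': "fcauchy p'" and q: "fcauchy q" and eq: "ev p = ev p'"
  shows "lim_form p q = lim_form p' q"
proof -
  obtain C where C: "C > 0" "\<And>n. gnorm (q n) \<le> C" using fcauchy_bounded[OF q] by blast
  have "(\<lambda>n. gnorm (minus_comb (p n) (p' n))) \<longlonglongrightarrow> 0"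
    by (rule null_form) (use p p' eq in \<open>auto simp: fcauchy_diff ev_diff\<close>)
  then have "(\<lambda>n. gnorm (minus_comb (p n) (p' n)) * C) \<longlonglongrightarrow> 0" by (rule tendsto_mult_left_zero)
  then have "(\<lambda>n. F (minus_comb (p n) (p' n)) (q n)) \<longlonglongrightarrow> 0"
    by (rule Lim_null_comparison[rotated])
      (auto intro!: always_eventually order_trans[OF Cauchy_Schwarz] mult_left_mono C)
  then have "lim_form (\<lambda>n. minus_comb (p n) (p' n)) q = 0"
    by (intro lim_formI fcauchy_diff p p' q)
  moreover have "lim_form (\<lambda>n. minus_comb (p n) (p' n)) q = lim_form p q - lim_form p' q"
    unfolding minus_comb_def by (simp add: lim_form_append lim_form_scale fcauchy_scale p p' q)
  ultimately show ?thesis by simp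
qed

lemma lim_form_cong:
  assumes "fcauchy p" "fcauchy p'" "fcauchy q" "fcauchy q'" "ev p = ev p'" "ev q = ev q'"
  shows "lim_form p q = lim_form p' q'"
proof -
  have "lim_form p q = lim_form p' q" using assms lim_form_cong_left by blast
  also have "\<dots> = cnj (lim_form q p')" using assms lim_form_cnj by blast
  also have "lim_form q p' = lim_form q' p'" using assms lim_form_cong_left by blast
  also have "cnj (lim_form q' p') = lim_form p' q'" using assms lim_form_cnj by metis
  finally show ?thesis .
qed

end

lemma cring_complex_scalars: "cring complex_scalars"
proof (rule cringI)
  show "abelian_group complex_scalars"
  proof (rule abelian_groupI)
    fix x :: complex
    show "\<exists>y\<in>carrier complex_scalars. y \<oplus>\<^bsub>complex_scalars\<^esub> x = \<zero>\<^bsub>complex_scalars\<^esub>"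
      by (auto simp: complex_scalars_def intro!: exI[of _ "- x"])
  qed (auto simp: complex_scalars_def)
  show "comm_monoid complex_scalars"
    by (rule comm_monoidI) (auto simp: complex_scalars_def)
qed (auto simp: complex_scalars_def algebra_simps)

context kernel
begin

text \<open>
  The points of the completion, and a choice \<open>rep\<close> of a Cauchy sequence for each of them.
\<close>

definition H_carrier :: "('i \<Rightarrow> complex) set" where "H_carrier = ev ` {p. fcauchy p}"

definition rep :: "('i \<Rightarrow> complex) \<Rightarrow> nat \<Rightarrow> (complex \<times> 'i) list" where
  "rep u = (SOME p. fcauchy p \<and> ev p = u)"

text \<open>
  The predicate \<open>Metric_space\<close> asks that the distance be symmetric and non-negative on the whole type.
  Composing the operations with this retraction onto the carrier achieves that.
\<close>

definition to_carrier :: "('i \<Rightarrow> complex) \<Rightarrow> 'i \<Rightarrow> complex" where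
  "to_carrier u = (if u \<in> H_carrier then u else (\<lambda>_. 0))"

text \<open>
  The Hilbert space. The ring multiplication and unit of the record are irrelevant.
\<close>

definition H_space :: "('i \<Rightarrow> complex) hilbert" where
  "H_space = \<lparr>carrier = H_carrier, monoid.mult = (\<lambda>_ _ _. 0), one = (\<lambda>_. 0), ring.zero = (\<lambda>_. 0),
     add = (\<lambda>u v i. to_carrier u i + to_carrier v i), smult = (\<lambda>c u i. c * u i),
     ip = (\<lambda>u v. lim_form (rep (to_carrier u)) (rep (to_carrier v)))\<rparr>"

lemma H_carrier_ev [simp]: "fcauchy p \<Longrightarrow> ev p \<in> H_carrier" by (simp add: H_carrier_def)

lemma rep:
  assumes "u \<in> H_carrier" shows "fcauchy (rep u)" "ev (rep u) = u"
proof -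
  obtain p where "fcauchy p \<and> ev p = u" using assms by (auto simp: H_carrier_def)
  then have "fcauchy (rep u) \<and> ev (rep u) = u"
    unfolding rep_def by (rule someI[where P="\<lambda>p. fcauchy p \<and> ev p = u"])
  then show "fcauchy (rep u)" "ev (rep u) = u" by auto
qed

lemma H_carrier_add: "u \<in> H_carrier \<Longrightarrow> v \<in> H_carrier \<Longrightarrow> (\<lambda>i. u i + v i) \<in> H_carrier"
  using ev_append[of "rep u" "rep v"] by (metis rep H_carrier_ev fcauchy_append)

lemma H_carrier_scale: "u \<in> H_carrier \<Longrightarrow> (\<lambda>i. c * u i) \<in> H_carrier"
  using ev_scale[of "rep u" c] by (metis rep H_carrier_ev fcauchy_scale)

lemma H_carrier_diff: "u \<in> H_carrier \<Longrightarrow> v \<in> H_carrier \<Longrightarrow> (\<lambda>i. u i - v i) \<in> H_carrier"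
  using ev_diff[of "rep u" "rep v"] by (metis rep H_carrier_ev fcauchy_diff)

lemma ev_Nil: "ev (\<lambda>_. []) = (\<lambda>_. 0)"
proof
  fix i
  have "(\<lambda>n. F [] [(1, i)]) \<longlonglongrightarrow> ev (\<lambda>_. []) i" by (rule ev_lim[OF fcauchy_const])
  then show "ev (\<lambda>_. []) i = 0" by (simp add: cform_def LIMSEQ_const_iff)
qed

lemma H_carrier_zero: "(\<lambda>_. 0) \<in> H_carrier"
  using H_carrier_ev[OF fcauchy_const] ev_Nil by metis

lemma to_carrier_in [simp]: "to_carrier u \<in> H_carrier" "u \<in> H_carrier \<Longrightarrow> to_carrier u = u" by (auto simp: to_carrier_def H_carrier_zero)

text \<open>
  The inner product of the completion.
\<close>

definition inp :: "('i \<Rightarrow> complex) \<Rightarrow> ('i \<Rightarrow> complex) \<Rightarrow> complex" where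
  "inp u v = lim_form (rep u) (rep v)"

lemma inp_ev: "fcauchy p \<Longrightarrow> fcauchy q \<Longrightarrow> inp (ev p) (ev q) = lim_form p q"
  unfolding inp_def by (rule lim_form_cong) (auto simp: rep)

lemma inp_add: "u \<in> H_carrier \<Longrightarrow> v \<in> H_carrier \<Longrightarrow> w \<in> H_carrier \<Longrightarrow> inp (\<lambda>i. u i + v i) w = inp u w + inp v w"
  by (auto simp: H_carrier_def inp_ev ev_append[symmetric] lim_form_append fcauchy_append)

lemma inp_scale: "u \<in> H_carrier \<Longrightarrow> w \<in> H_carrier \<Longrightarrow> inp (\<lambda>i. c * u i) w = c * inp u w"
  by (auto simp: H_carrier_def inp_ev ev_scale[symmetric] lim_form_scale fcauchy_scale)

lemma inp_cnj: "u \<in> H_carrier \<Longrightarrow> v \<in> H_carrier \<Longrightarrow> inp v u = cnj (inp u v)"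
  by (auto simp: H_carrier_def inp_ev intro: lim_form_cnj)

text \<open>
  The distance of the completion.
\<close>

definition hdist :: "('i \<Rightarrow> complex) \<Rightarrow> ('i \<Rightarrow> complex) \<Rightarrow> real" where
  "hdist u v = sqrt (Re (inp (\<lambda>i. u i - v i) (\<lambda>i. u i - v i)))"

lemma hdist_lim:
  assumes p: "fcauchy p" and q: "fcauchy q"
  shows "(\<lambda>n. gnorm (minus_comb (p n) (q n))) \<longlonglongrightarrow> hdist (ev p) (ev q)"
proof -
  have "(\<lambda>n. sqrt ((gnorm (minus_comb (p n) (q n)))\<^sup>2)) \<longlonglongrightarrow>
      sqrt (Re (lim_form (\<lambda>n. minus_comb (p n) (q n)) (\<lambda>n. minus_comb (p n) (q n))))"
    by (intro tendsto_real_sqrt lim_form_self fcauchy_diff p q)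
  also have "lim_form (\<lambda>n. minus_comb (p n) (q n)) (\<lambda>n. minus_comb (p n) (q n)) =
      inp (\<lambda>i. ev p i - ev q i) (\<lambda>i. ev p i - ev q i)"
    using inp_ev[OF fcauchy_diff[OF p q] fcauchy_diff[OF p q]] by (simp add: ev_diff[OF p q])
  finally show ?thesis by (simp add: hdist_def)
qed

lemma hdist_const:
  assumes "fcauchy p"
  shows "(\<lambda>n. gnorm (minus_comb (p n) xs)) \<longlonglongrightarrow> hdist (ev p) (ev (\<lambda>_. xs))"
  using hdist_lim[OF assms fcauchy_const] .

lemma hdist_const_const: "hdist (ev (\<lambda>_. xs)) (ev (\<lambda>_. ys)) = gnorm (minus_comb xs ys)"
  using hdist_lim[OF fcauchy_const fcauchy_const, of xs ys] by (simp add: LIMSEQ_const_iff)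

lemma hdist_nonneg: "u \<in> H_carrier \<Longrightarrow> v \<in> H_carrier \<Longrightarrow> 0 \<le> hdist u v"
  by (auto simp: H_carrier_def intro!: LIMSEQ_le_const[OF hdist_lim])

lemma hdist_commute:
  assumes "u \<in> H_carrier" "v \<in> H_carrier"
  shows "hdist u v = hdist v u"
proof -
  obtain p q where pq: "fcauchy p" "fcauchy q" "u = ev p" "v = ev q"
    using assms by (auto simp: H_carrier_def)
  have "(\<lambda>n. gnorm (minus_comb (q n) (p n))) \<longlonglongrightarrow> hdist u v"
    unfolding pq(3,4) by (subst gnorm_diff_commute) (rule hdist_lim[OF pq(1,2)])
  then show ?thesis
    using hdist_lim[OF pq(2,1)] LIMSEQ_unique unfolding pq(3,4) by blast
qed

lemma hdist_triangle:
  assumes "u \<in> H_carrier" "v \<in> H_carrier" "w \<in> H_carrier"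
  shows "hdist u w \<le> hdist u v + hdist v w"
proof -
  obtain p q r where pqr: "fcauchy p" "fcauchy q" "fcauchy r" "u = ev p" "v = ev q" "w = ev r"
    using assms by (auto simp: H_carrier_def)
  show ?thesis unfolding pqr
    by (rule tendsto_le[OF sequentially_bot tendsto_add[OF hdist_lim hdist_lim] hdist_lim])
      (auto simp: pqr intro!: always_eventually gnorm_diff_triangle)
qed

lemma ev_bound:
  assumes "fcauchy p" shows "cmod (ev p i) \<le> hdist (ev p) (\<lambda>_. 0) * gnorm [(1, i)]"
proof -
  have "(\<lambda>n. gnorm (minus_comb (p n) [])) \<longlonglongrightarrow> hdist (ev p) (\<lambda>_. 0)"
    using hdist_const[OF assms, of "[]"] by (simp add: ev_Nil)
  then have "(\<lambda>n. gnorm (minus_comb (p n) []) * gnorm [(1, i)]) \<longlonglongrightarrow> hdist (ev p) (\<lambda>_. 0) * gnorm [(1, i)]"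
    by (rule tendsto_mult_right)
  moreover have "gnorm (minus_comb xs []) = gnorm xs" for xs by (simp add: minus_comb_def scale_comb_def)
  ultimately have "(\<lambda>n. gnorm (p n) * gnorm [(1, i)]) \<longlonglongrightarrow> hdist (ev p) (\<lambda>_. 0) * gnorm [(1, i)]" by simp
  then show ?thesis
    by (rule tendsto_le[OF sequentially_bot _ tendsto_norm[OF ev_lim[OF assms]]])
      (auto intro!: always_eventually Cauchy_Schwarz)
qed

lemma hdist_self: "u \<in> H_carrier \<Longrightarrow> inp u u = of_real ((hdist u (\<lambda>_. 0))\<^sup>2)"
  by (auto simp: H_carrier_def inp_ev hdist_def lim_form_self complex_eq_iff)

lemma hdist_zero_iff:
  assumes "u \<in> H_carrier" "v \<in> H_carrier" shows "hdist u v = 0 \<longleftrightarrow> u = v"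
proof
  assume *: "hdist u v = 0"
  have "hdist (\<lambda>i. u i - v i) (\<lambda>_. 0) = 0" using * by (simp add: hdist_def)
  then have "u i - v i = 0" for i
    using ev_bound[of "rep (\<lambda>i. u i - v i)" i] rep[OF H_carrier_diff[OF assms]] by simp
  then show "u = v" by (simp add: fun_eq_iff)
next
  assume "u = v"
  have "hdist (ev (\<lambda>_. [])) (ev (\<lambda>_. [])) = gnorm (minus_comb [] [])" by (rule hdist_const_const)
  also have "\<dots> = 0" by (simp add: minus_comb_def scale_comb_def gnorm_def cform_def)
  finally show "hdist u v = 0" using \<open>u = v\<close> by (simp add: hdist_def ev_Nil)
qed

lemma H_space_simps:
  "carrier H_space = H_carrier" "\<zero>\<^bsub>H_space\<^esub> = (\<lambda>_. 0)" "c \<odot>\<^bsub>H_space\<^esub> u = (\<lambda>i. c * u i)"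
  "u \<oplus>\<^bsub>H_space\<^esub> v = (\<lambda>i. to_carrier u i + to_carrier v i)" "ip H_space u v = inp (to_carrier u) (to_carrier v)"
  by (simp_all add: H_space_def inp_def)

lemma abelian_group_H_space: "abelian_group H_space"
proof (rule abelian_groupI)
  fix u assume "u \<in> carrier H_space"
  then show "\<exists>v\<in>carrier H_space. v \<oplus>\<^bsub>H_space\<^esub> u = \<zero>\<^bsub>H_space\<^esub>"
    using H_carrier_scale[of u "-1"] by (intro bexI[of _ "\<lambda>i. - u i"]) (auto simp: H_space_simps)
qed (auto simp: H_space_simps H_carrier_add H_carrier_zero ac_simps)

lemma module_H_space: "Module.module complex_scalars H_space"
  by (rule moduleI[OF cring_complex_scalars abelian_group_H_space])
    (auto simp: H_space_simps H_carrier_scale H_carrier_add complex_scalars_def algebra_simps)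

lemma H_space_minus: "u \<ominus>\<^bsub>H_space\<^esub> v = (\<lambda>i. to_carrier u i - to_carrier v i)"
proof -
  have "\<ominus>\<^bsub>H_space\<^esub> v = (\<lambda>i. - to_carrier v i)"
    unfolding a_inv_def m_inv_def
  proof (rule the_equality)
    have "(\<lambda>i. - to_carrier v i) \<in> H_carrier" using H_carrier_scale[of "to_carrier v" "-1"] by simp
    then show "(\<lambda>i. - to_carrier v i) \<in> carrier (add_monoid H_space) \<and>
      v \<otimes>\<^bsub>add_monoid H_space\<^esub> (\<lambda>i. - to_carrier v i) = \<one>\<^bsub>add_monoid H_space\<^esub> \<and>
      (\<lambda>i. - to_carrier v i) \<otimes>\<^bsub>add_monoid H_space\<^esub> v = \<one>\<^bsub>add_monoid H_space\<^esub>"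
      by (simp add: H_space_simps)
  next
    fix w assume w: "w \<in> carrier (add_monoid H_space) \<and>
      v \<otimes>\<^bsub>add_monoid H_space\<^esub> w = \<one>\<^bsub>add_monoid H_space\<^esub> \<and>
      w \<otimes>\<^bsub>add_monoid H_space\<^esub> v = \<one>\<^bsub>add_monoid H_space\<^esub>"
    then have "to_carrier v i + w i = 0" for i by (auto simp: H_space_simps fun_eq_iff)
    then show "w = (\<lambda>i. - to_carrier v i)" by (auto simp: fun_eq_iff add_eq_0_iff)
  qed
  moreover have "(\<lambda>i. - to_carrier v i) \<in> H_carrier" using H_carrier_scale[of "to_carrier v" "-1"] by simp
  ultimately show ?thesis by (simp add: a_minus_def H_space_simps)
qed

lemma hnorm_H_space: "hnorm H_space (u \<ominus>\<^bsub>H_space\<^esub> v) = hdist (to_carrier u) (to_carrier v)"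
  by (simp add: hnorm_def H_space_minus H_space_simps H_carrier_diff hdist_def)

lemma Metric_space_H_space: "Metric_space H_carrier (\<lambda>u v. hnorm H_space (u \<ominus>\<^bsub>H_space\<^esub> v))"
  unfolding hnorm_H_space
  by standard (auto simp: hdist_nonneg hdist_zero_iff hdist_triangle intro: hdist_commute)

text \<open>
  The \<open>k\<close>-th point of a Cauchy sequence is within \<open>1/(k+1)\<close> of a single formal combination \<open>r k\<close>; the
  sequence \<open>r\<close> is Cauchy, and the point that it represents is the limit.
\<close>

lemma complete_H_space:
  "Metric_space.mcomplete H_carrier (\<lambda>u v. hnorm H_space (u \<ominus>\<^bsub>H_space\<^esub> v))"
proof -
  interpret Metric_space H_carrier "\<lambda>u v. hnorm H_space (u \<ominus>\<^bsub>H_space\<^esub> v)" by (rule Metric_space_H_space)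
  show ?thesis unfolding mcomplete_def
  proof (intro allI impI)
    fix s assume "MCauchy s"
    then have "range s \<subseteq> H_carrier" and
      *: "\<And>e. e > 0 \<Longrightarrow> \<exists>M. \<forall>n n'. M \<le> n \<longrightarrow> M \<le> n' \<longrightarrow> hnorm H_space (s n \<ominus>\<^bsub>H_space\<^esub> s n') < e"
      unfolding MCauchy_def by blast+
    then have sC: "\<And>k. s k \<in> H_carrier" by blast
    have sCau: "\<And>e. e > 0 \<Longrightarrow> \<exists>M. \<forall>n n'. M \<le> n \<longrightarrow> M \<le> n' \<longrightarrow> hdist (s n) (s n') < e"
      using * by (simp add: hnorm_H_space sC)
    have "\<exists>xs. hdist (s k) (ev (\<lambda>_. xs)) \<le> inverse (Suc k)" for k
    proof -
      obtain M where M: "\<And>m n. m \<ge> M \<Longrightarrow> n \<ge> M \<Longrightarrow> gnorm (minus_comb (rep (s k) m) (rep (s k) n)) < inverse (Suc k)"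
        using rep(1)[OF sC[of k]] unfolding fcauchy_def by (metis inverse_positive_iff_positive of_nat_0_less_iff zero_less_Suc)
      have "hdist (ev (rep (s k))) (ev (\<lambda>_. rep (s k) M)) \<le> inverse (Suc k)"
        by (rule LIMSEQ_le_const2[OF hdist_const[OF rep(1)[OF sC]]]) (use M in \<open>auto intro: less_imp_le exI[of _ M]\<close>)
      then show ?thesis using rep[OF sC] by metis
    qed
    then obtain r where r: "\<And>k. hdist (s k) (ev (\<lambda>_. r k)) \<le> inverse (Suc k)" by metis
    have cC: "ev (\<lambda>_. xs) \<in> H_carrier" for xs by (simp add: fcauchy_const)
    have inv0: "\<exists>M. \<forall>k\<ge>M. inverse (real (Suc k)) < e" if "e > 0" for e
      using order_tendstoD(2)[OF LIMSEQ_inverse_real_of_nat that] by (simp add: eventually_sequentially)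
    have rs: "\<exists>M. \<forall>k\<ge>M. hdist (s k) (ev (\<lambda>_. r k)) < e" if "e > 0" for e
      using inv0[OF that] r by (meson le_less_trans)
    have "fcauchy r"
      unfolding fcauchy_def
    proof (intro allI impI)
      fix e :: real assume "e > 0"
      obtain M where M: "\<forall>n n'. M \<le> n \<longrightarrow> M \<le> n' \<longrightarrow> hdist (s n) (s n') < e/3"
        using sCau[of "e/3"] \<open>e > 0\<close> by auto
      obtain M' where M': "\<forall>k\<ge>M'. hdist (s k) (ev (\<lambda>_. r k)) < e/3" using rs[of "e/3"] \<open>e > 0\<close> by auto
      have "gnorm (minus_comb (r k) (r l)) < e" if "k \<ge> max M M'" "l \<ge> max M M'" for k l
      proof -
        have "gnorm (minus_comb (r k) (r l)) = hdist (ev (\<lambda>_. r k)) (ev (\<lambda>_. r l))" by (simp add: hdist_const_const)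
        also have "\<dots> \<le> hdist (s k) (ev (\<lambda>_. r k)) + (hdist (s k) (s l) + hdist (s l) (ev (\<lambda>_. r l)))"
          using hdist_triangle[OF cC[of "r k"] sC[of k] cC[of "r l"]]
            hdist_triangle[OF sC[of k] sC[of l] cC[of "r l"]] hdist_commute[OF cC[of "r k"] sC[of k]]
          by linarith
        also have "\<dots> < e/3 + (e/3 + e/3)"
          using M M' that by (intro add_strict_mono) auto
        finally show ?thesis by simp
      qed
      then show "\<exists>M. \<forall>m\<ge>M. \<forall>n\<ge>M. gnorm (minus_comb (r m) (r n)) < e" by blast
    qed
    have "\<exists>M. \<forall>n\<ge>M. s n \<in> H_carrier \<and> hdist (s n) (ev r) < e" if "e > 0" for e
    proof -
      obtain M where M: "\<And>m n. m \<ge> M \<Longrightarrow> n \<ge> M \<Longrightarrow> gnorm (minus_comb (r m) (r n)) < e / 2"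
        using \<open>fcauchy r\<close> \<open>e > 0\<close> unfolding fcauchy_def by (metis half_gt_zero)
      obtain M' where M': "\<forall>k\<ge>M'. hdist (s k) (ev (\<lambda>_. r k)) < e/2" using rs[of "e/2"] \<open>e > 0\<close> by auto
      have "hdist (s k) (ev r) < e" if "k \<ge> max M M'" for k
      proof -
        have "hdist (ev r) (ev (\<lambda>_. r k)) \<le> e / 2"
          by (rule LIMSEQ_le_const2[OF hdist_const[OF \<open>fcauchy r\<close>]])
            (use M that in \<open>auto intro!: exI[of _ M] less_imp_le\<close>)
        moreover have "hdist (s k) (ev r) \<le> hdist (s k) (ev (\<lambda>_. r k)) + hdist (ev (\<lambda>_. r k)) (ev r)"
          by (rule hdist_triangle) (auto simp: sC cC \<open>fcauchy r\<close>)
        moreover have "hdist (s k) (ev (\<lambda>_. r k)) < e/2"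
          using M' that by auto
        moreover have "hdist (ev r) (ev (\<lambda>_. r k)) = hdist (ev (\<lambda>_. r k)) (ev r)"
          by (rule hdist_commute) (auto simp: cC \<open>fcauchy r\<close>)
        ultimately show ?thesis by linarith
      qed
      then show ?thesis using sC by blast
    qed
    then show "\<exists>x. limitin mtopology s x sequentially"
      using \<open>fcauchy r\<close> sC
      by (intro exI[of _ "ev r"], subst limit_metric_sequentially) (auto simp: hnorm_H_space)
  qed
qed

lemma hilbert_space_H_space: "hilbert_space H_space"
proof (intro hilbert_space.intro module_H_space hilbert_space_axioms.intro)
  fix u v w c assume u: "u \<in> carrier H_space" and v: "v \<in> carrier H_space"
  show "ip H_space (c \<odot>\<^bsub>H_space\<^esub> u) v = c * ip H_space u v"
    using u v by (simp add: H_space_simps H_carrier_scale inp_scale)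
  show "ip H_space v u = cnj (ip H_space u v)"
    using u v inp_cnj[of u v] by (simp add: H_space_simps)
  show "ip H_space (u \<oplus>\<^bsub>H_space\<^esub> v) w = ip H_space u w + ip H_space v w" if "w \<in> carrier H_space"
    using u v that by (simp add: H_space_simps inp_add H_carrier_add)
  show "0 < Re (ip H_space u u)" if "u \<noteq> \<zero>\<^bsub>H_space\<^esub>"
  proof -
    have "hdist u (\<lambda>_. 0) \<noteq> 0"
      using u that hdist_zero_iff[OF _ H_carrier_zero] by (simp add: H_space_simps)
    then show ?thesis using u by (simp add: H_space_simps hdist_self)
  qed
next
  show "Metric_space.mcomplete (carrier H_space) (\<lambda>x y. hnorm H_space (x \<ominus>\<^bsub>H_space\<^esub> y))"
    using complete_H_space by (simp add: H_space_simps)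
qed

end

section \<open>The representation of a group on the Hilbert space of an invariant kernel\<close>

text \<open>
  Left invariant positive definite kernels on a group, normalised to 1 on the diagonal. They
  correspond to the positive definite functions \<open>\<phi>\<close> with \<open>\<phi>(1) = 1\<close> via \<open>\<Phi>(g, h) = \<phi>(h\<inverse> g)\<close>.
\<close>

definition invariant_kernel :: "('g, 'b) monoid_scheme \<Rightarrow> ('g \<Rightarrow> 'g \<Rightarrow> real) \<Rightarrow> bool" where
  "invariant_kernel G \<Phi> \<longleftrightarrow> positive_on (carrier G) \<Phi> \<and>
     (\<forall>g\<in>carrier G. \<Phi> g g = 1) \<and>
     (\<forall>g\<in>carrier G. \<forall>h\<in>carrier G. \<Phi> g h = \<Phi> h g) \<and>
     (\<forall>k\<in>carrier G. \<forall>g\<in>carrier G. \<forall>h\<in>carrier G. \<Phi> (k \<otimes>\<^bsub>G\<^esub> g) (k \<otimes>\<^bsub>G\<^esub> h) = \<Phi> g h)"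

locale group_kernel = group G for G :: "('g, 'b) monoid_scheme" (structure) +
  fixes \<Phi> :: "'g \<Rightarrow> 'g \<Rightarrow> real"
  assumes countable_G: "countable (carrier G)"
    and inv_kernel: "invariant_kernel G \<Phi>"
begin

text \<open>
  The kernel is pulled back to \<open>\<nat>\<close> along an enumeration of the group, which need not be injective if
  the group is finite; \<open>move g\<close> is left translation by \<open>g\<close> in terms of indices.
\<close>

definition enum :: "nat \<Rightarrow> 'g" where "enum = from_nat_into (carrier G)"

definition move :: "'g \<Rightarrow> nat \<Rightarrow> nat" where "move g i = to_nat_on (carrier G) (g \<otimes> enum i)"

definition nat_kernel :: "nat \<Rightarrow> nat \<Rightarrow> real" where "nat_kernel i j = \<Phi> (enum i) (enum j)"

lemma enum_in [simp]: "enum i \<in> carrier G"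
  unfolding enum_def by (rule from_nat_into) auto

lemma enum_mv [simp]: "g \<in> carrier G \<Longrightarrow> enum (move g i) = g \<otimes> enum i"
  unfolding move_def by (metis countable_G enum_def enum_in from_nat_into_to_nat_on m_closed)

lemma enum_surj: "g \<in> carrier G \<Longrightarrow> \<exists>i. enum i = g"
  unfolding enum_def by (metis countable_G from_nat_into_to_nat_on)

lemma Phi_left:
  assumes "k \<in> carrier G" "g \<in> carrier G" "h \<in> carrier G"
  shows "\<Phi> (k \<otimes> g) h = \<Phi> g (inv k \<otimes> h)"
proof -
  have "\<Phi> g (inv k \<otimes> h) = \<Phi> (k \<otimes> g) (k \<otimes> (inv k \<otimes> h))"
    using inv_kernel assms by (simp add: invariant_kernel_def)
  then show ?thesis using assms by (simp add: m_assoc[symmetric])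
qed

lemma move_move:
  assumes "g \<in> carrier G" "h \<in> carrier G"
  shows "move g (move h i) = move (g \<otimes> h) i"
  using assms by (simp add: move_def[of g] move_def[of "g \<otimes> h"] m_assoc)

sublocale kernel nat_kernel
proof
  show "nat_kernel i j = nat_kernel j i" for i j
    using inv_kernel by (simp add: nat_kernel_def invariant_kernel_def)
  show "positive_on UNIV nat_kernel"
    unfolding positive_on_def
  proof (intro allI impI)
    fix w :: "(real \<times> nat) list"
    have "rform nat_kernel w w = rform \<Phi> (relabel enum w) (relabel enum w)"
      unfolding rform_shift by (simp add: nat_kernel_def[abs_def])
    moreover have "snd ` set (relabel enum w) \<subseteq> carrier G" by auto
    ultimately show "0 \<le> rform nat_kernel w w"
      using inv_kernel unfolding invariant_kernel_def positive_on_def by metis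
  qed
qed

lemma nat_kernel_mv: "g \<in> carrier G \<Longrightarrow> nat_kernel (move g j) i = nat_kernel j (move (inv g) i)"
  by (simp add: nat_kernel_def Phi_left)

lemma nat_kernel_move_move: "g \<in> carrier G \<Longrightarrow> nat_kernel (move g i) (move g j) = nat_kernel i j"
  using inv_kernel by (simp add: nat_kernel_def invariant_kernel_def)

lemma F_shift_mv: "g \<in> carrier G \<Longrightarrow> F (relabel (move g) xs) (relabel (move g) ys) = F xs ys"
  by (simp add: cform_shift nat_kernel_move_move)

lemma gnorm_shift_mv:
  assumes "g \<in> carrier G"
  shows "gnorm (minus_comb (relabel (move g) xs) (relabel (move g) ys)) = gnorm (minus_comb xs ys)"
  unfolding gnorm_def F_diff F_shift_mv[OF assms] ..

lemma fcauchy_shift: "g \<in> carrier G \<Longrightarrow> fcauchy p \<Longrightarrow> fcauchy (\<lambda>n. relabel (move g) (p n))"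
  by (simp add: fcauchy_def gnorm_shift_mv)

lemma ev_shift:
  assumes "g \<in> carrier G" "fcauchy p"
  shows "ev (\<lambda>n. relabel (move g) (p n)) = (\<lambda>i. ev p (move (inv g) i))"
proof
  fix i
  have "F (relabel (move g) xs) [(1, i)] = F xs [(1, move (inv g) i)]" for xs
  proof -
    have "F (relabel (move g) xs) [(1, i)] = cform (\<lambda>k j. nat_kernel k (move (inv g) j)) xs [(1, i)]"
      by (simp add: cform_shift nat_kernel_mv assms)
    also have "\<dots> = F xs (relabel (move (inv g)) [(1, i)])" by (simp add: cform_shift)
    finally show ?thesis by (simp add: relabel_def)
  qed
  then have "(\<lambda>n. F (relabel (move g) (p n)) [(1, i)]) \<longlonglongrightarrow> ev p (move (inv g) i)"
    using ev_lim[OF assms(2)] by simp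
  then show "ev (\<lambda>n. relabel (move g) (p n)) i = ev p (move (inv g) i)"
    using ev_lim[OF fcauchy_shift[OF assms]] LIMSEQ_unique by blast
qed

lemma lim_form_shift:
  assumes "g \<in> carrier G"
  shows "lim_form (\<lambda>n. relabel (move g) (p n)) (\<lambda>n. relabel (move g) (q n)) = lim_form p q"
  by (simp add: lim_form_def F_shift_mv assms)

text \<open>
  The translation representation on functions of the index.
\<close>

definition transl :: "'g \<Rightarrow> (nat \<Rightarrow> complex) \<Rightarrow> nat \<Rightarrow> complex" where
  "transl g = (\<lambda>u\<in>H_carrier. \<lambda>i. u (move (inv g) i))"

lemma transl_ev:
  assumes "g \<in> carrier G" "fcauchy p"
  shows "transl g (ev p) = ev (\<lambda>n. relabel (move g) (p n))"
  using assms by (simp add: transl_def ev_shift)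

lemma transl_in: "g \<in> carrier G \<Longrightarrow> u \<in> H_carrier \<Longrightarrow> transl g u \<in> H_carrier"
  by (metis H_carrier_ev fcauchy_shift rep transl_ev)

lemma transl_mult:
  assumes "g \<in> carrier G" "h \<in> carrier G" "u \<in> H_carrier"
  shows "transl (g \<otimes> h) u = transl g (transl h u)"
  using assms transl_in[of h u] by (simp add: transl_def inv_mult_group move_move)

lemma transl_one:
  assumes "u \<in> H_carrier" shows "transl \<one> u = u"
proof -
  have "relabel (move \<one>) xs = relabel (move \<one>) xs \<and> F (relabel (move \<one>) xs) ys = F xs ys" for xs ys
    by (simp add: cform_shift nat_kernel_def[abs_def])
  then have "ev (\<lambda>n. relabel (move \<one>) (p n)) = ev p" for p
    by (simp add: ev_def lim_form_def fun_eq_iff)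
  then show ?thesis using assms transl_ev[of \<one> "rep u"] rep[OF assms] by simp
qed

lemma unitary_transl: "unitary_representation G H_space transl"
  unfolding unitary_representation_def
proof (intro conjI ballI allI)
  show "group_action G (carrier H_space) transl"
  proof (intro group_action.intro group_hom.intro group_BijGroup group_axioms group_hom_axioms.intro homI)
    have bij: "transl g \<in> Bij H_carrier" if g: "g \<in> carrier G" for g
    proof -
      have "bij_betw (transl g) H_carrier H_carrier"
        by (rule bij_betw_byWitness[where f'="transl (inv g)"])
          (use g in \<open>auto simp: transl_in transl_mult[symmetric] transl_one\<close>)
      then show ?thesis by (simp add: Bij_def transl_def)
    qed
    fix g h assume gh: "g \<in> carrier G" "h \<in> carrier G"
    show "transl g \<in> carrier (BijGroup (carrier H_space))"
      using bij[OF gh(1)] by (simp add: BijGroup_def H_space_simps)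
    have "transl (g \<otimes> h) = compose H_carrier (transl g) (transl h)"
    proof (rule extensionalityI[of _ H_carrier])
      show "transl (g \<otimes> h) \<in> extensional H_carrier" by (simp add: transl_def)
      show "compose H_carrier (transl g) (transl h) \<in> extensional H_carrier" by simp
      show "transl (g \<otimes> h) u = compose H_carrier (transl g) (transl h) u" if "u \<in> H_carrier" for u
        using that gh by (simp add: compose_def transl_mult)
    qed
    then show "transl (g \<otimes> h) = transl g \<otimes>\<^bsub>BijGroup (carrier H_space)\<^esub> transl h"
      using bij gh by (simp add: BijGroup_def H_space_simps)
  qed
next
  fix g u v assume g: "g \<in> carrier G" and uv: "u \<in> carrier H_space" "v \<in> carrier H_space"
  then have H_carrier: "u \<in> H_carrier" "v \<in> H_carrier" by (auto simp: H_space_simps)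
  show "transl g (u \<oplus>\<^bsub>H_space\<^esub> v) = transl g u \<oplus>\<^bsub>H_space\<^esub> transl g v"
    using g H_carrier transl_in[of g] by (simp add: H_space_simps H_carrier_add) (simp add: transl_def H_carrier_add)
  show "transl g (c \<odot>\<^bsub>H_space\<^esub> u) = c \<odot>\<^bsub>H_space\<^esub> transl g u" for c
    using g H_carrier by (simp add: H_space_simps transl_def H_carrier_scale)
  have "inp (transl g (ev p)) (transl g (ev q)) = inp (ev p) (ev q)" if "fcauchy p" "fcauchy q" for p q
    using that g by (simp add: transl_ev inp_ev fcauchy_shift lim_form_shift)
  then show "ip H_space (transl g u) (transl g v) = ip H_space u v"
    using H_carrier transl_in[OF g] rep by (metis H_space_simps(5) to_carrier_in(2))
qed

text \<open>
  The index of the unit element and the cyclic vector that it represents.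
\<close>

definition origin :: nat where "origin = to_nat_on (carrier G) \<one>"

definition vacuum :: "nat \<Rightarrow> complex" where "vacuum = ev (\<lambda>_. [(1, origin)])"

lemma enum_origin [simp]: "enum origin = \<one>"
  unfolding origin_def enum_def by (simp add: countable_G)

lemma nat_kernel_self [simp]: "nat_kernel i i = 1"
  using inv_kernel by (simp add: nat_kernel_def invariant_kernel_def)

lemma gnorm_single [simp]: "gnorm [(1, i)] = 1"
  by (simp add: gnorm_def cform_def)

lemma vacuum_in: "vacuum \<in> carrier H_space"
  by (simp add: vacuum_def H_space_simps fcauchy_const)

lemma hnorm_vacuum: "hnorm H_space vacuum = 1"
proof -
  have "(\<lambda>n::nat. F [(1, origin)] [(1, origin)]) \<longlonglongrightarrow> inp vacuum vacuum"
    unfolding vacuum_def by (simp only: inp_ev fcauchy_const lim_form)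
  then have "inp vacuum vacuum = 1" by (simp add: cform_def LIMSEQ_const_iff)
  then show ?thesis using vacuum_in by (simp add: hnorm_def H_space_simps)
qed

lemma hnorm_transl_vacuum:
  assumes "g \<in> carrier G"
  shows "hnorm H_space (transl g vacuum \<ominus>\<^bsub>H_space\<^esub> vacuum) = sqrt (2 - 2 * \<Phi> g \<one>)"
proof -
  have "transl g vacuum = ev (\<lambda>_. [(1, move g origin)])"
    unfolding vacuum_def using transl_ev[OF assms fcauchy_const] by (simp add: relabel_def)
  then have "hnorm H_space (transl g vacuum \<ominus>\<^bsub>H_space\<^esub> vacuum) = gnorm (minus_comb [(1, move g origin)] [(1, origin)])"
    by (simp add: hnorm_H_space hdist_const_const vacuum_def fcauchy_const)
  also have "\<dots> = sqrt ((gnorm (minus_comb [(1, move g origin)] [(1, origin)]))\<^sup>2)" by simp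
  also have "\<dots> = sqrt (2 - 2 * \<Phi> g \<one>)"
    unfolding gnorm_diff_sq by (simp add: cform_def nat_kernel_def assms)
  finally show ?thesis .
qed

text \<open>
  If \<open>\<Phi>(h\<^sub>n g, g') \<longlonglongrightarrow> 0\<close>, the operators of \<open>h\<^sub>n\<close> tend to 0 weakly on formal combinations, hence everywhere,
  so only 0 is fixed by all of them.
\<close>

lemma no_invariant_vector:
  assumes \<eta>: "\<eta> \<in> H_carrier" and h: "\<And>n. h n \<in> carrier G" and inv: "\<And>n. transl (h n) \<eta> = \<eta>"
    and mix: "\<And>g g'. g \<in> carrier G \<Longrightarrow> g' \<in> carrier G \<Longrightarrow> (\<lambda>n::nat. \<Phi> (h n \<otimes> g) g') \<longlonglongrightarrow> 0"
  shows "\<eta> = (\<lambda>_. 0)"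
proof
  fix i
  define p where "p = rep \<eta>"
  have p: "fcauchy p" "ev p = \<eta>" using rep[OF \<eta>] by (auto simp: p_def)
  have "cmod (\<eta> i) \<le> 0 + d" if "d > 0" for d
  proof -
    obtain M where M: "\<And>m n. m \<ge> M \<Longrightarrow> n \<ge> M \<Longrightarrow> gnorm (minus_comb (p m) (p n)) < d"
      using p(1) \<open>d > 0\<close> unfolding fcauchy_def by metis
    have 1: "cmod (\<eta> i) \<le> cmod (F (relabel (move (h n)) (p M)) [(1, i)]) + d" for n
    proof -
      have "\<eta> i = ev (\<lambda>m. relabel (move (h n)) (p m)) i"
        unfolding transl_ev[OF h p(1), symmetric] p(2) inv ..
      moreover have "(\<lambda>m. F (relabel (move (h n)) (p m)) [(1, i)]) \<longlonglongrightarrow> ev (\<lambda>m. relabel (move (h n)) (p m)) i"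
        by (rule ev_lim[OF fcauchy_shift[OF h p(1)]])
      ultimately have "(\<lambda>m. F (relabel (move (h n)) (p m)) [(1, i)]) \<longlonglongrightarrow> \<eta> i" by (simp only:)
      then have "(\<lambda>m. cmod (F (relabel (move (h n)) (p m)) [(1, i)])) \<longlonglongrightarrow> cmod (\<eta> i)"
        by (rule tendsto_norm)
      then show ?thesis
      proof (rule LIMSEQ_le_const2, intro exI[of _ M] allI impI)
        fix m assume "m \<ge> M"
        let ?x = "relabel (move (h n)) (p m)" and ?y = "relabel (move (h n)) (p M)"
        have "cmod (F ?x [(1, i)]) = cmod (F ?y [(1, i)] + F (minus_comb ?x ?y) [(1, i)])"
          by (simp add: F_diff)
        also have "\<dots> \<le> cmod (F ?y [(1, i)]) + gnorm (minus_comb ?x ?y) * gnorm [(1, i)]"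
          by (rule norm_triangle_mono[OF order_refl Cauchy_Schwarz])
        also have "\<dots> \<le> cmod (F (relabel (move (h n)) (p M)) [(1, i)]) + d"
          using M[OF \<open>m \<ge> M\<close> order_refl] by (simp add: gnorm_shift_mv h)
        finally show "cmod (F (relabel (move (h n)) (p m)) [(1, i)]) \<le> cmod (F (relabel (move (h n)) (p M)) [(1, i)]) + d" .
      qed
    qed
    have "(\<lambda>n. nat_kernel (move (h n) k) i) \<longlonglongrightarrow> 0" for k
      using mix[of "enum k" "enum i"] by (simp add: nat_kernel_def h)
    then have "(\<lambda>n. of_real (nat_kernel (move (h n) k) i) :: complex) \<longlonglongrightarrow> of_real 0" for k
      by (rule tendsto_of_real)
    then have "(\<lambda>n. F (relabel (move (h n)) xs) [(1, i)]) \<longlonglongrightarrow> (\<Sum>x\<leftarrow>xs. fst x * 0)" for xs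
      unfolding cform_def relabel_def map_map o_def
      by (intro tendsto_sum_list) (auto intro!: tendsto_mult_right_zero)
    then have "(\<lambda>n. F (relabel (move (h n)) (p M)) [(1, i)]) \<longlonglongrightarrow> 0" by simp
    then have "(\<lambda>n. cmod (F (relabel (move (h n)) (p M)) [(1, i)]) + d) \<longlonglongrightarrow> 0 + d"
      by (intro tendsto_add tendsto_norm_zero) auto
    then show ?thesis by (rule LIMSEQ_le_const) (use 1 in auto)
  qed
  then have "cmod (\<eta> i) \<le> 0" by (rule field_le_epsilon)
  then show "\<eta> i = 0" by simp
qed

end

text \<open>
  Relative property (T) in terms of invariant kernels.
\<close>

lemma relative_property_T_kernel:
  assumes "relative_property_T TYPE(nat \<Rightarrow> complex) G H"
    and "group G" "countable (carrier G)" "H \<subseteq> carrier G"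
  obtains Q \<delta> where "finite Q" "Q \<subseteq> carrier G" "\<delta> > 0"
    "\<And>\<Phi> h. invariant_kernel G \<Phi> \<Longrightarrow> (\<And>g. g \<in> Q \<Longrightarrow> 1 - \<Phi> g \<one>\<^bsub>G\<^esub> < \<delta>) \<Longrightarrow> (\<And>n::nat. h n \<in> H) \<Longrightarrow>
      (\<And>g g'. g \<in> carrier G \<Longrightarrow> g' \<in> carrier G \<Longrightarrow> (\<lambda>n. \<Phi> (h n \<otimes>\<^bsub>G\<^esub> g) g') \<longlonglongrightarrow> 0) \<Longrightarrow> False"
proof -
  obtain Q \<epsilon> where Q: "finite Q" "Q \<subseteq> carrier G" "(0::real) < \<epsilon>"
    and T: "\<forall>(V :: (nat \<Rightarrow> complex) hilbert) \<pi> \<xi>.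
           hilbert_space V \<and> unitary_representation G V \<pi> \<and>
           \<xi> \<in> carrier V \<and> hnorm V \<xi> = 1 \<and> (\<forall>g\<in>Q. hnorm V (\<pi> g \<xi> \<ominus>\<^bsub>V\<^esub> \<xi>) < \<epsilon>) \<longrightarrow>
           (\<exists>\<eta>\<in>carrier V. \<eta> \<noteq> \<zero>\<^bsub>V\<^esub> \<and> (\<forall>h\<in>H. \<pi> h \<eta> = \<eta>))"
    using assms(1) unfolding relative_property_T_def by (elim exE conjE) (rule that; assumption)
  show ?thesis
  proof (rule that[of Q "\<epsilon>\<^sup>2 / 2"])
    fix \<Phi> and h :: "nat \<Rightarrow> 'a"
    assume inv: "invariant_kernel G \<Phi>" and close: "\<And>g. g \<in> Q \<Longrightarrow> 1 - \<Phi> g \<one>\<^bsub>G\<^esub> < \<epsilon>\<^sup>2 / 2" and hH: "\<And>n. h n \<in> H"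
      and mix: "\<And>g g'. g \<in> carrier G \<Longrightarrow> g' \<in> carrier G \<Longrightarrow> (\<lambda>n. \<Phi> (h n \<otimes>\<^bsub>G\<^esub> g) g') \<longlonglongrightarrow> 0"
    interpret gk: group_kernel G \<Phi>
      by (intro group_kernel.intro group_kernel_axioms.intro assms inv)
    have "hnorm gk.H_space (gk.transl g gk.vacuum \<ominus>\<^bsub>gk.H_space\<^esub> gk.vacuum) < \<epsilon>" if "g \<in> Q" for g
    proof -
      have "sqrt (2 - 2 * \<Phi> g \<one>\<^bsub>G\<^esub>) < sqrt (\<epsilon>\<^sup>2)"
        using close[OF that] by (intro real_sqrt_less_mono) simp
      then show ?thesis using gk.hnorm_transl_vacuum that Q by auto
    qed
    then obtain \<eta> where "\<eta> \<in> carrier gk.H_space" "\<eta> \<noteq> \<zero>\<^bsub>gk.H_space\<^esub>" "\<forall>k\<in>H. gk.transl k \<eta> = \<eta>"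
      using T[rule_format, of gk.H_space gk.transl gk.vacuum] gk.hilbert_space_H_space gk.unitary_transl
        gk.vacuum_in gk.hnorm_vacuum by metis
    moreover have "\<eta> = (\<lambda>_. 0)"
    proof (rule gk.no_invariant_vector)
      show "\<eta> \<in> gk.H_carrier" using \<open>\<eta> \<in> carrier gk.H_space\<close> by (simp add: gk.H_space_simps)
      show "h n \<in> carrier G" for n using hH assms(4) by blast
      show "gk.transl (h n) \<eta> = \<eta>" for n using hH \<open>\<forall>k\<in>H. gk.transl k \<eta> = \<eta>\<close> by blast
    qed (rule mix)
    ultimately show False by (simp add: gk.H_space_simps)
  qed (use Q in auto)
qed

section \<open>Automorphisms of a separated probability space\<close>

lemma mp_autD:
  assumes "T \<in> mp_aut M"
  shows "T \<in> M \<rightarrow>\<^sub>M M" "bij_betw T (space M) (space M)" "T \<in> extensional (space M)"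
    "A \<in> sets M \<Longrightarrow> measure M (T -` A \<inter> space M) = measure M A"
    "A \<in> sets M \<Longrightarrow> T ` A \<in> sets M"
    "A \<in> sets M \<Longrightarrow> measure M (T ` A) = measure M A"
proof -
  show T: "T \<in> M \<rightarrow>\<^sub>M M" and bij: "bij_betw T (space M) (space M)" "T \<in> extensional (space M)"
    using assms by (auto simp: mp_aut_def Bij_def)
  have inv: "inv_into (space M) T \<in> M \<rightarrow>\<^sub>M M" and distr: "distr M M T = M"
    using assms by (auto simp: mp_aut_def)
  show pre: "measure M (T -` A \<inter> space M) = measure M A" if "A \<in> sets M" for A
    using measure_distr[OF T that] distr by simp
  have eq: "T ` A = inv_into (space M) T -` A \<inter> space M" if "A \<subseteq> space M" for A
  proof -
    have inj: "inj_on T (space M)" and img: "T ` space M = space M"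
      using bij by (auto simp: bij_betw_def)
    show ?thesis
    proof (intro equalityI subsetI)
      fix y assume "y \<in> T ` A"
      then show "y \<in> inv_into (space M) T -` A \<inter> space M"
        using that inj img by (auto simp: inv_into_f_f subset_iff)
    next
      fix y assume "y \<in> inv_into (space M) T -` A \<inter> space M"
      then show "y \<in> T ` A" using img by (auto intro!: image_eqI[of _ _ "inv_into (space M) T y"] simp: f_inv_into_f)
    qed
  qed
  show img: "T ` A \<in> sets M" if "A \<in> sets M" for A
    using eq[of A] measurable_sets[OF inv that] sets.sets_into_space[OF that] by simp
  show "measure M (T ` A) = measure M A" if "A \<in> sets M" for A
  proof -
    have "T -` (T ` A) \<inter> space M = A"
      using bij sets.sets_into_space[OF that] by (auto simp: bij_betw_def inj_on_def)
    then show ?thesis using pre[OF img[OF that]] by simp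
  qed
qed

lemma mp_aut_space: "T \<in> mp_aut M \<Longrightarrow> x \<in> space M \<Longrightarrow> T x \<in> space M"
  using mp_autD(1) measurable_space by metis

lemma mp_aut_inj: "T \<in> mp_aut M \<Longrightarrow> x \<in> space M \<Longrightarrow> y \<in> space M \<Longrightarrow> T x = T y \<longleftrightarrow> x = y"
  using mp_autD(2) by (metis bij_betw_def inj_on_eq_iff)

text \<open>
  An automorphism is recognised by its action on images of measurable sets. For inverses, composites
  and maps defined piecewise this is more convenient than preimages.
\<close>

lemma (in finite_measure) mp_autI:
  assumes ext: "T \<in> extensional (space M)" and bij: "bij_betw T (space M) (space M)"
    and T: "T \<in> M \<rightarrow>\<^sub>M M" and img: "\<And>A. A \<in> sets M \<Longrightarrow> T ` A \<in> sets M"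
    and meas: "\<And>A. A \<in> sets M \<Longrightarrow> measure M (T ` A) = measure M A"
  shows "T \<in> mp_aut M"
proof -
  have inj: "inj_on T (space M)" and surj: "T ` space M = space M"
    using bij by (auto simp: bij_betw_def)
  have "inv_into (space M) T \<in> M \<rightarrow>\<^sub>M M"
  proof (rule measurableI)
    show "inv_into (space M) T x \<in> space M" if "x \<in> space M" for x
      using inv_into_into[of x T "space M"] that unfolding surj .
    show "inv_into (space M) T -` A \<inter> space M \<in> sets M" if "A \<in> sets M" for A
    proof -
      have "inv_into (space M) T -` A \<inter> space M = T ` A"
      proof (intro equalityI subsetI)
        fix y assume "y \<in> T ` A"
        then show "y \<in> inv_into (space M) T -` A \<inter> space M"
          using sets.sets_into_space[OF that] inj surj by (auto simp: inv_into_f_f subset_iff)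
      next
        fix y assume "y \<in> inv_into (space M) T -` A \<inter> space M"
        then show "y \<in> T ` A" using surj by (auto intro!: image_eqI[of _ _ "inv_into (space M) T y"] simp: f_inv_into_f)
      qed
      then show ?thesis using img[OF that] by simp
    qed
  qed
  moreover have "distr M M T = M"
  proof (rule measure_eqI)
    fix A assume "A \<in> sets (distr M M T)"
    then have A: "A \<in> sets M" by simp
    have P: "T -` A \<inter> space M \<in> sets M" using measurable_sets[OF T A] .
    have "T ` (T -` A \<inter> space M) = A \<inter> T ` space M" by auto
    also have "\<dots> = A" unfolding surj using sets.sets_into_space[OF A] by (rule Int_absorb2)
    finally have "T ` (T -` A \<inter> space M) = A" .
    then have "measure M (T -` A \<inter> space M) = measure M A" using meas[OF P] by simp
    then show "emeasure (distr M M T) A = emeasure M A"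
      unfolding emeasure_distr[OF T A] emeasure_eq_measure by simp
  qed simp
  ultimately show ?thesis using ext bij T unfolding mp_aut_def Bij_def by blast
qed

lemma (in finite_measure) mp_aut_inverse:
  assumes "T \<in> mp_aut M"
  shows "restrict (inv_into (space M) T) (space M) \<in> mp_aut M"
proof -
  note T = mp_autD[OF assms]
  let ?I = "inv_into (space M) T"
  have inj: "inj_on T (space M)" and surj: "T ` space M = space M"
    using T(2) by (auto simp: bij_betw_def)
  have eq: "restrict ?I (space M) ` A = T -` A \<inter> space M" if "A \<subseteq> space M" for A
  proof (intro equalityI subsetI)
    fix x assume "x \<in> restrict ?I (space M) ` A"
    then show "x \<in> T -` A \<inter> space M"
      using that surj by (auto simp: subset_iff f_inv_into_f inv_into_into)
  next
    fix x assume "x \<in> T -` A \<inter> space M"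
    then show "x \<in> restrict ?I (space M) ` A"
      using inj that by (auto intro!: image_eqI[of _ _ "T x"] simp: inv_into_f_f subset_iff)
  qed
  show ?thesis
  proof (rule mp_autI)
    show "bij_betw (restrict ?I (space M)) (space M) (space M)"
      using bij_betw_inv_into[OF T(2)] by (simp cong: bij_betw_cong)
    have "?I \<in> M \<rightarrow>\<^sub>M M" using assms by (simp add: mp_aut_def)
    then show "restrict ?I (space M) \<in> M \<rightarrow>\<^sub>M M" by (simp cong: measurable_cong)
    show "restrict ?I (space M) ` A \<in> sets M" "measure M (restrict ?I (space M) ` A) = measure M A"
      if "A \<in> sets M" for A
      unfolding eq[OF sets.sets_into_space[OF that]] by (rule measurable_sets[OF T(1) that], rule T(4)[OF that])
  qed simp
qed

lemma (in finite_measure) mp_aut_compose: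
  assumes "S \<in> mp_aut M" "T \<in> mp_aut M"
  shows "compose (space M) S T \<in> mp_aut M"
proof -
  note S = mp_autD[OF assms(1)] and T = mp_autD[OF assms(2)]
  have img: "compose (space M) S T ` A = S ` (T ` A)" if "A \<subseteq> space M" for A
    using that by (force simp: compose_def)
  show ?thesis
  proof (rule mp_autI)
    show "bij_betw (compose (space M) S T) (space M) (space M)"
      using S(2) T(2) by (rule bij_betw_compose[rotated])
    show "compose (space M) S T \<in> M \<rightarrow>\<^sub>M M"
      using measurable_comp[OF T(1) S(1)] by (simp add: compose_def o_def cong: measurable_cong)
    show "compose (space M) S T ` A \<in> sets M" "measure M (compose (space M) S T ` A) = measure M A"
      if "A \<in> sets M" for A
      using that S(5,6) T(5,6) img[OF sets.sets_into_space[OF that]] by simp_all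
  qed simp
qed

lemma (in finite_measure) mp_aut_AE:
  assumes "T \<in> mp_aut M" "AE x in M. P x"
  shows "AE x in M. P (T x)"
proof -
  have distr: "distr M M T = M" using assms(1) by (auto simp: mp_aut_def)
  have "AE x in distr M M T. P x" unfolding distr by (rule assms(2))
  then show ?thesis by (rule AE_distrD[OF mp_autD(1)[OF assms(1)]])
qed

text \<open>
  The consequences of \<open>mp_action\<close> that are used below. In this form they pass to subgroups, by
  restricting the carrier, and to conjugate actions.
\<close>

definition pmp_action :: "('g, 'b) monoid_scheme \<Rightarrow> 'x measure \<Rightarrow> ('g \<Rightarrow> 'x \<Rightarrow> 'x) \<Rightarrow> bool" where
  "pmp_action G M \<sigma> \<longleftrightarrow> (\<forall>g\<in>carrier G. \<sigma> g \<in> mp_aut M) \<and>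
     (\<forall>g\<in>carrier G. \<forall>h\<in>carrier G. \<forall>x\<in>space M. \<sigma> (g \<otimes>\<^bsub>G\<^esub> h) x = \<sigma> g (\<sigma> h x)) \<and>
     (\<forall>x\<in>space M. \<sigma> \<one>\<^bsub>G\<^esub> x = x)"

lemma mp_action_pmp:
  assumes "mp_action G M \<sigma>" shows "pmp_action G M \<sigma>"
proof -
  interpret group_action G "space M" \<sigma> using assms by (simp add: mp_action_def)
  have "\<sigma> \<one>\<^bsub>G\<^esub> x = x" if "x \<in> space M" for x
    using that by (simp flip: id_eq_one)
  then show ?thesis
    using assms composition_rule unfolding mp_action_def pmp_action_def by blast
qed

lemma pmp_action_subgroup:
  assumes "pmp_action G M \<sigma>" "subgroup H G"
  shows "pmp_action (G\<lparr>carrier := H\<rparr>) M \<sigma>"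
  using assms subgroup.subset[OF assms(2)] by (auto simp: pmp_action_def subset_iff)

lemma (in group) pmp_actionD:
  assumes "pmp_action G M \<sigma>" "g \<in> carrier G" "x \<in> space M"
  shows "\<sigma> (inv g) (\<sigma> g x) = x" "\<sigma> g (\<sigma> (inv g) x) = x"
proof -
  have "\<sigma> (inv g \<otimes> g) x = \<sigma> (inv g) (\<sigma> g x)" "\<sigma> (g \<otimes> inv g) x = \<sigma> g (\<sigma> (inv g) x)"
    using assms inv_closed[of g] unfolding pmp_action_def by blast+
  moreover have "\<sigma> \<one> x = x" using assms unfolding pmp_action_def by blast
  ultimately show "\<sigma> (inv g) (\<sigma> g x) = x" "\<sigma> g (\<sigma> (inv g) x) = x"
    using assms(2) by simp_all
qed

text \<open>
  A probability space whose measurable sets are generated by a countable family of sets that separates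
  points. These are the only properties of a standard Borel space that matter here: they make the
  coincidence set of two measurable maps measurable (\<open>measurable_eq\<close>) and the measure algebra separable
  (\<open>approx_all\<close>).
\<close>

locale separated_prob = prob_space +
  fixes \<U> :: "'a set set"
  assumes countable_U: "countable \<U>"
    and sets_U: "sets M = sigma_sets (space M) \<U>" and U_Pow: "\<U> \<subseteq> Pow (space M)"
    and separates: "x \<in> space M \<Longrightarrow> y \<in> space M \<Longrightarrow> x \<noteq> y \<Longrightarrow> \<exists>U\<in>\<U>. (x \<in> U) \<noteq> (y \<in> U)"
begin

lemma measurable_eq [measurable (raw)]:
  assumes "S \<in> N \<rightarrow>\<^sub>M M" "T \<in> N \<rightarrow>\<^sub>M M"
  shows "Measurable.pred N (\<lambda>x. S x = T x)"
proof -
  have "Measurable.pred N (\<lambda>x. S x \<in> U \<longleftrightarrow> T x \<in> U)" if "U \<in> \<U>" for U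
  proof -
    have "U \<in> sets M" using that sets_U by (simp add: sigma_sets.Basic)
    then have *: "S -` U \<inter> space N \<in> sets N" "T -` U \<inter> space N \<in> sets N"
      using measurable_sets assms by metis+
    have "{x \<in> space N. S x \<in> U \<longleftrightarrow> T x \<in> U} =
        (S -` U \<inter> space N) \<inter> (T -` U \<inter> space N) \<union>
        (space N - S -` U \<inter> space N) \<inter> (space N - T -` U \<inter> space N)"
      by auto
    also have "\<dots> \<in> sets N" by (intro sets.Un sets.Int sets.Diff sets.top *)
    finally show ?thesis by (simp add: pred_def)
  qed
  then have "Measurable.pred N (\<lambda>x. \<forall>U\<in>\<U>. S x \<in> U \<longleftrightarrow> T x \<in> U)"
    by (rule measurable_pred_countable[OF countable_U])
  moreover have "(\<forall>U\<in>\<U>. S x \<in> U \<longleftrightarrow> T x \<in> U) \<longleftrightarrow> S x = T x" if "x \<in> space N" for x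
    using separates[OF measurable_space[OF assms(1) that] measurable_space[OF assms(2) that]]
    by (cases "S x = T x") auto
  ultimately show ?thesis by (simp cong: measurable_cong)
qed

end

lemma second_countable_metrizable:
  assumes "metrizable_space X" "separable_space X"
  shows "second_countable X"
proof -
  obtain S d where Sd: "Metric_space S d" "X = Metric_space.mtopology S d"
    using assms(1) by (auto simp: metrizable_space_def)
  interpret Metric_space S d by fact
  obtain D where D: "countable D" "D \<subseteq> S" "mtopology closure_of D = S"
    using assms(2) Sd(2) by (auto simp: separable_space_def)
  define \<B> where "\<B> = (\<lambda>(q, n::nat). mball q (inverse (Suc n))) ` (D \<times> UNIV)"
  have "\<exists>V\<in>\<B>. x \<in> V \<and> V \<subseteq> U" if U: "openin mtopology U" "x \<in> U" for U x
  proof -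
    obtain r where r: "r > 0" "mball x r \<subseteq> U" and xS: "x \<in> S"
      using U openin_mtopology[of U] by blast
    obtain n where n: "inverse (real (Suc n)) < r / 2"
      using reals_Archimedean[of "r / 2"] r(1) by auto
    have "x \<in> mtopology closure_of D" using D(3) xS by simp
    moreover have "x \<in> mball x (inverse (Suc n))" using xS by simp
    ultimately obtain q where q: "q \<in> D" "q \<in> mball x (inverse (Suc n))"
      unfolding in_closure_of using openin_mball[of x "inverse (Suc n)"] by blast
    have "mball q (inverse (Suc n)) \<subseteq> mball x r"
    proof
      fix y assume y: "y \<in> mball q (inverse (Suc n))"
      have "d x y \<le> d x q + d q y" using q y by (intro triangle) auto
      then show "y \<in> mball x r" using q y n by auto
    qed
    moreover have "x \<in> mball q (inverse (Suc n))" using q commute by auto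
    ultimately show ?thesis
      using q(1) r(2) unfolding \<B>_def by (intro bexI[of _ "mball q (inverse (Suc n))"]) auto
  qed
  moreover have "countable \<B>" using D(1) by (auto simp: \<B>_def)
  moreover have "\<forall>V\<in>\<B>. openin mtopology V" by (auto simp: \<B>_def)
  ultimately show ?thesis unfolding second_countable_def Sd(2) by blast
qed

text \<open>
  A countable base of the topology is the generating family.
\<close>

lemma standard_borel_separated:
  assumes "standard_borel M" "prob_space M"
  obtains \<U> where "separated_prob M \<U>"
proof -
  obtain X where X: "topspace X = space M" "completely_metrizable_space X" "separable_space X"
      "sets M = sigma_sets (space M) {U. openin X U}"
    using assms(1) by (auto simp: standard_borel_def)
  have met: "metrizable_space X" using X(2) by (rule completely_metrizable_imp_metrizable_space)
  have "second_countable X" using met X(3) by (rule second_countable_metrizable)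
  then obtain \<B> where B: "countable \<B>" "\<And>V. V \<in> \<B> \<Longrightarrow> openin X V"
    "\<And>U x. openin X U \<Longrightarrow> x \<in> U \<Longrightarrow> \<exists>V \<in> \<B>. x \<in> V \<and> V \<subseteq> U"
    unfolding second_countable_def by metis
  have Bsp: "\<B> \<subseteq> Pow (space M)" using B(2) openin_subset X(1) by blast
  have "sigma_sets (space M) {U. openin X U} = sigma_sets (space M) \<B>"
  proof (rule sigma_sets_eqI)
    fix U assume "U \<in> {U. openin X U}"
    then have U: "openin X U" by simp
    have "U \<subseteq> \<Union> {V \<in> \<B>. V \<subseteq> U}"
    proof
      fix x assume "x \<in> U"
      then obtain V where "V \<in> \<B>" "x \<in> V" "V \<subseteq> U" using B(3)[OF U] by auto
      then show "x \<in> \<Union> {V \<in> \<B>. V \<subseteq> U}" by blast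
    qed
    then have "U = \<Union> {V \<in> \<B>. V \<subseteq> U}" by blast
    moreover have "\<Union> {V \<in> \<B>. V \<subseteq> U} \<in> sigma_sets (space M) \<B>"
      using B(1) by (intro sigma_sets_UNION) (auto intro: countable_subset[of _ \<B>])
    ultimately show "U \<in> sigma_sets (space M) \<B>" by simp
  qed (use B(2) in auto)
  moreover have "\<exists>U\<in>\<B>. (x \<in> U) \<noteq> (y \<in> U)" if xy: "x \<in> space M" "y \<in> space M" "x \<noteq> y" for x y
  proof -
    have "Hausdorff_space X" using met by (rule metrizable_imp_Hausdorff_space)
    then obtain U V where "openin X U" "openin X V" "x \<in> U" "y \<in> V" "disjnt U V"
      using Hausdorff_space_def[of X] xy X(1) by blast
    moreover obtain W where "W \<in> \<B>" "x \<in> W" "W \<subseteq> U" using B(3)[OF \<open>openin X U\<close> \<open>x \<in> U\<close>] by auto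
    ultimately show ?thesis by (intro bexI[of _ W]) (auto simp: disjnt_def)
  qed
  ultimately have "separated_prob M \<B>"
    using assms(2) B(1) Bsp X(4) by (simp add: separated_prob_def separated_prob_axioms_def)
  then show ?thesis using that by blast
qed

section \<open>The coincidence kernel of two actions\<close>

text \<open>
  The map \<open>c\<^sub>g = \<tau>(g) \<circ> \<sigma>(g)\<inverse>\<close> and the kernel \<open>\<mu> {x. c\<^sub>g x = c\<^sub>h x}\<close>.
\<close>

definition twist :: "('g, 'b) monoid_scheme \<Rightarrow> 'x measure \<Rightarrow> ('g \<Rightarrow> 'x \<Rightarrow> 'x) \<Rightarrow> ('g \<Rightarrow> 'x \<Rightarrow> 'x) \<Rightarrow> 'g \<Rightarrow> 'x \<Rightarrow> 'x" where
  "twist G M \<sigma> \<tau> g = compose (space M) (\<tau> g) (\<sigma> (inv\<^bsub>G\<^esub> g))"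

definition coincide :: "('g, 'b) monoid_scheme \<Rightarrow> 'x measure \<Rightarrow> ('g \<Rightarrow> 'x \<Rightarrow> 'x) \<Rightarrow> ('g \<Rightarrow> 'x \<Rightarrow> 'x) \<Rightarrow> 'g \<Rightarrow> 'g \<Rightarrow> real" where
  "coincide G M \<sigma> \<tau> g h = measure M {x \<in> space M. twist G M \<sigma> \<tau> g x = twist G M \<sigma> \<tau> h x}"

locale action_pair = separated_prob M \<U> + group G
  for M :: "'x measure" and \<U> and G :: "('g, 'b) monoid_scheme" (structure) +
  fixes \<sigma> \<tau> :: "'g \<Rightarrow> 'x \<Rightarrow> 'x"
  assumes act_s: "pmp_action G M \<sigma>" and act_t: "pmp_action G M \<tau>"
begin

abbreviation "tw \<equiv> twist G M \<sigma> \<tau>"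
abbreviation "co \<equiv> coincide G M \<sigma> \<tau>"

lemma s_aut: "g \<in> carrier G \<Longrightarrow> \<sigma> g \<in> mp_aut M" and t_aut: "g \<in> carrier G \<Longrightarrow> \<tau> g \<in> mp_aut M"
  using act_s act_t by (auto simp: pmp_action_def)

lemma s_space: "g \<in> carrier G \<Longrightarrow> x \<in> space M \<Longrightarrow> \<sigma> g x \<in> space M"
  and t_space: "g \<in> carrier G \<Longrightarrow> x \<in> space M \<Longrightarrow> \<tau> g x \<in> space M"
  by (auto intro: mp_aut_space s_aut t_aut)

lemma tw_aut: "g \<in> carrier G \<Longrightarrow> tw g \<in> mp_aut M"
  unfolding twist_def by (intro mp_aut_compose s_aut t_aut inv_closed)

lemma tw_meas [measurable]: "g \<in> carrier G \<Longrightarrow> tw g \<in> M \<rightarrow>\<^sub>M M"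
  using tw_aut mp_autD(1) by blast

lemma tw_space: "g \<in> carrier G \<Longrightarrow> x \<in> space M \<Longrightarrow> tw g x \<in> space M"
  by (auto intro: mp_aut_space tw_aut)

text \<open>
  The maps \<open>\<sigma>(k) \<times> \<tau>(k)\<close> carry the graph of \<open>c\<^sub>g\<close> to the graph of \<open>c\<^bsub>kg\<^esub>\<close>.
\<close>

lemma tw_equivariant:
  assumes "k \<in> carrier G" "g \<in> carrier G" "x \<in> space M"
  shows "tw (k \<otimes> g) (\<sigma> k x) = \<tau> k (tw g x)"
proof -
  have "\<sigma> (inv (k \<otimes> g)) (\<sigma> k x) = \<sigma> (inv g) (\<sigma> (inv k) (\<sigma> k x))"
    using act_s assms s_space[OF assms(1,3)] unfolding pmp_action_def by (simp add: inv_mult_group)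
  also have "\<dots> = \<sigma> (inv g) x" using pmp_actionD[OF act_s assms(1,3)] by simp
  finally have "tw (k \<otimes> g) (\<sigma> k x) = \<tau> (k \<otimes> g) (\<sigma> (inv g) x)"
    using s_space[OF assms(1,3)] by (simp add: twist_def compose_def)
  also have "\<dots> = \<tau> k (\<tau> g (\<sigma> (inv g) x))"
    using act_t assms s_space[of "inv g" x] unfolding pmp_action_def by simp
  finally show ?thesis using assms by (simp add: twist_def compose_def)
qed

lemma tw_one: "x \<in> space M \<Longrightarrow> tw \<one> x = x"
  using act_s act_t by (simp add: twist_def compose_def pmp_action_def)

lemma co_sets: "g \<in> carrier G \<Longrightarrow> h \<in> carrier G \<Longrightarrow> {x \<in> space M. tw g x = tw h x} \<in> sets M"
  by measurable

lemma co_invariant: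
  assumes "k \<in> carrier G" "g \<in> carrier G" "h \<in> carrier G"
  shows "co (k \<otimes> g) (k \<otimes> h) = co g h"
proof -
  let ?A = "{x \<in> space M. tw (k \<otimes> g) x = tw (k \<otimes> h) x}"
  have "\<sigma> k -` ?A \<inter> space M = {x \<in> space M. tw g x = tw h x}"
    using assms by (auto simp: tw_equivariant s_space tw_space mp_aut_inj[OF t_aut])
  moreover have "?A \<in> sets M" using assms by (intro co_sets) auto
  ultimately show ?thesis
    using mp_autD(4)[OF s_aut[OF assms(1)], of ?A] by (simp add: coincide_def)
qed

lemma co_one:
  assumes "g \<in> carrier G"
  shows "co g \<one> = measure M {x \<in> space M. \<sigma> g x = \<tau> g x}"
proof -
  let ?A = "{x \<in> space M. tw g x = tw \<one> x}"
  have "tw g (\<sigma> g x) = \<tau> g x" if "x \<in> space M" for x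
    using tw_equivariant[OF assms one_closed that] assms that by (simp add: tw_one)
  then have "tw g (\<sigma> g x) = tw \<one> (\<sigma> g x) \<longleftrightarrow> \<sigma> g x = \<tau> g x" if "x \<in> space M" for x
    using that s_space[OF assms that] by (auto simp: tw_one)
  then have "\<sigma> g -` ?A \<inter> space M = {x \<in> space M. \<sigma> g x = \<tau> g x}"
    using s_space[OF assms] by auto
  moreover have "?A \<in> sets M" using assms by (intro co_sets) auto
  ultimately show ?thesis
    using mp_autD(4)[OF s_aut[OF assms], of ?A] by (simp add: coincide_def)
qed

lemma co_self: "co g g = 1"
  by (simp add: coincide_def prob_space)

lemma co_commute: "co g h = co h g"
  by (simp add: coincide_def eq_commute)

lemma co_bounds: "0 \<le> co g h" "co g h \<le> 1"
  by (simp_all add: coincide_def)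

lemma co_triangle:
  assumes "g \<in> carrier G" "h \<in> carrier G" "k \<in> carrier G"
  shows "1 - co g k \<le> (1 - co g h) + (1 - co h k)"
proof -
  let ?D = "\<lambda>g h. {x \<in> space M. tw g x \<noteq> tw h x}"
  have D: "?D g h \<in> sets M" "measure M (?D g h) = 1 - co g h" if "g \<in> carrier G" "h \<in> carrier G" for g h
  proof -
    show "?D g h \<in> sets M" using that by measurable
    have "?D g h = space M - {x \<in> space M. tw g x = tw h x}" by auto
    then show "measure M (?D g h) = 1 - co g h"
      using prob_compl[OF co_sets[OF that]] by (simp add: coincide_def)
  qed
  have "measure M (?D g k) \<le> measure M (?D g h \<union> ?D h k)"
    using D assms by (intro finite_measure_mono) auto
  also have "\<dots> \<le> measure M (?D g h) + measure M (?D h k)"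
    using D assms by (intro measure_Un_le) auto
  finally show ?thesis using D assms by simp
qed

text \<open>
  The coincidence kernel is the integral of this kernel over \<open>x\<close>.
\<close>

definition same :: "'x \<Rightarrow> 'g \<Rightarrow> 'g \<Rightarrow> real" where
  "same x g h = (if tw g x = tw h x then 1 else 0)"

lemma same_integral:
  assumes "g \<in> carrier G" "h \<in> carrier G"
  shows "integrable M (\<lambda>x. same x g h)" "(\<integral>x. same x g h \<partial>M) = co g h"
proof -
  have eq: "same x g h = indicator {x \<in> space M. tw g x = tw h x} x" if "x \<in> space M" for x
    using that by (simp add: same_def indicator_def)
  have "integrable M (\<lambda>x. indicator {x \<in> space M. tw g x = tw h x} x :: real)"
    using co_sets[OF assms] by (simp add: emeasure_eq_measure)
  then show "integrable M (\<lambda>x. same x g h)" by (simp add: eq cong: Bochner_Integration.integrable_cong)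
  have "(\<integral>x. same x g h \<partial>M) = (\<integral>x. indicator {x \<in> space M. tw g x = tw h x} x \<partial>M)"
    by (rule Bochner_Integration.integral_cong) (auto simp: eq)
  then show "(\<integral>x. same x g h \<partial>M) = co g h"
    using co_sets[OF assms] by (simp add: coincide_def)
qed

text \<open>
  Pointwise in \<open>x\<close> the product with \<open>same x\<close> restricts \<open>L\<close> to the classes of the relation \<open>c\<^sub>g x = c\<^sub>h x\<close>.
\<close>

lemma positive_on_mult_co:
  assumes L: "positive_on (carrier G) L"
  shows "positive_on (carrier G) (\<lambda>g h. co g h * L g h)"
  unfolding positive_on_def
proof (intro allI impI)
  fix w :: "(real \<times> 'g) list" assume w: "snd ` set w \<subseteq> carrier G"
  have i: "integrable M (\<lambda>x. same x g h * L g h)" "(\<integral>x. same x g h * L g h \<partial>M) = co g h * L g h"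
    if "g \<in> snd ` set w" "h \<in> snd ` set w" for g h
    using same_integral[of g h] that w by (auto simp: subset_iff)
  have "rform (\<lambda>g h. co g h * L g h) w w = rform (\<lambda>g h. \<integral>x. same x g h * L g h \<partial>M) w w"
    by (rule rform_cong) (simp only: i)
  also have "\<dots> = (\<integral>x. rform (\<lambda>g h. same x g h * L g h) w w \<partial>M)"
    by (rule rform_integral(2)[symmetric]) (rule i)
  also have "\<dots> \<ge> 0"
  proof (rule Bochner_Integration.integral_nonneg)
    fix x
    have "positive_on (carrier G) (\<lambda>g h. if tw g x = tw h x then L g h else 0)"
      by (rule positive_on_classes[OF L])
    then have "0 \<le> rform (\<lambda>g h. if tw g x = tw h x then L g h else 0) w w"
      using w by (simp add: positive_on_def)
    also have "\<dots> = rform (\<lambda>g h. same x g h * L g h) w w"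
      by (rule rform_cong) (simp add: same_def)
    finally show "0 \<le> rform (\<lambda>g h. same x g h * L g h) w w" .
  qed
  finally show "0 \<le> rform (\<lambda>g h. co g h * L g h) w w" .
qed

lemma positive_on_mult_co_power:
  assumes L: "positive_on (carrier G) L"
  shows "positive_on (carrier G) (\<lambda>g h. co g h ^ n * L g h)"
proof (induction n)
  case (Suc n)
  from positive_on_mult_co[OF this] show ?case by (simp add: mult.assoc)
qed (use L in simp)

end

text \<open>
  Under relative property (T), actions that are close on a suitable finite set are uniformly close on
  \<open>H\<close>.
\<close>

lemma (in separated_prob) relative_property_T_close:
  fixes G :: "('g, 'b) monoid_scheme" (structure)
  assumes T: "relative_property_T TYPE(nat \<Rightarrow> complex) G H"
    and G: "group G" "countable (carrier G)" and H: "H \<subseteq> carrier G"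
  obtains Q \<epsilon> where "finite Q" "Q \<subseteq> carrier G" "\<epsilon> > 0"
    "\<And>\<sigma> \<tau> h. pmp_action G M \<sigma> \<Longrightarrow> pmp_action G M \<tau> \<Longrightarrow>
       (\<And>g. g \<in> Q \<Longrightarrow> 1 - coincide G M \<sigma> \<tau> g \<one> < \<epsilon>) \<Longrightarrow> h \<in> H \<Longrightarrow> 3 / 4 \<le> coincide G M \<sigma> \<tau> h \<one>"
proof (rule ccontr)
  assume contra: "\<not> thesis"
  interpret G: group G by (rule G)
  obtain Q \<delta> where Q: "finite Q" "Q \<subseteq> carrier G" "(0::real) < \<delta>"
    and no: "\<And>\<Phi> h. invariant_kernel G \<Phi> \<Longrightarrow> (\<And>g. g \<in> Q \<Longrightarrow> 1 - \<Phi> g \<one> < \<delta>) \<Longrightarrow> (\<And>n::nat. h n \<in> H) \<Longrightarrow>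
      (\<And>g g'. g \<in> carrier G \<Longrightarrow> g' \<in> carrier G \<Longrightarrow> (\<lambda>n. \<Phi> (h n \<otimes> g) g') \<longlonglongrightarrow> 0) \<Longrightarrow> False"
    using relative_property_T_kernel[OF T G H] by metis
  define e where "e = from_nat_into (carrier G)"
  have e_in: "e i \<in> carrier G" for i unfolding e_def by (rule from_nat_into) auto
  have e_surj: "\<exists>i. e i = g" if "g \<in> carrier G" for g
    unfolding e_def using from_nat_into_surj[OF G(2) that] .
  have "\<exists>\<sigma> \<tau> h. pmp_action G M \<sigma> \<and> pmp_action G M \<tau> \<and>
     (\<forall>i<n. 1 - coincide G M \<sigma> \<tau> (e i) \<one> < 1 / 4 ^ n) \<and> h \<in> H \<and> coincide G M \<sigma> \<tau> h \<one> < 3 / 4" for n :: nat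
  proof (rule ccontr)
    assume none: "\<not> ?thesis"
    have thesis
    proof (rule that[of "e ` {..<n}" "1 / 4 ^ n"])
      fix \<sigma> \<tau> :: "'g \<Rightarrow> 'a \<Rightarrow> 'a" and h
      assume "pmp_action G M \<sigma>" "pmp_action G M \<tau>" "h \<in> H"
        and "\<And>g. g \<in> e ` {..<n} \<Longrightarrow> 1 - coincide G M \<sigma> \<tau> g \<one> < 1 / 4 ^ n"
      then show "3 / 4 \<le> coincide G M \<sigma> \<tau> h \<one>"
        using none by (meson image_eqI lessThan_iff not_le)
    qed (auto simp: e_in)
    then show False using contra by contradiction
  qed
  then obtain \<sigma> \<tau> h where act: "\<And>n. pmp_action G M (\<sigma> n)" "\<And>n. pmp_action G M (\<tau> n)"
    and near: "\<And>n i. i < n \<Longrightarrow> 1 - coincide G M (\<sigma> n) (\<tau> n) (e i) \<one> < 1 / 4 ^ n"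
    and hH: "\<And>n. h n \<in> H" and far: "\<And>n. coincide G M (\<sigma> n) (\<tau> n) (h n) \<one> < 3 / 4"
    by metis
  define k where "k n = coincide G M (\<sigma> n) (\<tau> n)" for n
  have ap: "action_pair M \<U> G (\<sigma> n) (\<tau> n)" for n
    by (intro action_pair.intro action_pair_axioms.intro separated_prob_axioms G act)
  note k_inv = action_pair.co_invariant[OF ap, folded k_def]
    and k_self = action_pair.co_self[OF ap, folded k_def]
    and k_comm = action_pair.co_commute[OF ap, folded k_def]
    and k_bd = action_pair.co_bounds[OF ap, folded k_def]
    and k_tri = action_pair.co_triangle[OF ap, folded k_def]
    and k_pos = action_pair.positive_on_mult_co_power[OF ap, folded k_def]
  note near = near[folded k_def] and far = far[folded k_def]

  obtain N1 where N1: "Q \<subseteq> e ` {..<N1}"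
  proof -
    have "Q \<subseteq> range e"
    proof
      fix g assume "g \<in> Q"
      then obtain i where "e i = g" using e_surj[of g] Q(2) by auto
      then show "g \<in> range e" by auto
    qed
    then obtain J where J: "finite J" "Q = e ` J" using Q(1) by (meson finite_subset_image)
    then obtain N1 where "J \<subseteq> {..<N1}" using finite_nat_iff_bounded by blast
    then show ?thesis using that J by blast
  qed
  obtain N2 :: nat where N2: "(1 / 2) ^ N2 < \<delta> / 2"
    using real_arch_pow_inv[of "\<delta> / 2" "1/2"] Q(3) by auto
  define N where "N = max N1 N2"
  have "(1 / 2 :: real) ^ N \<le> (1 / 2) ^ N2" unfolding N_def by (intro power_decreasing) auto
  moreover have "2 / 2 ^ N = 2 * (1 / 2 :: real) ^ N" by (simp add: power_one_over)
  ultimately have N: "2 / 2 ^ N < \<delta>" using N2 by linarith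

  \<comment> \<open>The exponents \<open>n\<close> make the product tend to 0 along \<open>h n\<close>, and \<open>1 - k n g 1 < 1 / 4 ^ n\<close> keeps it near 1 on \<open>Q\<close>.\<close>
  define R where "R m g g' = (\<Prod>n\<in>{N..<m}. k n g g' ^ n)" for m g g'
  have R_Suc: "R (Suc m) g g' = (if N \<le> m then k m g g' ^ m * R m g g' else R m g g')" for m g g'
    by (simp add: R_def mult.commute)
  have R_bd: "0 \<le> R m g g'" "R m g g' \<le> 1" for m g g'
    unfolding R_def by (auto intro!: prod_nonneg prod_le_1 simp: k_bd power_le_one)
  have R_dec: "R (Suc m) g g' \<le> R m g g'" for m g g'
    by (simp add: R_Suc mult_left_le_one_le k_bd R_bd power_le_one)
  define \<Phi> where "\<Phi> g g' = lim (\<lambda>m. R m g g')" for g g'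
  have lim: "(\<lambda>m. R m g g') \<longlonglongrightarrow> \<Phi> g g'" and \<Phi>_le: "\<Phi> g g' \<le> R m g g'" for m g g'
  proof -
    have "decseq (\<lambda>m. R m g g')" using R_dec by (rule decseq_SucI)
    then obtain L where L: "(\<lambda>m. R m g g') \<longlonglongrightarrow> L" "\<forall>i. L \<le> R i g g'"
      using decseq_convergent[of "\<lambda>m. R m g g'" 0] R_bd by blast
    then have "\<Phi> g g' = L" unfolding \<Phi>_def by (simp add: limI)
    then show "(\<lambda>m. R m g g') \<longlonglongrightarrow> \<Phi> g g'" "\<Phi> g g' \<le> R m g g'" using L by auto
  qed
  have "positive_on (carrier G) (R m)" for m
  proof (induction m)
    case 0 show ?case using positive_on_const by (simp add: R_def[abs_def])
  next
    case (Suc m)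
    have "R (Suc m) = (if N \<le> m then (\<lambda>g g'. k m g g' ^ m * R m g g') else R m)"
      by (auto simp: fun_eq_iff R_Suc)
    then show ?case using Suc k_pos[OF Suc, of m m] by simp
  qed
  then have "positive_on (carrier G) \<Phi>" using lim by (rule positive_on_limit[of _ R, rotated])
  moreover have "\<Phi> g g = 1" "\<Phi> g g' = \<Phi> g' g" for g g'
    unfolding \<Phi>_def R_def using k_comm[of _ g g'] by (simp_all add: k_self)
  moreover have "\<Phi> (l \<otimes> g) (l \<otimes> g') = \<Phi> g g'" if "l \<in> carrier G" "g \<in> carrier G" "g' \<in> carrier G" for l g g'
    unfolding \<Phi>_def R_def using that by (simp add: k_inv)
  ultimately have inv: "invariant_kernel G \<Phi>"
    unfolding invariant_kernel_def by blast
  have close: "1 - \<Phi> g \<one> < \<delta>" if "g \<in> Q" for g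
  proof -
    obtain i where "i < N1" "g = e i" using \<open>g \<in> Q\<close> N1 by auto
    then have i: "i < N" "g = e i" by (auto simp: N_def)
    \<comment> \<open>The sum of the losses \<open>n / 4 ^ n \<le> 1 / 2 ^ n\<close> over \<open>N \<le> n < m\<close> is \<open>2 / 2 ^ N - 2 / 2 ^ m\<close>.\<close>
    have step: "1 - 2 / 2 ^ N + 2 / 2 ^ m \<le> R m g \<one>" if "m \<ge> N" for m
      using that
    proof (induction m rule: dec_induct)
      case base show ?case by (simp add: R_def)
    next
      case (step m)
      have "real m * (1 - k m g \<one>) \<le> 2 ^ m * (1 / 4 ^ m)"
        using near[of i m] i step.hyps k_bd[of m g \<one>] less_imp_le[OF of_nat_less_two_power[of m]]
        by (intro mult_mono) auto
      also have "\<dots> = 1 / 2 ^ m" by (simp add: field_simps flip: power_mult_distrib)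
      finally have "1 - 1 / 2 ^ m \<le> 1 + real m * (k m g \<one> - 1)" by (simp add: algebra_simps)
      also have "\<dots> \<le> (1 + (k m g \<one> - 1)) ^ m"
        using k_bd(1)[of m g \<one>] by (intro Bernoulli_inequality) auto
      finally have a: "1 - 1 / 2 ^ m \<le> k m g \<one> ^ m" by simp
      have "R m g \<one> * (1 - k m g \<one> ^ m) \<le> 1 * (1 - k m g \<one> ^ m)"
        using R_bd k_bd by (intro mult_right_mono) (auto simp: power_le_one)
      then have "R m g \<one> - 1 / 2 ^ m \<le> R (Suc m) g \<one>"
        using a step.hyps by (simp add: R_Suc algebra_simps)
      then show ?case using step.IH by simp
    qed
    have "1 - 2 / 2 ^ N \<le> \<Phi> g \<one>"
    proof (rule LIMSEQ_le_const[OF lim], intro exI[of _ N] allI impI)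
      fix m assume "N \<le> m"
      have "(0 :: real) \<le> 2 / 2 ^ m" by simp
      then show "1 - 2 / 2 ^ N \<le> R m g \<one>" using step[OF \<open>N \<le> m\<close>] by linarith
    qed
    then show ?thesis using N by linarith
  qed
  have mix: "(\<lambda>n. \<Phi> (h n \<otimes> g) g') \<longlonglongrightarrow> 0" if g: "g \<in> carrier G" "g' \<in> carrier G" for g g'
  proof -
    obtain i j where ij: "g = e i" "g' = e j" using e_surj g by metis
    have upper: "\<Phi> (h n \<otimes> g) g' \<le> (7 / 8) ^ n" if n: "n \<ge> max N (max 2 (Suc (max i j)))" for n
    proof -
      have hn: "h n \<in> carrier G" using hH H by blast
      \<comment> \<open>In the pseudometric \<open>1 - k n\<close>, moving from \<open>h n\<close> to \<open>h n g\<close> and from \<open>g\'\<close> to 1 costs less than 1/16 each.\<close>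
      have "k n (h n) (h n \<otimes> g) = k n \<one> g" using k_inv[of "h n" \<one> g n] hn g by simp
      moreover have "1 - k n (h n) \<one> \<le> (1 - k n (h n) (h n \<otimes> g)) + (1 - k n (h n \<otimes> g) \<one>)"
        "1 - k n (h n \<otimes> g) \<one> \<le> (1 - k n (h n \<otimes> g) g') + (1 - k n g' \<one>)"
        using k_tri hn g by auto
      moreover have "1 - k n g \<one> < 1 / 16" "1 - k n g' \<one> < 1 / 16"
      proof -
        have "(1 / 4 :: real) ^ n \<le> (1 / 4) ^ 2" using n by (intro power_decreasing) auto
        then have *: "1 / 4 ^ n \<le> (1 / 16 :: real)" by (simp add: power_one_over power2_eq_square)
        show "1 - k n g \<one> < 1 / 16" "1 - k n g' \<one> < 1 / 16"
          using less_le_trans[OF near[of i n] *] less_le_trans[OF near[of j n] *] n unfolding ij by auto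
      qed
      ultimately have "k n (h n \<otimes> g) g' \<le> 7 / 8"
        using far[of n] k_comm[of n \<one> g] by linarith
      have "\<Phi> (h n \<otimes> g) g' \<le> R (Suc n) (h n \<otimes> g) g'" by (rule \<Phi>_le)
      also have "\<dots> \<le> k n (h n \<otimes> g) g' ^ n"
        using n R_bd k_bd by (simp add: R_Suc mult_left_le)
      also have "\<dots> \<le> (7 / 8) ^ n"
        using \<open>k n (h n \<otimes> g) g' \<le> 7 / 8\<close> k_bd by (intro power_mono) auto
      finally show ?thesis .
    qed
    have lower: "0 \<le> \<Phi> g g'" for g g' by (rule LIMSEQ_le_const[OF lim]) (auto simp: R_bd)
    show ?thesis
    proof (rule tendsto_sandwich)
      show "\<forall>\<^sub>F n in sequentially. 0 \<le> \<Phi> (h n \<otimes> g) g'" using lower by simp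
      show "\<forall>\<^sub>F n in sequentially. \<Phi> (h n \<otimes> g) g' \<le> (7 / 8) ^ n"
        unfolding eventually_sequentially using upper by blast
      show "(\<lambda>n. (7 / 8 :: real) ^ n) \<longlonglongrightarrow> 0" by (rule LIMSEQ_power_zero) simp
    qed simp
  qed
  show False using no[OF inv close hH mix] .
qed

section \<open>Uniformly close ergodic actions are conjugate\<close>

context separated_prob begin

text \<open>
  A measurable bijection that agrees at every point with one of countably many automorphisms is an
  automorphism.
\<close>

lemma piecewise_mp_aut:
  fixes c :: "'i \<Rightarrow> 'a \<Rightarrow> 'a"
  assumes ext: "T \<in> extensional (space M)" and bij: "bij_betw T (space M) (space M)"
    and T: "T \<in> M \<rightarrow>\<^sub>M M" and I: "countable I" "I \<noteq> {}" and c: "\<And>i. i \<in> I \<Longrightarrow> c i \<in> mp_aut M"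
    and pw: "\<And>x. x \<in> space M \<Longrightarrow> \<exists>i\<in>I. T x = c i x"
  shows "T \<in> mp_aut M"
proof (rule mp_autI[OF ext bij T])
  define e where "e = from_nat_into I"
  have eI: "e n \<in> I" for n unfolding e_def using I(2) by (rule from_nat_into)
  have inj: "inj_on T (space M)" using bij by (simp add: bij_betw_def)
  define E where "E n = {x \<in> space M. T x = c (e n) x}" for n
  define P where "P n = disjointed E n" for n
  have E: "range E \<subseteq> sets M"
  proof -
    have "E n \<in> sets M" for n
    proof -
      have "Measurable.pred M (\<lambda>x. T x = c (e n) x)"
        by (rule measurable_eq[OF T mp_autD(1)[OF c[OF eI]]])
      then show ?thesis by (simp add: E_def pred_def)
    qed
    then show ?thesis by blast
  qed
  have P: "P n \<in> sets M" for n
    using sets.range_disjointed_sets[OF E] by (auto simp: P_def)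
  have PE: "P n \<subseteq> E n" for n unfolding P_def by (rule disjointed_subset)
  have disj: "disjoint_family P" unfolding P_def by (rule disjoint_family_disjointed)
  have UN: "(\<Union>n. P n) = space M"
  proof -
    have "(\<Union>n. P n) = (\<Union>n. E n)" unfolding P_def by (rule UN_disjointed_eq)
    also have "\<dots> = space M"
    proof (intro equalityI subsetI)
      fix x assume x: "x \<in> space M"
      then obtain i where "i \<in> I" "T x = c i x" using pw[OF x] by auto
      moreover obtain n where "e n = i" using from_nat_into_surj[OF I(1) \<open>i \<in> I\<close>] by (auto simp: e_def)
      ultimately show "x \<in> (\<Union>n. E n)" using x by (auto simp: E_def)
    qed (auto simp: E_def)
    finally show ?thesis .
  qed
  fix A assume A: "A \<in> sets M"
  have img: "T ` (A \<inter> P n) = c (e n) ` (A \<inter> P n)" for n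
    by (rule image_cong) (use PE[of n] in \<open>auto simp: E_def\<close>)
  have AP: "A \<inter> P n \<in> sets M" for n using A P by blast
  have imgs: "T ` (A \<inter> P n) \<in> sets M" for n
    unfolding img by (rule mp_autD(5)[OF c[OF eI] AP])
  have TA: "T ` A = (\<Union>n. T ` (A \<inter> P n))"
  proof -
    have "A = (\<Union>n. A \<inter> P n)" using UN sets.sets_into_space[OF A] by auto
    then show ?thesis by (metis image_UN)
  qed
  show "T ` A \<in> sets M" unfolding TA using imgs by blast
  have d1: "disjoint_family (\<lambda>n. A \<inter> P n)" using disj by (auto simp: disjoint_family_on_def)
  have d2: "disjoint_family (\<lambda>n. T ` (A \<inter> P n))"
    unfolding disjoint_family_on_def
  proof (intro ballI impI)
    fix m n :: nat assume "m \<noteq> n"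
    then have "(A \<inter> P m) \<inter> (A \<inter> P n) = {}" using d1 by (auto simp: disjoint_family_on_def)
    moreover have "A \<inter> P m \<subseteq> space M" "A \<inter> P n \<subseteq> space M" using sets.sets_into_space[OF A] by auto
    ultimately show "T ` (A \<inter> P m) \<inter> T ` (A \<inter> P n) = {}"
      using inj_on_image_Int[OF inj, of "A \<inter> P m" "A \<inter> P n"] by simp
  qed
  have "(\<lambda>n. measure M (A \<inter> P n)) sums measure M (\<Union>n. A \<inter> P n)"
    by (rule finite_measure_UNION) (use AP d1 in auto)
  moreover have "(\<Union>n. A \<inter> P n) = A" using UN sets.sets_into_space[OF A] by auto
  moreover have "(\<lambda>n. measure M (T ` (A \<inter> P n))) sums measure M (T ` A)"
    unfolding TA by (rule finite_measure_UNION) (use imgs d2 in auto)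
  moreover have "measure M (T ` (A \<inter> P n)) = measure M (A \<inter> P n)" for n
    unfolding img by (rule mp_autD(6)[OF c[OF eI] AP])
  ultimately show "measure M (T ` A) = measure M A" by (simp add: sums_unique2)
qed

text \<open>
  Countably many partial maps \<open>c i\<close> on \<open>D i\<close> that fit together to an injection with conull domain and
  range agree almost everywhere with an automorphism. The domain and range themselves can have
  complements of different cardinality; therefore the glued map \<open>S\<close> is only used on the conull set \<open>C\<close> of
  points at which all its iterates, forward and backward, are defined, and is replaced by the identity
  elsewhere. The identity is assumed to be one of the \<open>c i\<close>.
\<close>

lemma partial_iso_extend:
  fixes c :: "'i \<Rightarrow> 'a \<Rightarrow> 'a"
  assumes I: "countable I" and c: "\<And>i. i \<in> I \<Longrightarrow> c i \<in> mp_aut M"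
    and i0: "i0 \<in> I" "\<And>x. x \<in> space M \<Longrightarrow> c i0 x = x"
    and D: "\<And>i. i \<in> I \<Longrightarrow> D i \<in> sets M"
    and inj: "\<And>i j x y. i \<in> I \<Longrightarrow> j \<in> I \<Longrightarrow> x \<in> D i \<Longrightarrow> y \<in> D j \<Longrightarrow> c i x = c j y \<longleftrightarrow> x = y"
    and dom: "AE x in M. x \<in> (\<Union>i\<in>I. D i)" and ran: "AE y in M. y \<in> (\<Union>i\<in>I. c i ` D i)"
  obtains T where "T \<in> mp_aut M" "AE x in M. \<exists>i\<in>I. x \<in> D i \<and> T x = c i x"
proof -
  define A where "A = (\<Union>i\<in>I. D i)"
  define A' where "A' = (\<Union>i\<in>I. c i ` D i)"
  define S where "S x = (if x \<in> A then c (SOME i. i \<in> I \<and> x \<in> D i) x else x)" for x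
  define S' where "S' y = (if y \<in> A' then (SOME x. \<exists>i\<in>I. x \<in> D i \<and> y = c i x) else y)" for y
  have Dsp: "D i \<subseteq> space M" if "i \<in> I" for i using sets.sets_into_space[OF D[OF that]] .
  have S_D: "S x = c i x" if "i \<in> I" "x \<in> D i" for i x
  proof -
    have "(SOME i. i \<in> I \<and> x \<in> D i) \<in> I \<and> x \<in> D (SOME i. i \<in> I \<and> x \<in> D i)"
      by (rule someI[where P="\<lambda>i. i \<in> I \<and> x \<in> D i"]) (use that in blast)
    moreover have "x \<in> A" using that by (auto simp: A_def)
    ultimately show ?thesis using inj[of "SOME i. i \<in> I \<and> x \<in> D i" i x x] that by (simp add: S_def)
  qed
  have S'_D: "S' (c i x) = x" if "i \<in> I" "x \<in> D i" for i x
  proof -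
    let ?P = "\<lambda>z. \<exists>j\<in>I. z \<in> D j \<and> c i x = c j z"
    have "?P (SOME z. ?P z)" by (rule someI[where P="?P"]) (use that in blast)
    then obtain j where "j \<in> I" "(SOME z. ?P z) \<in> D j" "c i x = c j (SOME z. ?P z)" by blast
    then have "(SOME z. ?P z) = x" using inj[of i j x "SOME z. ?P z"] that by simp
    moreover have "c i x \<in> A'" using that by (auto simp: A'_def)
    ultimately show ?thesis by (simp add: S'_def)
  qed
  have SA: "S' (S x) = x" if "x \<in> A" for x using that S_D S'_D by (auto simp: A_def)
  have SA': "S (S' y) = y" if "y \<in> A'" for y using that S_D S'_D by (auto simp: A'_def)
  have S_cases: "\<exists>i\<in>I. S x = c i x" if "x \<in> space M" for x
  proof (cases "x \<in> A")
    case True then show ?thesis using S_D by (auto simp: A_def)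
  next
    case False then show ?thesis using i0 that by (intro bexI[of _ i0]) (auto simp: S_def)
  qed
  define ci where "ci i = inv_into (space M) (c i)" for i
  have ci: "ci i (c i x) = x" if "i \<in> I" "x \<in> space M" for i x
    using mp_autD(2)[OF c[OF that(1)]] that(2) unfolding ci_def by (simp add: bij_betw_def inv_into_f_f)
  have S'_cases: "\<exists>i\<in>I. S' y = ci i y" if "y \<in> space M" for y
  proof (cases "y \<in> A'")
    case True
    then obtain i x where "i \<in> I" "x \<in> D i" "y = c i x" by (auto simp: A'_def)
    moreover from this have "ci i (c i x) = x" using ci[of i x] Dsp[of i] by blast
    ultimately show ?thesis using S'_D[of i x] by (intro bexI[of _ i]) auto
  next
    case False
    have "ci i0 y = y" using ci[OF i0(1) that] i0(2)[OF that] by simp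
    then show ?thesis using False i0 by (intro bexI[of _ i0]) (auto simp: S'_def)
  qed
  have A: "A \<in> sets M" "A' \<in> sets M"
    unfolding A_def A'_def using I D mp_autD(5)[OF c D] by (auto intro!: sets.countable_UN')
  have S_space: "S x \<in> space M" "S' x \<in> space M" if "x \<in> space M" for x
  proof -
    show "S x \<in> space M" using S_cases[OF that] mp_aut_space[OF c that] by auto
    show "S' x \<in> space M"
    proof (cases "x \<in> A'")
      case True
      then obtain i z where "i \<in> I" "z \<in> D i" "x = c i z" by (auto simp: A'_def)
      then show ?thesis using S'_D[of i z] Dsp[of i] by auto
    qed (use that in \<open>simp add: S'_def\<close>)
  qed
  have S_meas: "S \<in> M \<rightarrow>\<^sub>M M"
  proof (rule measurableI)
    fix B assume B: "B \<in> sets M"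
    have "S -` B \<inter> space M = (\<Union>i\<in>I. D i \<inter> (c i -` B \<inter> space M)) \<union> (B - A)"
    proof (intro equalityI subsetI)
      fix x assume x: "x \<in> S -` B \<inter> space M"
      show "x \<in> (\<Union>i\<in>I. D i \<inter> (c i -` B \<inter> space M)) \<union> (B - A)"
      proof (cases "x \<in> A")
        case True then show ?thesis using x S_D by (auto simp: A_def)
      qed (use x in \<open>simp add: S_def\<close>)
    next
      fix x assume "x \<in> (\<Union>i\<in>I. D i \<inter> (c i -` B \<inter> space M)) \<union> (B - A)"
      then show "x \<in> S -` B \<inter> space M"
      proof
        assume "x \<in> B - A" then show ?thesis using sets.sets_into_space[OF B] by (auto simp: S_def)
      qed (use S_D in auto)
    qed
    also have "\<dots> \<in> sets M"
      using I D A B measurable_sets[OF mp_autD(1)[OF c] B]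
      by (intro sets.Un sets.Diff sets.countable_UN') auto
    finally show "S -` B \<inter> space M \<in> sets M" .
  qed (rule S_space)
  have S'_meas: "S' \<in> M \<rightarrow>\<^sub>M M"
  proof (rule measurableI)
    fix B assume B: "B \<in> sets M"
    have "S' -` B \<inter> space M = (\<Union>i\<in>I. c i ` (D i \<inter> B)) \<union> (B - A')"
    proof (intro equalityI subsetI)
      fix y assume y: "y \<in> S' -` B \<inter> space M"
      show "y \<in> (\<Union>i\<in>I. c i ` (D i \<inter> B)) \<union> (B - A')"
      proof (cases "y \<in> A'")
        case True
        then obtain i x where ix: "i \<in> I" "x \<in> D i" "y = c i x" by (auto simp: A'_def)
        then have "x \<in> B" using y S'_D[of i x] by simp
        then show ?thesis using ix by blast
      qed (use y in \<open>simp add: S'_def\<close>)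
    next
      fix y assume "y \<in> (\<Union>i\<in>I. c i ` (D i \<inter> B)) \<union> (B - A')"
      then show "y \<in> S' -` B \<inter> space M"
      proof
        assume "y \<in> B - A'" then show ?thesis using sets.sets_into_space[OF B] by (auto simp: S'_def)
      next
        assume "y \<in> (\<Union>i\<in>I. c i ` (D i \<inter> B))"
        then obtain i x where ix: "i \<in> I" "x \<in> D i" "x \<in> B" "y = c i x" by auto
        then show ?thesis using S'_D[of i x] mp_aut_space[OF c[OF ix(1)], of x] Dsp[of i] by auto
      qed
    qed
    also have "\<dots> \<in> sets M"
      using I A B mp_autD(5)[OF c sets.Int[OF D B]]
      by (intro sets.Un sets.Diff sets.countable_UN') auto
    finally show "S' -` B \<inter> space M \<in> sets M" .
  qed (rule S_space)
  have AE_S: "AE x in M. P (S x)" if "AE x in M. P x" for P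
  proof -
    have "AE x in M. \<forall>i\<in>I. P (c i x)"
      using mp_aut_AE[OF c that] by (simp add: AE_ball_countable[OF I])
    then show ?thesis
      using AE_space
    proof eventually_elim
      fix x assume "\<forall>i\<in>I. P (c i x)" "x \<in> space M"
      then show "P (S x)" using S_cases[of x] by auto
    qed
  qed
  have AE_S': "AE x in M. P (S' x)" if "AE x in M. P x" for P
  proof -
    have "AE x in M. \<forall>i\<in>I. P (restrict (ci i) (space M) x)"
      using mp_aut_AE[OF mp_aut_inverse[OF c] that] by (simp add: AE_ball_countable[OF I] ci_def)
    then show ?thesis
      using AE_space
    proof eventually_elim
      fix x assume "\<forall>i\<in>I. P (restrict (ci i) (space M) x)" "x \<in> space M"
      then show "P (S' x)" using S'_cases[of x] by auto
    qed
  qed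
  define B where "B = A \<inter> A'"
  have B: "B \<in> sets M" using A by (auto simp: B_def)
  have AE_B: "AE x in M. x \<in> B" using dom ran by eventually_elim (auto simp: B_def A_def A'_def)
  have AE_pow: "AE x in M. (S ^^ n) x \<in> B" "AE x in M. (S' ^^ n) x \<in> B" for n
  proof (induction n)
    case (Suc n)
    show "AE x in M. (S ^^ Suc n) x \<in> B" "AE x in M. (S' ^^ Suc n) x \<in> B"
      using AE_S[OF Suc(1)] AE_S'[OF Suc(2)] by (simp_all add: funpow_Suc_right del: funpow.simps)
  qed (use AE_B in simp_all)
  define C where "C = {x \<in> space M. \<forall>n. (S ^^ n) x \<in> B \<and> (S' ^^ n) x \<in> B}"
  have pow_meas: "(S ^^ n) \<in> M \<rightarrow>\<^sub>M M" "(S' ^^ n) \<in> M \<rightarrow>\<^sub>M M" for n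
    by (induction n) (auto intro: measurable_comp S_meas S'_meas)
  have C_sets: "C \<in> sets M"
  proof -
    have "C = (\<Inter>n. ((S ^^ n) -` B \<inter> space M) \<inter> ((S' ^^ n) -` B \<inter> space M))"
      by (auto simp: C_def)
    then show ?thesis
      using measurable_sets[OF pow_meas(1) B] measurable_sets[OF pow_meas(2) B] by auto
  qed
  have C_AE: "AE x in M. x \<in> C"
  proof -
    have "AE x in M. \<forall>n. (S ^^ n) x \<in> B \<and> (S' ^^ n) x \<in> B"
      using AE_pow by (simp add: AE_all_countable)
    then show ?thesis using AE_space by eventually_elim (auto simp: C_def)
  qed
  have CB: "x \<in> A" "x \<in> A'" "x \<in> space M" "(S ^^ n) x \<in> B" "(S' ^^ n) x \<in> B" if "x \<in> C" for x n
  proof -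
    show *: "(S ^^ n) x \<in> B" "(S' ^^ n) x \<in> B" "x \<in> space M" for n using that by (auto simp: C_def)
    show "x \<in> A" "x \<in> A'" using *(1)[of 0] by (auto simp: B_def)
  qed
  have SC: "S x \<in> C" if "x \<in> C" for x
  proof -
    have "(S ^^ n) (S x) \<in> B" for n using CB(4)[OF that, of "Suc n"] by (simp add: funpow_Suc_right del: funpow.simps)
    moreover have "(S' ^^ n) (S x) \<in> B" for n
    proof (cases n)
      case 0 then show ?thesis using CB(4)[OF that, of 1] by simp
    next
      case (Suc m)
      then have "(S' ^^ n) (S x) = (S' ^^ m) x"
        using SA[OF CB(1)[OF that]] by (simp add: funpow_Suc_right del: funpow.simps)
      then show ?thesis using CB(5)[OF that, of m] by simp
    qed
    ultimately show ?thesis using S_space(1)[OF CB(3)[OF that]] by (simp add: C_def)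
  qed
  have S'C: "S' x \<in> C" if "x \<in> C" for x
  proof -
    have "(S' ^^ n) (S' x) \<in> B" for n using CB(5)[OF that, of "Suc n"] by (simp add: funpow_Suc_right del: funpow.simps)
    moreover have "(S ^^ n) (S' x) \<in> B" for n
    proof (cases n)
      case 0 then show ?thesis using CB(5)[OF that, of 1] by simp
    next
      case (Suc m)
      then have "(S ^^ n) (S' x) = (S ^^ m) x"
        using SA'[OF CB(2)[OF that]] by (simp add: funpow_Suc_right del: funpow.simps)
      then show ?thesis using CB(4)[OF that, of m] by simp
    qed
    ultimately show ?thesis using S_space(2)[OF CB(3)[OF that]] by (simp add: C_def)
  qed
  define T where "T = restrict (\<lambda>x. if x \<in> C then S x else x) (space M)"
  define T' where "T' x = (if x \<in> C then S' x else x)" for x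
  have T_simps: "T x = (if x \<in> C then S x else x)" if "x \<in> space M" for x
    using that by (simp add: T_def)
  have "T \<in> mp_aut M"
  proof (rule piecewise_mp_aut[of T I c])
    show "T \<in> extensional (space M)" by (simp add: T_def)
    show "bij_betw T (space M) (space M)"
      by (rule bij_betw_byWitness[where f'=T'])
        (auto simp: T_simps T'_def SC S'C SA SA' CB S_space split: if_splits)
    have "(\<lambda>x. if x \<in> C then S x else x) \<in> M \<rightarrow>\<^sub>M M"
      using C_sets S_meas by (intro measurable_If) (auto simp: pred_def)
    then show "T \<in> M \<rightarrow>\<^sub>M M" unfolding T_def by (simp cong: measurable_cong)
    show "\<exists>i\<in>I. T x = c i x" if "x \<in> space M" for x
    proof (cases "x \<in> C")
      case True then show ?thesis using S_cases[OF that] that by (simp add: T_simps)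
    next
      case False then show ?thesis using i0(2)[OF that] that by (intro bexI[OF _ i0(1)]) (simp add: T_simps)
    qed
  qed (use I i0 c in auto)
  moreover have "AE x in M. \<exists>i\<in>I. x \<in> D i \<and> T x = c i x"
    using C_AE
  proof eventually_elim
    fix x assume x: "x \<in> C"
    then obtain i where "i \<in> I" "x \<in> D i" using CB(1)[OF x] by (auto simp: A_def)
    then show "\<exists>i\<in>I. x \<in> D i \<and> T x = c i x"
      using x CB(3)[OF x] S_D by (intro bexI[of _ i]) (auto simp: T_simps)
  qed
  ultimately show ?thesis by (rule that)
qed

end

lemma rform_add_kernel: "rform (\<lambda>i j. K i j + L i j) xs ys = rform K xs ys + rform L xs ys"
  by (simp add: rform_def distrib_left sum_list_addf)

lemma rform_rank_one:
  "rform (\<lambda>i j. u i * v j) xs ys = (\<Sum>x\<leftarrow>xs. fst x * u (snd x)) * (\<Sum>y\<leftarrow>ys. fst y * v (snd y))"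
proof -
  have "rform (\<lambda>i j. u i * v j) xs ys = (\<Sum>x\<leftarrow>xs. \<Sum>y\<leftarrow>ys. (fst x * u (snd x)) * (fst y * v (snd y)))"
    by (simp add: rform_def mult_ac)
  then show ?thesis by (simp only: sum_list_const_mult sum_list_mult_const)
qed

context action_pair begin

text \<open>
  The function \<open>f\<^sub>w(x, y) = \<Sum>g. w(g) [c\<^sub>g x = y]\<close> of a formal combination \<open>w\<close>, the convex combinations of group
  elements, and the left translates of a combination.
\<close>

definition val :: "(real \<times> 'g) list \<Rightarrow> 'x \<Rightarrow> 'x \<Rightarrow> real" where
  "val w x y = (\<Sum>p\<leftarrow>w. fst p * of_bool (tw (snd p) x = y))"

definition conv :: "(real \<times> 'g) list set" where
  "conv = {w. snd ` set w \<subseteq> carrier G \<and> (\<forall>p\<in>set w. 0 \<le> fst p) \<and> (\<Sum>p\<leftarrow>w. fst p) = 1}"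

definition tr :: "'g \<Rightarrow> (real \<times> 'g) list \<Rightarrow> (real \<times> 'g) list" where
  "tr k w = relabel (\<lambda>g. k \<otimes> g) w"

text \<open>
  The form of \<open>same x\<close> at \<open>w\<close> is \<open>\<Sum>y. f\<^sub>w(x, y)\<^sup>2\<close>, which dominates each of its terms.
\<close>

lemma val_sq_le: "(val w x y)\<^sup>2 \<le> rform (same x) w w"
proof -
  define u where "u g = (of_bool (tw g x = y) :: real)" for g
  define v where "v g = (of_bool (tw g x \<noteq> y) :: real)" for g
  let ?L = "\<lambda>g h. if tw g x = tw h x then v g * v h * 1 else 0"
  have "positive_on UNIV ?L"
    by (intro positive_on_classes positive_on_rank_one positive_on_const)
  then have "0 \<le> rform ?L w w" by (simp add: positive_on_def)
  moreover have "rform (\<lambda>g h. u g * u h) w w = (val w x y)\<^sup>2"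
    by (simp add: rform_rank_one val_def u_def power2_eq_square)
  moreover have "rform (same x) w w = rform (\<lambda>g h. u g * u h + ?L g h) w w"
    by (rule rform_cong) (auto simp: same_def u_def v_def)
  ultimately show ?thesis by (simp only: rform_add_kernel)
qed

lemma val_append: "val (v @ w) x y = val v x y + val w x y"
  by (simp add: val_def)

lemma val_scale: "val (scale_comb a w) x y = a * val w x y"
  by (simp add: val_def scale_comb_def o_def sum_list_const_mult mult.assoc)

lemma val_tw: "val w x (tw h x) = rform (same x) w [(1, h)]"
proof -
  have "fst p * of_bool (tw (snd p) x = tw h x) = fst p * same x (snd p) h" for p :: "real \<times> 'g"
    by (simp add: same_def)
  then have "val w x (tw h x) = (\<Sum>p\<leftarrow>w. fst p * same x (snd p) h)" by (simp only: val_def)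
  then show ?thesis by (simp add: rform_def)
qed

lemma val_tr:
  assumes "k \<in> carrier G" "x \<in> space M" "y \<in> space M" "snd ` set w \<subseteq> carrier G"
  shows "val (tr k w) (\<sigma> k x) (\<tau> k y) = val w x y"
proof -
  have "tw (k \<otimes> snd p) (\<sigma> k x) = \<tau> k y \<longleftrightarrow> tw (snd p) x = y" if "p \<in> set w" for p
  proof -
    have "snd p \<in> carrier G" using that assms(4) by auto
    then show ?thesis
      using assms by (simp add: tw_equivariant mp_aut_inj[OF t_aut] tw_space)
  qed
  then show ?thesis
    unfolding val_def tr_def relabel_def map_map o_def by (auto intro!: arg_cong[where f=sum_list] map_cong)
qed

lemma conv_carrier: "w \<in> conv \<Longrightarrow> snd ` set w \<subseteq> carrier G"
  by (simp add: conv_def)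

lemma conv_tr: "w \<in> conv \<Longrightarrow> k \<in> carrier G \<Longrightarrow> tr k w \<in> conv"
  by (auto simp: conv_def tr_def relabel_def o_def)

lemma conv_mid:
  assumes "v \<in> conv" "w \<in> conv"
  shows "scale_comb (1/2) (v @ w) \<in> conv"
proof -
  have "(\<Sum>p\<leftarrow>scale_comb (1/2) (v @ w). fst p) = 1/2 * ((\<Sum>p\<leftarrow>v. fst p) + (\<Sum>p\<leftarrow>w. fst p))"
    unfolding scale_comb_def map_map o_def fst_conv sum_list_const_mult by simp
  then show ?thesis using assms by (auto simp: conv_def scale_comb_def)
qed

lemma co_tr:
  assumes "w \<in> conv" "k \<in> carrier G"
  shows "rform co (tr k w) (tr k w) = rform co w w"
  unfolding tr_def rform_shift
  by (rule rform_cong) (use assms co_invariant conv_carrier in blast)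

text \<open>
  The third and fourth claims say that \<open>f\<^sub>w\<close> takes total mass at most 1 on any two points of a row or of
  a column. The fourth uses that the maps \<open>c\<^sub>g\<close> are injective.
\<close>

lemma val_conv:
  assumes "w \<in> conv"
  shows "0 \<le> val w x y" "val w x y \<le> 1"
    "y \<noteq> y' \<Longrightarrow> val w x y + val w x y' \<le> 1"
    "x \<in> space M \<Longrightarrow> x' \<in> space M \<Longrightarrow> x \<noteq> x' \<Longrightarrow> val w x y + val w x' y \<le> 1"
    "y \<notin> (\<lambda>g. tw g x) ` carrier G \<Longrightarrow> val w x y = 0"
proof -
  note w = assms[unfolded conv_def, simplified]
  have le: "(\<Sum>p\<leftarrow>w. fst p * u p) \<le> 1" if "\<And>p. p \<in> set w \<Longrightarrow> u p \<le> 1" for u :: "real \<times> 'g \<Rightarrow> real"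
  proof -
    have "(\<Sum>p\<leftarrow>w. fst p * u p) \<le> (\<Sum>p\<leftarrow>w. fst p)"
      using w that by (intro sum_list_mono) (auto intro!: mult_left_le)
    then show ?thesis using w by simp
  qed
  show "0 \<le> val w x y" unfolding val_def using w by (intro sum_list_nonneg) auto
  show "val w x y \<le> 1" unfolding val_def by (rule le) simp
  show "val w x y + val w x y' \<le> 1" if "y \<noteq> y'"
    unfolding val_def sum_list_addf[symmetric] distrib_left[symmetric] by (rule le) (use that in auto)
  show "val w x y + val w x' y \<le> 1" if "x \<in> space M" "x' \<in> space M" "x \<noteq> x'"
    unfolding val_def sum_list_addf[symmetric] distrib_left[symmetric]
  proof (rule le)
    fix p assume "p \<in> set w"
    then have "snd p \<in> carrier G" using w by auto
    then show "of_bool (tw (snd p) x = y) + of_bool (tw (snd p) x' = y) \<le> (1::real)"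
      using that mp_aut_inj[OF tw_aut, of "snd p" x x'] by auto
  qed
  show "val w x y = 0" if "y \<notin> (\<lambda>g. tw g x) ` carrier G"
  proof -
    have "fst p * of_bool (tw (snd p) x = y) = 0" if "p \<in> set w" for p
      using that \<open>y \<notin> _\<close> w by auto
    then have eq: "map (\<lambda>p. fst p * of_bool (tw (snd p) x = y)) w = map (\<lambda>p. 0 :: real) w"
      by (intro map_cong refl)
    show ?thesis unfolding val_def eq by simp
  qed
qed

text \<open>
  Since the form of \<open>co\<close> is the integral of the forms of \<open>same x\<close>, geometric decay of the former gives
  geometric decay of the latter at almost every \<open>x\<close>, by Markov and Borel--Cantelli.
\<close>

lemma AE_small:
  assumes v: "\<And>n::nat. snd ` set (v n) \<subseteq> carrier G" and small: "\<And>n. rform co (v n) (v n) \<le> (1/8) ^ n"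
  shows "AE x in M. \<forall>\<^sub>F n in sequentially. rform (same x) (v n) (v n) < (1/4) ^ n"
proof -
  let ?Q = "\<lambda>n x. rform (same x) (v n) (v n)"
  have int: "integrable M (?Q n)" "(\<integral>x. ?Q n x \<partial>M) = rform co (v n) (v n)" for n
  proof -
    have i: "integrable M (\<lambda>z. same z i j)" if "i \<in> snd ` set (v n)" "j \<in> snd ` set (v n)" for i j
      by (rule same_integral(1)) (use v that in blast)+
    show "integrable M (?Q n)" using i by (rule rform_integral(1))
    have "(\<integral>x. ?Q n x \<partial>M) = rform (\<lambda>i j. \<integral>z. same z i j \<partial>M) (v n) (v n)" using i by (rule rform_integral(2))
    also have "\<dots> = rform co (v n) (v n)" by (rule rform_cong) (use same_integral(2) v in blast)
    finally show "(\<integral>x. ?Q n x \<partial>M) = rform co (v n) (v n)" .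
  qed
  have nonneg: "0 \<le> ?Q n x" for n x using val_sq_le[of "v n" x x] zero_le_power2 order_trans by blast
  let ?A = "\<lambda>n. {x \<in> space M. ?Q n x \<ge> (1/4) ^ n}"
  have A: "?A n \<in> sets M" for n using int(1)[of n] by measurable
  have "measure M (?A n) \<le> (1/2) ^ n" for n
  proof -
    have "measure M (?A n) \<le> (\<integral>x. ?Q n x \<partial>M) / (1/4) ^ n"
      by (rule integral_Markov_inequality_measure[of M "?Q n" "{}"]) (use int nonneg in auto)
    also have "\<dots> \<le> (1/8) ^ n / (1/4) ^ n"
      unfolding int using small by (intro divide_right_mono) auto
    also have "\<dots> = (1/2) ^ n" by (simp flip: power_divide)
    finally show ?thesis .
  qed
  then have "summable (\<lambda>n. measure M (?A n))"
    by (intro summable_comparison_test'[OF summable_geometric[of "1/2 :: real"]]) auto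
  then have "AE x in M. \<forall>\<^sub>F n in sequentially. x \<in> space M - ?A n"
    using A by (intro borel_cantelli_AE1) (auto simp: emeasure_eq_measure)
  then show ?thesis
  proof eventually_elim
    case (elim x)
    then show ?case by eventually_elim auto
  qed
qed

text \<open>
  By the parallelogram law, two convex combinations at which the form is nearly minimal are close.
  This applies to consecutive members of a minimising sequence, and to a member and its translates.
\<close>

lemma minimizing_sequence:
  obtains w where "\<And>n::nat. w n \<in> conv"
    "\<And>n. rform co (w (Suc n) @ scale_comb (-1) (w n)) (w (Suc n) @ scale_comb (-1) (w n)) \<le> (1/8) ^ n"
    "\<And>n k. k \<in> carrier G \<Longrightarrow> rform co (tr k (w n) @ scale_comb (-1) (w n)) (tr k (w n) @ scale_comb (-1) (w n)) \<le> (1/8) ^ n"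
proof -
  let ?q = "\<lambda>w. rform co w w"
  define I where "I = Inf (?q ` conv)"
  have "positive_on (carrier G) co"
    using positive_on_mult_co[OF positive_on_const] by simp
  then have "bdd_below (?q ` conv)"
    by (intro bdd_belowI[of _ 0]) (auto simp: positive_on_def conv_carrier)
  then have I_le: "I \<le> ?q w" if "w \<in> conv" for w
    unfolding I_def using that by (intro cInf_lower) auto
  have "[(1, \<one>)] \<in> conv" by (simp add: conv_def)
  then have ne: "?q ` conv \<noteq> {}" by blast
  have "\<exists>w\<in>conv. ?q w < I + (1/8) ^ n / 4" for n :: nat
    using cInf_lessD[OF ne, of "I + (1/8) ^ n / 4"] by (auto simp: I_def)
  then obtain w where w: "\<And>n. w n \<in> conv" "\<And>n. ?q (w n) < I + (1/8) ^ n / 4" by metis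
  have par: "?q (u @ scale_comb (-1) v) \<le> 2 * (?q u - I) + 2 * (?q v - I)" if "u \<in> conv" "v \<in> conv" for u v
    using I_le[OF conv_mid[OF that]] by (simp add: rform_linear algebra_simps)
  have arith: "s \<le> c" if "s \<le> 2 * (x - I) + 2 * (y - I)" "x < I + b / 4" "y < I + c / 4" "b \<le> c" for s x y b c
    using that by (simp add: field_simps)
  show ?thesis
  proof (rule that[of w])
    fix n
    have "(1/8 :: real) ^ Suc n \<le> (1/8) ^ n" by (rule power_decreasing) auto
    then show "?q (w (Suc n) @ scale_comb (-1) (w n)) \<le> (1/8) ^ n"
      by (rule arith[OF par[OF w(1) w(1)] w(2) w(2)])
    show "?q (tr k (w n) @ scale_comb (-1) (w n)) \<le> (1/8) ^ n" if "k \<in> carrier G" for k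
      by (rule arith[OF par[OF conv_tr[OF w(1) that] w(1)] _ w(2) order_refl])
        (simp add: co_tr[OF w(1) that] w(2))
  qed (rule w)
qed


text \<open>
  The conjugacy is the graph of \<open>f > 1/2\<close>, where \<open>f\<close> is the limit of the functions of a minimising
  sequence of convex combinations. Any constant above 1/2 would do in place of 3/4.
\<close>

lemma conjugate_if_close:
  assumes G_count: "countable (carrier G)"
    and erg: "ergodic_action G M \<sigma>" "ergodic_action G M \<tau>"
    and close: "\<And>h. h \<in> carrier G \<Longrightarrow> 3 / 4 \<le> co h \<one>"
  shows "conjugate_on (carrier G) M \<sigma> \<tau>"
proof -
  obtain w where w: "\<And>n::nat. w n \<in> conv"
    and w_step: "\<And>n. rform co (w (Suc n) @ scale_comb (-1) (w n)) (w (Suc n) @ scale_comb (-1) (w n)) \<le> (1/8) ^ n"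
    and w_tr: "\<And>n k. k \<in> carrier G \<Longrightarrow>
        rform co (tr k (w n) @ scale_comb (-1) (w n)) (tr k (w n) @ scale_comb (-1) (w n)) \<le> (1/8) ^ n"
    by (rule minimizing_sequence) (rule that; assumption)
  define dl where "dl u v = u @ scale_comb (-1) v" for u v :: "(real \<times> 'g) list"
  have dl_carrier: "snd ` set (dl u v) \<subseteq> carrier G" if "u \<in> conv" "v \<in> conv" for u v
    using conv_carrier[OF that(1)] conv_carrier[OF that(2)] by (simp add: dl_def image_Un)
  have val_dl: "\<bar>val u x y - val v x y\<bar> \<le> (1/2) ^ n"
    if "rform (same x) (dl u v) (dl u v) < (1/4) ^ n" for u v x y n
  proof -
    have "(val u x y - val v x y)\<^sup>2 = (val (dl u v) x y)\<^sup>2" by (simp add: dl_def val_append val_scale)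
    also have "\<dots> \<le> rform (same x) (dl u v) (dl u v)" by (rule val_sq_le)
    also have "\<dots> \<le> ((1/2) ^ n)\<^sup>2" using that by (simp add: power2_eq_square flip: power_mult_distrib)
    finally show ?thesis by (simp add: abs_le_square_iff[symmetric])
  qed

  \<comment> \<open>At a good point \<open>f\<^sub>w\<close> converges along the sequence, with the same limit for all translated sequences.\<close>
  define good where "good x \<longleftrightarrow>
     (\<forall>\<^sub>F n in sequentially. rform (same x) (dl (w (Suc n)) (w n)) (dl (w (Suc n)) (w n)) < (1/4) ^ n) \<and>
     (\<forall>k\<in>carrier G. \<forall>\<^sub>F n in sequentially. rform (same x) (dl (tr k (w n)) (w n)) (dl (tr k (w n)) (w n)) < (1/4) ^ n)" for x
  have "AE x in M. good x"
  proof -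
    have "AE x in M. \<forall>\<^sub>F n in sequentially. rform (same x) (dl (w (Suc n)) (w n)) (dl (w (Suc n)) (w n)) < (1/4) ^ n"
      by (rule AE_small) (use dl_carrier w w_step in \<open>auto simp: dl_def\<close>)
    moreover have "AE x in M. \<forall>k\<in>carrier G. \<forall>\<^sub>F n in sequentially.
        rform (same x) (dl (tr k (w n)) (w n)) (dl (tr k (w n)) (w n)) < (1/4) ^ n"
      unfolding AE_ball_countable[OF G_count]
    proof
      fix k assume "k \<in> carrier G"
      then show "AE x in M. \<forall>\<^sub>F n in sequentially.
          rform (same x) (dl (tr k (w n)) (w n)) (dl (tr k (w n)) (w n)) < (1/4) ^ n"
        using dl_carrier[OF conv_tr[OF w] w] w_tr by (intro AE_small) (auto simp: dl_def)
    qed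
    ultimately show ?thesis by eventually_elim (simp add: good_def)
  qed
  then obtain N where N: "{x \<in> space M. \<not> good x} \<subseteq> N" "N \<in> null_sets M"
    by (auto simp: eventually_ae_filter)
  \<comment> \<open>The conull set \<open>X\<close> is exactly invariant under \<open>\<sigma>\<close>, as ergodicity refers to exactly invariant sets.\<close>
  define X where "X = {x \<in> space M. \<forall>k\<in>carrier G. \<sigma> k x \<notin> N}"
  have X_sets: "X \<in> sets M"
  proof -
    have "Measurable.pred M (\<lambda>x. \<sigma> k x \<notin> N)" if "k \<in> carrier G" for k
    proof -
      have "\<sigma> k -` (space M - N) \<inter> space M \<in> sets M"
        using N(2) mp_autD(1)[OF s_aut[OF that]] by (intro measurable_sets) auto
      moreover have "\<sigma> k -` (space M - N) \<inter> space M = {x \<in> space M. \<sigma> k x \<notin> N}"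
        using s_space[OF that] by auto
      ultimately show ?thesis by (simp add: pred_def)
    qed
    then have "Measurable.pred M (\<lambda>x. \<forall>k\<in>carrier G. \<sigma> k x \<notin> N)"
      by (rule measurable_pred_countable[OF G_count])
    then show ?thesis by (simp add: X_def pred_def)
  qed
  have X_space: "x \<in> space M" if "x \<in> X" for x using that by (simp add: X_def)
  have X_AE: "AE x in M. x \<in> X"
  proof -
    have "AE x in M. \<forall>k\<in>carrier G. \<sigma> k x \<notin> N"
      unfolding AE_ball_countable[OF G_count] using mp_aut_AE[OF s_aut AE_not_in[OF N(2)]] by blast
    then show ?thesis using AE_space by eventually_elim (simp add: X_def)
  qed
  have X_inv: "\<sigma> k x \<in> X" if "k \<in> carrier G" "x \<in> X" for k x
  proof -
    have "\<sigma> l (\<sigma> k x) \<notin> N" if "l \<in> carrier G" for l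
    proof -
      have "\<sigma> (l \<otimes> k) x \<notin> N" using \<open>x \<in> X\<close> m_closed[OF that \<open>k \<in> carrier G\<close>] by (simp add: X_def)
      moreover have "\<sigma> (l \<otimes> k) x = \<sigma> l (\<sigma> k x)"
        using act_s that \<open>k \<in> carrier G\<close> X_space[OF \<open>x \<in> X\<close>] by (simp add: pmp_action_def)
      ultimately show ?thesis by simp
    qed
    then show ?thesis using that s_space[OF that(1)] by (simp add: X_def)
  qed
  have X_good: "good (\<sigma> k x)" if "k \<in> carrier G" "x \<in> X" for k x
    using N(1) that s_space[OF that(1)] by (auto simp: X_def)
  have X_good1: "good x" if "x \<in> X" for x
    using X_good[OF one_closed that] act_s X_space[OF that] by (simp add: pmp_action_def)

  define f where "f x y = lim (\<lambda>n. val (w n) x y)" for x y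
  have f_lim: "(\<lambda>n. val (w n) x y) \<longlonglongrightarrow> f x y" if "x \<in> X" for x y
  proof -
    have "\<forall>\<^sub>F n in sequentially. rform (same x) (dl (w (Suc n)) (w n)) (dl (w (Suc n)) (w n)) < (1/4) ^ n"
      using X_good1[OF that] by (simp add: good_def)
    then have "\<forall>\<^sub>F n in sequentially. norm (val (w (Suc n)) x y - val (w n) x y) \<le> (1/2) ^ n"
      by (rule eventually_mono) (simp add: val_dl)
    then have "summable (\<lambda>n. val (w (Suc n)) x y - val (w n) x y)"
      by (rule summable_comparison_test_ev) (simp add: summable_geometric)
    then have "convergent (\<lambda>n. \<Sum>i<n. val (w (Suc i)) x y - val (w i) x y)"
      by (simp add: summable_iff_convergent)
    then have "convergent (\<lambda>n. val (w n) x y - val (w 0) x y)"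
      unfolding sum_lessThan_telescope[of "\<lambda>n. val (w n) x y"] .
    then have "convergent (\<lambda>n. (val (w n) x y - val (w 0) x y) + val (w 0) x y)"
      by (intro convergent_add convergent_const)
    then show ?thesis by (simp add: f_def convergent_LIMSEQ_iff)
  qed
  have f_inv: "f (\<sigma> k x) (\<tau> k y) = f x y" if "k \<in> carrier G" "x \<in> X" "y \<in> space M" for k x y
  proof -
    have "\<forall>\<^sub>F n in sequentially. rform (same (\<sigma> k x)) (dl (tr k (w n)) (w n)) (dl (tr k (w n)) (w n)) < (1/4) ^ n"
      using X_good[OF that(1,2)] that(1) by (simp add: good_def)
    then have "\<forall>\<^sub>F n in sequentially. norm (val (tr k (w n)) (\<sigma> k x) (\<tau> k y) - val (w n) (\<sigma> k x) (\<tau> k y)) \<le> (1/2) ^ n"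
      by (rule eventually_mono) (simp add: val_dl)
    then have "(\<lambda>n. val (tr k (w n)) (\<sigma> k x) (\<tau> k y) - val (w n) (\<sigma> k x) (\<tau> k y)) \<longlonglongrightarrow> 0"
      by (rule Lim_null_comparison) (rule LIMSEQ_power_zero, simp)
    then have "(\<lambda>n. val (w n) x y - val (w n) (\<sigma> k x) (\<tau> k y)) \<longlonglongrightarrow> 0"
      using val_tr[OF that(1) X_space[OF that(2)] that(3) conv_carrier[OF w]] by simp
    moreover have "(\<lambda>n. val (w n) x y - val (w n) (\<sigma> k x) (\<tau> k y)) \<longlonglongrightarrow> f x y - f (\<sigma> k x) (\<tau> k y)"
      by (intro tendsto_diff f_lim X_inv that)
    ultimately have "0 = f x y - f (\<sigma> k x) (\<tau> k y)" by (rule LIMSEQ_unique)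
    then show ?thesis by simp
  qed
  have f_row: "f x y + f x y' \<le> 1" if "x \<in> X" "y \<noteq> y'" for x y y'
    by (rule LIMSEQ_le_const2[OF tendsto_add[OF f_lim f_lim]]) (use that val_conv(3)[OF w] in auto)
  have f_col: "f x y + f x' y \<le> 1" if "x \<in> X" "x' \<in> X" "x \<noteq> x'" for x x' y
    by (rule LIMSEQ_le_const2[OF tendsto_add[OF f_lim f_lim]]) (use that val_conv(4)[OF w] X_space in auto)
  have f_supp: "\<exists>g\<in>carrier G. y = tw g x" if "x \<in> X" "f x y > 1/2" for x y
  proof (rule ccontr)
    assume "\<not> ?thesis"
    then have "y \<notin> (\<lambda>g. tw g x) ` carrier G" by blast
    then have "val (w n) x y = 0" for n by (rule val_conv(5)[OF w])
    then have "f x y = 0" using f_lim[OF that(1), of y] by (simp add: LIMSEQ_const_iff)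
    then show False using that by simp
  qed

  define D where "D g = {x \<in> X. f x (tw g x) > 1/2}" for g
  have D_X: "x \<in> X" "x \<in> space M" if "x \<in> D g" for x g using that X_space by (auto simp: D_def)
  have f_meas: "(\<lambda>x. f x (tw g x)) \<in> borel_measurable M" if "g \<in> carrier G" for g
  proof -
    have "(\<lambda>x. val (w n) x (tw g x)) \<in> borel_measurable M" for n
    proof -
      have "integrable M (\<lambda>x. rform (same x) (w n) [(1, g)])"
        by (rule rform_integral(1), rule same_integral(1)) (use conv_carrier[OF w] that in auto)
      then show ?thesis unfolding val_tw by (rule borel_measurable_integrable)
    qed
    then show ?thesis unfolding f_def by (rule borel_measurable_lim_metric)
  qed
  have D_sets: "D g \<in> sets M" if "g \<in> carrier G" for g
  proof -
    have "D g = X \<inter> ((\<lambda>x. f x (tw g x)) -` {1/2<..} \<inter> space M)" using X_space by (auto simp: D_def)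
    then show ?thesis using X_sets measurable_sets[OF f_meas[OF that], of "{1/2<..}"] by auto
  qed
  \<comment> \<open>\<open>B\<close> is an invariant relation; two values above 1/2 in one row or column would have sum above 1.\<close>
  define B where "B x y \<longleftrightarrow> x \<in> X \<and> y \<in> space M \<and> f x y > 1/2" for x y
  have B_inv: "B (\<sigma> k x) (\<tau> k y)" if "k \<in> carrier G" "B x y" for k x y
    using that f_inv X_inv t_space by (auto simp: B_def)
  have B_iff: "B x y \<longleftrightarrow> (\<exists>g\<in>carrier G. x \<in> D g \<and> y = tw g x)" for x y
    using f_supp[of x y] X_space tw_space by (auto simp: B_def D_def)
  have B_row: "y = y'" if "B x y" "B x y'" for x y y'
    using f_row[of x y y'] that by (force simp: B_def)
  have B_col: "x = x'" if "B x y" "B x' y" for x x' y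
    using f_col[of x x' y] that by (force simp: B_def)
  define A where "A = (\<Union>g\<in>carrier G. D g)"
  define A' where "A' = (\<Union>g\<in>carrier G. tw g ` D g)"
  have A_iff: "x \<in> A \<longleftrightarrow> (\<exists>y. B x y)" for x by (auto simp: A_def B_iff)
  have A'_iff: "y \<in> A' \<longleftrightarrow> (\<exists>x. B x y)" for y by (auto simp: A'_def B_iff)
  have B_space: "x \<in> space M" "y \<in> space M" if "B x y" for x y using that X_space by (auto simp: B_def)
  have A_sets: "A \<in> sets M" "A' \<in> sets M"
    unfolding A_def A'_def using G_count D_sets mp_autD(5)[OF tw_aut D_sets] by (auto intro!: sets.countable_UN')
  have A_inv: "\<sigma> k -` A \<inter> space M = A" if k: "k \<in> carrier G" for k
  proof (intro equalityI subsetI)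
    fix x assume "x \<in> \<sigma> k -` A \<inter> space M"
    then obtain y where x: "x \<in> space M" and y: "B (\<sigma> k x) y" by (auto simp: A_iff)
    have "B (\<sigma> (inv k) (\<sigma> k x)) (\<tau> (inv k) y)" using B_inv[OF inv_closed[OF k] y] .
    then show "x \<in> A" using pmp_actionD(1)[OF act_s k x] by (auto simp: A_iff)
  next
    fix x assume "x \<in> A"
    then obtain y where y: "B x y" by (auto simp: A_iff)
    then show "x \<in> \<sigma> k -` A \<inter> space M" using B_inv[OF k y] B_space[OF y] by (auto simp: A_iff)
  qed
  have A'_inv: "\<tau> k -` A' \<inter> space M = A'" if k: "k \<in> carrier G" for k
  proof (intro equalityI subsetI)
    fix y assume "y \<in> \<tau> k -` A' \<inter> space M"
    then obtain x where y: "y \<in> space M" and x: "B x (\<tau> k y)" by (auto simp: A'_iff)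
    have "B (\<sigma> (inv k) x) (\<tau> (inv k) (\<tau> k y))" using B_inv[OF inv_closed[OF k] x] .
    then show "y \<in> A'" using pmp_actionD(1)[OF act_t k y] by (auto simp: A'_iff)
  next
    fix y assume "y \<in> A'"
    then obtain x where x: "B x y" by (auto simp: A'_iff)
    then show "y \<in> \<tau> k -` A' \<inter> space M" using B_inv[OF k x] B_space[OF x] by (auto simp: A'_iff)
  qed

  \<comment> \<open>On the diagonal \<open>c\<^sub>1 x = x\<close>, and \<open>\<integral> f x x\<close> is a limit of averages of the values \<open>co g 1 \<ge> 3/4\<close>.\<close>
  have D_pos: "measure M (D \<one>) > 0"
  proof (rule ccontr)
    assume "\<not> ?thesis"
    then have "measure M (D \<one>) = 0" using measure_nonneg[of M "D \<one>"] by linarith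
    then have "D \<one> \<in> null_sets M" using D_sets[OF one_closed] by (simp add: null_sets_def emeasure_eq_measure)
    then have "AE x in M. x \<notin> D \<one>" by (rule AE_not_in)
    then have half: "AE x in M. f x (tw \<one> x) \<le> 1/2" using X_AE by eventually_elim (auto simp: D_def)
    have i: "integrable M (\<lambda>x. val (w n) x (tw \<one> x))"
      and int: "3/4 \<le> (\<integral>x. val (w n) x (tw \<one> x) \<partial>M)" for n
    proof -
      have s: "integrable M (\<lambda>x. same x i j)" if "i \<in> snd ` set (w n)" "j \<in> snd ` set [(1::real, \<one>)]" for i j
        using that conv_carrier[OF w, of n] by (intro same_integral(1)) auto
      show "integrable M (\<lambda>x. val (w n) x (tw \<one> x))"
        unfolding val_tw using s by (rule rform_integral(1))
      have "(\<integral>x. val (w n) x (tw \<one> x) \<partial>M) = rform (\<lambda>i j. \<integral>x. same x i j \<partial>M) (w n) [(1, \<one>)]"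
        unfolding val_tw using s by (rule rform_integral(2))
      also have "\<dots> = rform co (w n) [(1, \<one>)]"
        using conv_carrier[OF w, of n] by (intro rform_cong same_integral(2)) auto
      also have "\<dots> = (\<Sum>p\<leftarrow>w n. fst p * co (snd p) \<one>)" by (simp add: rform_def)
      also have "\<dots> \<ge> (\<Sum>p\<leftarrow>w n. fst p * (3/4))"
        using w[of n] close by (intro sum_list_mono mult_left_mono) (auto simp: conv_def)
      finally have "(\<Sum>p\<leftarrow>w n. fst p) * (3/4) \<le> (\<integral>x. val (w n) x (tw \<one> x) \<partial>M)"
        unfolding sum_list_mult_const .
      then show "3/4 \<le> (\<integral>x. val (w n) x (tw \<one> x) \<partial>M)"
        using w[of n] by (simp add: conv_def)
    qed
    have ae_lim: "AE x in M. (\<lambda>n. val (w n) x (tw \<one> x)) \<longlonglongrightarrow> f x (tw \<one> x)"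
      using X_AE by eventually_elim (rule f_lim)
    have bound: "AE x in M. norm (val (w n) x (tw \<one> x)) \<le> 1" for n
      using val_conv(1,2)[OF w] by simp
    note dom = f_meas[OF one_closed] borel_measurable_integrable[OF i] _ ae_lim bound
    have fi: "integrable M (\<lambda>x. f x (tw \<one> x))" by (rule integrable_dominated_convergence[OF dom]) simp
    have "(\<lambda>n. \<integral>x. val (w n) x (tw \<one> x) \<partial>M) \<longlonglongrightarrow> (\<integral>x. f x (tw \<one> x) \<partial>M)"
      by (rule integral_dominated_convergence[OF dom]) simp
    then have "3/4 \<le> (\<integral>x. f x (tw \<one> x) \<partial>M)"
      by (rule LIMSEQ_le_const) (use int in blast)
    also have "\<dots> \<le> (\<integral>x. 1/2 \<partial>M)" using fi half by (intro integral_mono_AE) auto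
    also have "\<dots> = 1/2" by (simp add: prob_space)
    finally show False by simp
  qed
  have full: "AE x in M. x \<in> E" if "E \<in> sets M" "D \<one> \<subseteq> E"
    "measure M E = 0 \<or> measure M (space M - E) = 0" for E
  proof -
    have "measure M (D \<one>) \<le> measure M E" using that by (intro finite_measure_mono) auto
    then have "measure M (space M - E) = 0" using that D_pos by auto
    then have "measure M E = 1" using prob_compl[OF that(1)] by simp
    then show ?thesis by (rule prob_eq_1[OF that(1), THEN iffD1])
  qed
  have A_full: "AE x in M. x \<in> A"
  proof (rule full)
    show "measure M A = 0 \<or> measure M (space M - A) = 0"
      using erg(1) A_sets A_inv by (simp add: ergodic_action_def)
  qed (use A_sets in \<open>auto simp: A_def\<close>)
  have A'_full: "AE x in M. x \<in> A'"
  proof (rule full)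
    show "measure M A' = 0 \<or> measure M (space M - A') = 0"
      using erg(2) A_sets A'_inv by (simp add: ergodic_action_def)
    show "D \<one> \<subseteq> A'"
    proof
      fix x assume "x \<in> D \<one>"
      then have "tw \<one> x \<in> A'" by (auto simp: A'_def)
      then show "x \<in> A'" using tw_one[OF D_X(2)[OF \<open>x \<in> D \<one>\<close>]] by simp
    qed
  qed (use A_sets in auto)
  obtain T where T: "T \<in> mp_aut M" "AE x in M. \<exists>g\<in>carrier G. x \<in> D g \<and> T x = tw g x"
  proof (rule partial_iso_extend[of "carrier G" tw \<one> D])
    fix g h x y assume gh: "g \<in> carrier G" "h \<in> carrier G" "x \<in> D g" "y \<in> D h"
    then have B: "B x (tw g x)" "B y (tw h y)" by (auto simp: B_iff)
    show "tw g x = tw h y \<longleftrightarrow> x = y"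
    proof
      assume "tw g x = tw h y"
      then have "B x (tw h y)" using B(1) by simp
      then show "x = y" using B(2) by (rule B_col)
    next
      assume "x = y"
      then have "B y (tw g x)" using B(1) by simp
      then show "tw g x = tw h y" using B(2) by (rule B_row)
    qed
  qed (use G_count tw_aut tw_one D_sets A_full A'_full in \<open>simp_all add: A_def A'_def\<close>)
  have TB: "AE x in M. B x (T x)" using T(2) by eventually_elim (auto simp: B_iff)
  have "AE x in M. \<forall>k\<in>carrier G. B (\<sigma> k x) (T (\<sigma> k x))"
    unfolding AE_ball_countable[OF G_count]
  proof
    fix k assume "k \<in> carrier G"
    then show "AE x in M. B (\<sigma> k x) (T (\<sigma> k x))" by (rule mp_aut_AE[OF s_aut TB])
  qed
  then have "AE x in M. \<forall>k\<in>carrier G. T (\<sigma> k x) = \<tau> k (T x)"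
    using TB
  proof eventually_elim
    fix x assume x: "\<forall>k\<in>carrier G. B (\<sigma> k x) (T (\<sigma> k x))" "B x (T x)"
    show "\<forall>k\<in>carrier G. T (\<sigma> k x) = \<tau> k (T x)"
    proof
      fix k assume k: "k \<in> carrier G"
      show "T (\<sigma> k x) = \<tau> k (T x)" by (rule B_row[OF x(1)[rule_format, OF k] B_inv[OF k x(2)]])
    qed
  qed
  then show ?thesis using T(1) by (auto simp: conjugate_on_def)
qed

end

section \<open>Separability of the measure algebra and of full groups\<close>

abbreviation sdiff :: "'a set \<Rightarrow> 'a set \<Rightarrow> 'a set" where
  "sdiff A B \<equiv> (A - B) \<union> (B - A)"

context separated_prob begin

lemma measure_sdiff_triangle:
  assumes "A \<in> sets M" "B \<in> sets M" "C \<in> sets M"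
  shows "measure M (sdiff A C) \<le> measure M (sdiff A B) + measure M (sdiff B C)"
proof -
  have "measure M (sdiff A C) \<le> measure M (sdiff A B \<union> sdiff B C)"
    using assms by (intro finite_measure_mono) auto
  also have "\<dots> \<le> measure M (sdiff A B) + measure M (sdiff B C)"
    using assms by (intro measure_Un_le) auto
  finally show ?thesis .
qed

text \<open>
  The algebra of sets generated by \<open>\<U>\<close>, as an increasing union of countable levels.
\<close>

primrec lev :: "nat \<Rightarrow> 'a set set" where
  "lev 0 = insert {} \<U>"
| "lev (Suc n) = lev n \<union> (\<lambda>A. space M - A) ` lev n \<union> (\<lambda>(A, B). A \<union> B) ` (lev n \<times> lev n)"

definition alg :: "'a set set" where "alg = (\<Union>n. lev n)"

lemma countable_alg: "countable alg"
proof -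
  have "countable (lev n)" for n by (induction n) (simp_all add: countable_U)
  then show ?thesis by (simp add: alg_def)
qed

lemma lev_mono: "m \<le> n \<Longrightarrow> lev m \<subseteq> lev n"
  by (rule lift_Suc_mono_le[of lev]) auto

lemma alg_sets: "A \<in> alg \<Longrightarrow> A \<in> sets M"
proof -
  have "A \<in> lev n \<Longrightarrow> A \<in> sets M" for A n
  proof (induction n arbitrary: A)
    case 0 then show ?case by (auto simp: sets_U intro: sigma_sets.Basic sigma_sets.Empty)
  qed auto
  then show "A \<in> alg \<Longrightarrow> A \<in> sets M" by (auto simp: alg_def)
qed

lemma alg_closed:
  shows "{} \<in> alg" "U \<in> \<U> \<Longrightarrow> U \<in> alg" "A \<in> alg \<Longrightarrow> space M - A \<in> alg"
    "A \<in> alg \<Longrightarrow> B \<in> alg \<Longrightarrow> A \<union> B \<in> alg"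
proof -
  have "lev 0 \<subseteq> alg" unfolding alg_def by blast
  then show "{} \<in> alg" "U \<in> \<U> \<Longrightarrow> U \<in> alg" by auto
  show "space M - A \<in> alg" if A: "A \<in> alg"
  proof -
    obtain n where "A \<in> lev n" using A by (auto simp: alg_def)
    then have "space M - A \<in> lev (Suc n)" by simp
    then show ?thesis unfolding alg_def by blast
  qed
  show "A \<union> B \<in> alg" if AB: "A \<in> alg" "B \<in> alg"
  proof -
    obtain m n where "A \<in> lev m" "B \<in> lev n" using AB by (auto simp: alg_def)
    then have "A \<in> lev (max m n)" "B \<in> lev (max m n)"
      using lev_mono[of m "max m n"] lev_mono[of n "max m n"] by auto
    then have "A \<union> B \<in> lev (Suc (max m n))" by (auto intro: rev_image_eqI[of "(A, B)"])
    then show ?thesis unfolding alg_def by blast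
  qed
qed

text \<open>
  The sets that can be approximated in measure by members of the algebra.
\<close>

definition approx :: "'a set \<Rightarrow> bool" where
  "approx A \<longleftrightarrow> A \<in> sets M \<and> (\<forall>\<delta>>0. \<exists>B\<in>alg. measure M (sdiff A B) < \<delta>)"

lemma approx_alg: "A \<in> alg \<Longrightarrow> approx A"
  unfolding approx_def using alg_sets by (auto intro!: bexI[of _ A])

lemma approx_Un:
  assumes "approx A" "approx B" shows "approx (A \<union> B)"
  unfolding approx_def
proof (intro conjI allI impI)
  show "A \<union> B \<in> sets M" using assms by (auto simp: approx_def)
  fix \<delta> :: real assume "\<delta> > 0"
  then obtain A' B' where AB: "A' \<in> alg" "B' \<in> alg" "measure M (sdiff A A') < \<delta> / 2" "measure M (sdiff B B') < \<delta> / 2"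
    using assms unfolding approx_def by (meson half_gt_zero)
  have s: "A \<in> sets M" "B \<in> sets M" "A' \<in> sets M" "B' \<in> sets M"
    using assms AB alg_sets by (auto simp: approx_def)
  have "measure M (sdiff (A \<union> B) (A' \<union> B')) \<le> measure M (sdiff A A' \<union> sdiff B B')"
    using s by (intro finite_measure_mono) auto
  also have "\<dots> \<le> measure M (sdiff A A') + measure M (sdiff B B')"
    using s by (intro measure_Un_le) auto
  also have "\<dots> < \<delta>" using AB by simp
  finally show "\<exists>C\<in>alg. measure M (sdiff (A \<union> B) C) < \<delta>" using alg_closed(4)[OF AB(1,2)] by blast
qed

lemma approx_all:
  assumes "A \<in> sets M" shows "approx A"
proof -
  have "A \<in> sigma_sets (space M) \<U>" using assms sets_U by simp
  then show ?thesis
  proof induction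
    case (Basic U) then show ?case by (intro approx_alg alg_closed)
  next
    case Empty show ?case by (intro approx_alg alg_closed)
  next
    case (Compl A)
    show ?case unfolding approx_def
    proof (intro conjI allI impI)
      have A: "A \<in> sets M" using Compl.IH by (simp add: approx_def)
      then show "space M - A \<in> sets M" by auto
      fix \<delta> :: real assume "\<delta> > 0"
      then obtain B where B: "B \<in> alg" "measure M (sdiff A B) < \<delta>"
        using Compl.IH unfolding approx_def by metis
      have "measure M (sdiff (space M - A) (space M - B)) \<le> measure M (sdiff A B)"
        using A alg_sets[OF B(1)] by (intro finite_measure_mono) auto
      then show "\<exists>C\<in>alg. measure M (sdiff (space M - A) C) < \<delta>"
        using B alg_closed(3)[OF B(1)] by (auto intro: le_less_trans)
    qed
  next
    case (Union A)
    have A: "A i \<in> sets M" for i using Union.IH by (simp add: approx_def)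
    define S where "S n = (\<Union>i<n. A i)" for n
    have S: "approx (S n)" for n
    proof (induction n)
      case 0 show ?case using approx_alg[OF alg_closed(1)] by (simp add: S_def)
    next
      case (Suc n) then show ?case using approx_Un[OF Union.IH[of n] Suc] by (simp add: S_def lessThan_Suc)
    qed
    have S_sets: "S n \<in> sets M" for n using S by (simp add: approx_def)
    have UN: "(\<Union>n. S n) = (\<Union>i. A i)" by (auto simp: S_def)
    have lim: "(\<lambda>n. measure M (S n)) \<longlonglongrightarrow> measure M (\<Union>i. A i)"
      unfolding UN[symmetric]
    proof (rule finite_Lim_measure_incseq)
      show "incseq S" by (rule incseq_SucI) (auto simp: S_def lessThan_Suc)
    qed (use S_sets in auto)
    show ?case unfolding approx_def
    proof (intro conjI allI impI)
      show "\<Union> (range A) \<in> sets M" using A by auto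
      fix \<delta> :: real assume "\<delta> > 0"
      then obtain n where n: "\<bar>measure M (S n) - measure M (\<Union>i. A i)\<bar> < \<delta> / 2"
        using LIMSEQ_D[OF lim, of "\<delta> / 2"] by auto
      obtain B where B: "B \<in> alg" "measure M (sdiff (S n) B) < \<delta> / 2"
        using S[of n] \<open>\<delta> > 0\<close> unfolding approx_def by (meson half_gt_zero)
      have sub: "S n \<subseteq> (\<Union>i. A i)" by (auto simp: S_def)
      then have "sdiff (\<Union>i. A i) (S n) = (\<Union>i. A i) - S n" by blast
      then have "measure M (sdiff (\<Union>i. A i) (S n)) = measure M (\<Union>i. A i) - measure M (S n)"
        using finite_measure_Diff[OF _ S_sets sub] A by auto
      then have "measure M (sdiff (\<Union>i. A i) (S n)) < \<delta> / 2" using n by linarith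
      then have "measure M (sdiff (\<Union>i. A i) B) < \<delta>"
        using measure_sdiff_triangle[of "\<Union>i. A i" "S n" B] A S_sets alg_sets[OF B(1)] B(2) by auto
      then show "\<exists>B\<in>alg. measure M (sdiff (\<Union> (range A)) B) < \<delta>" using B(1) by blast
    qed
  qed
qed

text \<open>
  A map that agrees almost everywhere with one of the maps \<open>c n\<close> is determined, up to the sets where it
  agrees with each \<open>c n\<close>. Finitely many of these sets cover all but a set of measure \<open>\<delta>\<close>, and their
  approximations by members of the countable algebra form the code of the map.
\<close>

lemma separable_full_group:
  fixes c :: "nat \<Rightarrow> 'a \<Rightarrow> 'a"
  assumes c: "\<And>n. c n \<in> M \<rightarrow>\<^sub>M M" and "\<epsilon> > 0"
  obtains code :: "('a \<Rightarrow> 'a) \<Rightarrow> 'a set list" and \<C> where "countable \<C>"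
    "\<And>S. S \<in> M \<rightarrow>\<^sub>M M \<Longrightarrow> AE x in M. \<exists>n. S x = c n x \<Longrightarrow> code S \<in> \<C>"
    "\<And>S S'. S \<in> M \<rightarrow>\<^sub>M M \<Longrightarrow> AE x in M. \<exists>n. S x = c n x \<Longrightarrow> S' \<in> M \<rightarrow>\<^sub>M M \<Longrightarrow> AE x in M. \<exists>n. S' x = c n x \<Longrightarrow>
       code S = code S' \<Longrightarrow> measure M {x \<in> space M. S x \<noteq> S' x} < \<epsilon>"
proof -
  define \<delta> where "\<delta> = \<epsilon> / 4"
  have "\<delta> > 0" using assms by (simp add: \<delta>_def)
  define E where "E S n = {x \<in> space M. S x = c n x}" for S n
  have E: "E S n \<in> sets M" if "S \<in> M \<rightarrow>\<^sub>M M" for S n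
    using measurable_eq[OF that c] by (simp add: E_def pred_def)
  define ok where "ok S Bs \<longleftrightarrow> Bs \<in> lists alg \<and> measure M (space M - (\<Union>n<length Bs. E S n)) < \<delta> \<and>
      (\<forall>n<length Bs. measure M (sdiff (E S n) (Bs ! n)) < \<delta> / real (length Bs))" for S Bs
  have ex: "\<exists>Bs. ok S Bs" if S: "S \<in> M \<rightarrow>\<^sub>M M" and full: "AE x in M. \<exists>n. S x = c n x" for S
  proof -
    define U where "U k = (\<Union>n<k. E S n)" for k
    have U: "U k \<in> sets M" for k using E[OF S] by (auto simp: U_def)
    have "(\<lambda>k. measure M (U k)) \<longlonglongrightarrow> measure M (\<Union>k. U k)"
    proof (rule finite_Lim_measure_incseq)
      show "incseq U" by (rule incseq_SucI) (auto simp: U_def lessThan_Suc)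
    qed (use U in auto)
    moreover have "measure M (\<Union>k. U k) = 1"
    proof -
      have "AE x in M. x \<in> (\<Union>k. U k)"
        using full AE_space
      proof eventually_elim
        fix x assume "\<exists>n. S x = c n x" "x \<in> space M"
        then obtain n where "x \<in> U (Suc n)" by (auto simp: U_def E_def)
        then show "x \<in> (\<Union>k. U k)" by blast
      qed
      moreover have "(\<Union>k. U k) \<in> sets M" using U by auto
      ultimately show ?thesis by (subst prob_eq_1) auto
    qed
    ultimately obtain k where k: "\<bar>measure M (U k) - 1\<bar> < \<delta>"
      using LIMSEQ_D[of "\<lambda>k. measure M (U k)" 1 \<delta>] \<open>\<delta> > 0\<close> by auto
    have "\<exists>B\<in>alg. k > 0 \<longrightarrow> measure M (sdiff (E S n) B) < \<delta> / real k" for n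
    proof (cases "k > 0")
      case True
      then have "\<delta> / real k > 0" using \<open>\<delta> > 0\<close> by simp
      then show ?thesis using approx_all[OF E[OF S, of n]] unfolding approx_def by blast
    qed (use alg_closed(1) in auto)
    then obtain B where B: "\<And>n. B n \<in> alg" "\<And>n. k > 0 \<Longrightarrow> measure M (sdiff (E S n) (B n)) < \<delta> / real k"
      by metis
    have "ok S (map B [0..<k])"
      unfolding ok_def using B k prob_compl[OF U[of k]] by (auto simp: U_def)
    then show ?thesis by blast
  qed
  define code where "code S = (SOME Bs. ok S Bs)" for S
  have code: "ok S (code S)" if "S \<in> M \<rightarrow>\<^sub>M M" "AE x in M. \<exists>n. S x = c n x" for S
    unfolding code_def using ex[OF that] by (rule someI_ex)
  show ?thesis
  proof (rule that[of "lists alg" code])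
    show "countable (lists alg)" using countable_alg by (rule countable_lists)
    show "code S \<in> lists alg" if "S \<in> M \<rightarrow>\<^sub>M M" "AE x in M. \<exists>n. S x = c n x" for S
      using code[OF that] by (simp add: ok_def)
    fix S S' assume S: "S \<in> M \<rightarrow>\<^sub>M M" "AE x in M. \<exists>n. S x = c n x"
      and S': "S' \<in> M \<rightarrow>\<^sub>M M" "AE x in M. \<exists>n. S' x = c n x" and eq: "code S = code S'"
    define Bs where "Bs = code S"
    define k where "k = length Bs"
    have ok: "ok S Bs" "ok S' Bs" using code[OF S] code[OF S'] eq by (simp_all add: Bs_def)
    have Bn: "Bs ! n \<in> sets M" if "n < k" for n
      using ok(1) that by (intro alg_sets) (auto simp: ok_def k_def in_lists_conv_set)
    let ?U = "space M - (\<Union>n<k. E S n)" and ?V = "\<Union>n<k. sdiff (E S n) (E S' n)"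
    have UV: "?U \<in> sets M" "?V \<in> sets M" using E[OF S(1)] E[OF S'(1)] by auto
    have "{x \<in> space M. S x \<noteq> S' x} \<subseteq> ?U \<union> ?V"
    proof
      fix x assume x: "x \<in> {x \<in> space M. S x \<noteq> S' x}"
      show "x \<in> ?U \<union> ?V"
      proof (cases "x \<in> ?U")
        case False
        then obtain n where "n < k" "x \<in> E S n" using x by auto
        moreover from this have "x \<notin> E S' n" using x by (simp add: E_def)
        ultimately show ?thesis by blast
      qed simp
    qed
    then have "measure M {x \<in> space M. S x \<noteq> S' x} \<le> measure M (?U \<union> ?V)"
      using UV by (intro finite_measure_mono) auto
    also have "\<dots> \<le> measure M ?U + measure M ?V" using UV by (rule measure_Un_le)
    also have "measure M (\<Union>n<k. sdiff (E S n) (E S' n)) \<le> (\<Sum>n<k. measure M (sdiff (E S n) (E S' n)))"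
      using E[OF S(1)] E[OF S'(1)] by (intro measure_UNION_le) auto
    also have "\<dots> \<le> (\<Sum>n<k. 2 * \<delta> / real k)"
    proof (rule sum_mono)
      fix n assume "n \<in> {..<k}"
      then have n: "n < k" by simp
      have "measure M (sdiff (E S n) (E S' n)) \<le> measure M (sdiff (E S n) (Bs ! n)) + measure M (sdiff (Bs ! n) (E S' n))"
        by (intro measure_sdiff_triangle E S S' Bn n)
      also have "sdiff (Bs ! n) (E S' n) = sdiff (E S' n) (Bs ! n)" by blast
      finally have "measure M (sdiff (E S n) (E S' n)) \<le>
          measure M (sdiff (E S n) (Bs ! n)) + measure M (sdiff (E S' n) (Bs ! n))" .
      moreover have "measure M (sdiff (E S n) (Bs ! n)) < \<delta> / real k"
        "measure M (sdiff (E S' n) (Bs ! n)) < \<delta> / real k"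
        using ok n by (auto simp: ok_def k_def)
      moreover have "2 * \<delta> / real k = \<delta> / real k + \<delta> / real k" by simp
      ultimately show "measure M (sdiff (E S n) (E S' n)) \<le> 2 * \<delta> / real k" by linarith
    qed
    also have "\<dots> \<le> 2 * \<delta>" using \<open>\<delta> > 0\<close> by simp
    also have "measure M (space M - (\<Union>n<k. E S n)) + 2 * \<delta> < \<epsilon>"
      using ok(1) \<open>\<delta> > 0\<close> by (simp add: ok_def k_def \<delta>_def)
    finally show "measure M {x \<in> space M. S x \<noteq> S' x} < \<epsilon>" by simp
  qed
qed

end

section \<open>Orbit equivalent actions\<close>

lemma (in separated_prob) pmp_action_conjugate:
  assumes "group G" and \<sigma>: "pmp_action G M \<sigma>" and T: "T \<in> mp_aut M"
  obtains \<sigma>' where "pmp_action G M \<sigma>'"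
    "\<And>g x. g \<in> carrier G \<Longrightarrow> x \<in> space M \<Longrightarrow> \<sigma>' g (T x) = T (\<sigma> g x)"
proof -
  interpret group G by fact
  define Ti where "Ti = restrict (inv_into (space M) T) (space M)"
  have Ti: "Ti \<in> mp_aut M" unfolding Ti_def by (rule mp_aut_inverse[OF T])
  have TiT: "Ti (T x) = x" if "x \<in> space M" for x
    using mp_autD(2)[OF T] that mp_aut_space[OF T that] by (simp add: Ti_def bij_betw_def inv_into_f_f)
  have TTi: "T (Ti x) = x" if "x \<in> space M" for x
    using mp_autD(2)[OF T] that by (simp add: Ti_def bij_betw_def f_inv_into_f)
  define \<sigma>' where "\<sigma>' g = compose (space M) T (compose (space M) (\<sigma> g) Ti)" for g
  have app: "\<sigma>' g x = T (\<sigma> g (Ti x))" if "x \<in> space M" for g x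
    using that by (simp add: \<sigma>'_def compose_def)
  have sp: "\<sigma> g x \<in> space M" if "g \<in> carrier G" "x \<in> space M" for g x
    using \<sigma> that mp_aut_space[of "\<sigma> g" M x] by (simp add: pmp_action_def)
  have "pmp_action G M \<sigma>'"
    unfolding pmp_action_def
  proof (intro conjI ballI)
    fix g assume g: "g \<in> carrier G"
    show "\<sigma>' g \<in> mp_aut M"
      unfolding \<sigma>'_def using \<sigma> g by (intro mp_aut_compose T Ti) (auto simp: pmp_action_def)
    fix h x assume h: "h \<in> carrier G" and x: "x \<in> space M"
    have Tx: "Ti x \<in> space M" using mp_aut_space[OF Ti x] .
    have "\<sigma>' g (\<sigma>' h x) = T (\<sigma> g (Ti (T (\<sigma> h (Ti x)))))"
      unfolding app[OF x] by (rule app[OF mp_aut_space[OF T sp[OF h Tx]]])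
    also have "\<dots> = T (\<sigma> g (\<sigma> h (Ti x)))" using TiT[OF sp[OF h Tx]] by simp
    also have "\<dots> = T (\<sigma> (g \<otimes>\<^bsub>G\<^esub> h) (Ti x))" using \<sigma> g h Tx by (simp add: pmp_action_def)
    finally show "\<sigma>' (g \<otimes>\<^bsub>G\<^esub> h) x = \<sigma>' g (\<sigma>' h x)" using app[OF x] by simp
  next
    fix x assume x: "x \<in> space M"
    show "\<sigma>' \<one>\<^bsub>G\<^esub> x = x" using app[OF x] mp_aut_space[OF Ti x] \<sigma> TTi[OF x] by (simp add: pmp_action_def)
  qed
  moreover have "\<sigma>' g (T x) = T (\<sigma> g x)" if "g \<in> carrier G" "x \<in> space M" for g x
    using app[OF mp_aut_space[OF T that(2)]] TiT[OF that(2)] by simp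
  ultimately show ?thesis by (rule that)
qed

lemma (in separated_prob) ergodic_conjugate:
  assumes T: "T \<in> mp_aut M" and act: "\<And>g x. g \<in> carrier G \<Longrightarrow> x \<in> space M \<Longrightarrow> \<sigma> g x \<in> space M"
    and conj: "\<And>g x. g \<in> carrier G \<Longrightarrow> x \<in> space M \<Longrightarrow> \<sigma>' g (T x) = T (\<sigma> g x)"
    and erg: "ergodic_action G M \<sigma>"
  shows "ergodic_action G M \<sigma>'"
  unfolding ergodic_action_def
proof (intro ballI impI)
  fix A assume A: "A \<in> sets M" and inv: "\<forall>g\<in>carrier G. \<sigma>' g -` A \<inter> space M = A"
  let ?B = "T -` A \<inter> space M"
  have B: "?B \<in> sets M" using measurable_sets[OF mp_autD(1)[OF T] A] .
  have "\<sigma> g -` ?B \<inter> space M = ?B" if g: "g \<in> carrier G" for g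
  proof (intro equalityI subsetI)
    fix x assume x: "x \<in> \<sigma> g -` ?B \<inter> space M"
    then have "T x \<in> \<sigma>' g -` A \<inter> space M" using conj[OF g, of x] mp_aut_space[OF T, of x] by simp
    then show "x \<in> ?B" using inv g x by simp
  next
    fix x assume x: "x \<in> ?B"
    then have "T x \<in> \<sigma>' g -` A \<inter> space M" using inv g by simp
    then show "x \<in> \<sigma> g -` ?B \<inter> space M" using conj[OF g, of x] act[OF g, of x] x by simp
  qed
  then have "measure M ?B = 0 \<or> measure M (space M - ?B) = 0"
    using erg B by (simp add: ergodic_action_def)
  then show "measure M A = 0 \<or> measure M (space M - A) = 0"
    using mp_autD(4)[OF T A] prob_compl[OF A] prob_compl[OF B] by auto
qed

lemma (in separated_prob) conjugate_on_transfer: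
  assumes S: "S \<in> mp_aut M" and T: "T \<in> mp_aut M"
    and s_space: "\<And>h x. h \<in> H \<Longrightarrow> x \<in> space M \<Longrightarrow> \<sigma> h x \<in> space M"
    and t_space: "\<And>h x. h \<in> H \<Longrightarrow> x \<in> space M \<Longrightarrow> \<tau> h x \<in> space M"
    and s: "\<And>h x. h \<in> H \<Longrightarrow> x \<in> space M \<Longrightarrow> \<sigma>' h (S x) = S (\<sigma> h x)"
    and t: "\<And>h x. h \<in> H \<Longrightarrow> x \<in> space M \<Longrightarrow> \<tau>' h (T x) = T (\<tau> h x)"
    and conj: "conjugate_on H M \<sigma>' \<tau>'"
  shows "conjugate_on H M \<sigma> \<tau>"
proof -
  obtain R where R: "R \<in> mp_aut M" "AE x in M. \<forall>h\<in>H. R (\<sigma>' h x) = \<tau>' h (R x)"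
    using conj by (auto simp: conjugate_on_def)
  define Ti where "Ti = restrict (inv_into (space M) T) (space M)"
  have Ti: "Ti \<in> mp_aut M" unfolding Ti_def by (rule mp_aut_inverse[OF T])
  have TiT: "Ti (T x) = x" if "x \<in> space M" for x
    using mp_autD(2)[OF T] that mp_aut_space[OF T that] by (simp add: Ti_def bij_betw_def inv_into_f_f)
  have TTi: "T (Ti x) = x" if "x \<in> space M" for x
    using mp_autD(2)[OF T] that by (simp add: Ti_def bij_betw_def f_inv_into_f)
  define V where "V = compose (space M) Ti (compose (space M) R S)"
  have V: "V \<in> mp_aut M" unfolding V_def by (intro mp_aut_compose Ti R S)
  have app: "V x = Ti (R (S x))" if "x \<in> space M" for x using that by (simp add: V_def compose_def)
  have "AE x in M. \<forall>h\<in>H. R (\<sigma>' h (S x)) = \<tau>' h (R (S x))" by (rule mp_aut_AE[OF S R(2)])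
  then have "AE x in M. \<forall>h\<in>H. V (\<sigma> h x) = \<tau> h (V x)"
    using AE_space
  proof eventually_elim
    fix x assume x: "\<forall>h\<in>H. R (\<sigma>' h (S x)) = \<tau>' h (R (S x))" "x \<in> space M"
    show "\<forall>h\<in>H. V (\<sigma> h x) = \<tau> h (V x)"
    proof
      fix h assume h: "h \<in> H"
      have RS: "R (S x) \<in> space M" using mp_aut_space[OF R(1) mp_aut_space[OF S x(2)]] .
      have Vx: "V x \<in> space M" using mp_aut_space[OF V x(2)] .
      have TV: "T (V x) = R (S x)" using app[OF x(2)] TTi[OF RS] by simp
      have "V (\<sigma> h x) = Ti (R (\<sigma>' h (S x)))" using app[OF s_space[OF h x(2)]] s[OF h x(2)] by simp
      also have "\<dots> = Ti (\<tau>' h (T (V x)))" using x(1) h TV by simp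
      also have "\<dots> = Ti (T (\<tau> h (V x)))" using t[OF h Vx] by simp
      also have "\<dots> = \<tau> h (V x)" by (rule TiT[OF t_space[OF h Vx]])
      finally show "V (\<sigma> h x) = \<tau> h (V x)" .
    qed
  qed
  then show ?thesis using V by (auto simp: conjugate_on_def)
qed

text \<open>
  An action that is orbit equivalent to \<open>\<sigma>0\<close> has a conjugate that moves almost every point inside its
  \<open>\<sigma>0\<close>-orbit.
\<close>

lemma (in separated_prob) orbit_equivalent_model:
  assumes "group G" and \<sigma>: "pmp_action G M \<sigma>" and oe: "orbit_equivalent G M \<sigma> \<sigma>0"
  obtains T \<sigma>' where "T \<in> mp_aut M" "pmp_action G M \<sigma>'"
    "\<And>g x. g \<in> carrier G \<Longrightarrow> x \<in> space M \<Longrightarrow> \<sigma>' g (T x) = T (\<sigma> g x)"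
    "\<And>g. g \<in> carrier G \<Longrightarrow> AE x in M. \<exists>k\<in>carrier G. \<sigma>' g x = \<sigma>0 k x"
proof -
  obtain T N where T: "T \<in> mp_aut M" and N: "N \<in> null_sets M"
    and eq: "\<And>x y. x \<in> space M - N \<Longrightarrow> y \<in> space M - N \<Longrightarrow>
        (x, y) \<in> orbit_rel G M \<sigma> \<longleftrightarrow> (T x, T y) \<in> orbit_rel G M \<sigma>0"
    using oe unfolding orbit_equivalent_def by blast
  obtain \<sigma>' where \<sigma>': "pmp_action G M \<sigma>'"
    "\<And>g x. g \<in> carrier G \<Longrightarrow> x \<in> space M \<Longrightarrow> \<sigma>' g (T x) = T (\<sigma> g x)"
    using pmp_action_conjugate[OF assms(1) \<sigma> T] by blast
  have "AE x in M. \<exists>k\<in>carrier G. \<sigma>' g x = \<sigma>0 k x" if g: "g \<in> carrier G" for g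
  proof -
    have aut: "\<sigma> g \<in> mp_aut M" using \<sigma> g by (simp add: pmp_action_def)
    have "AE x in M. \<exists>k\<in>carrier G. \<sigma>' g (T x) = \<sigma>0 k (T x)"
      using AE_not_in[OF N] mp_aut_AE[OF aut AE_not_in[OF N]] AE_space
    proof eventually_elim
      fix x assume x: "x \<notin> N" "\<sigma> g x \<notin> N" "x \<in> space M"
      have "(x, \<sigma> g x) \<in> orbit_rel G M \<sigma>" using x g by (auto simp: orbit_rel_def orbit_def)
      then have "(T x, T (\<sigma> g x)) \<in> orbit_rel G M \<sigma>0"
        using eq[of x "\<sigma> g x"] x mp_aut_space[OF aut x(3)] by simp
      then show "\<exists>k\<in>carrier G. \<sigma>' g (T x) = \<sigma>0 k (T x)"
        using \<sigma>'(2)[OF g x(3)] by (auto simp: orbit_rel_def orbit_def)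
    qed
    from mp_aut_AE[OF mp_aut_inverse[OF T] this] show ?thesis
      using AE_space
    proof eventually_elim
      fix x assume x: "\<exists>k\<in>carrier G. \<sigma>' g (T (restrict (inv_into (space M) T) (space M) x)) =
          \<sigma>0 k (T (restrict (inv_into (space M) T) (space M) x))" "x \<in> space M"
      have "T (restrict (inv_into (space M) T) (space M) x) = x"
        using mp_autD(2)[OF T] x(2) by (simp add: bij_betw_def f_inv_into_f)
      then show "\<exists>k\<in>carrier G. \<sigma>' g x = \<sigma>0 k x" using x(1) by simp
    qed
  qed
  then show ?thesis using that[OF T \<sigma>'] by blast
qed

text \<open>
  The values of the coincidence kernel of \<open>G\<close> and of \<open>H\<close> at \<open>(h, 1)\<close> agree, although the kernels are
  formed in different groups.
\<close>

lemma (in separated_prob) conjugate_on_subgroup_if_close: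
  assumes G: "group G" "countable (carrier G)" and H: "subgroup H G"
    and act: "pmp_action G M \<sigma>" "pmp_action G M \<tau>"
    and erg: "ergodic_on G H M \<sigma>" "ergodic_on G H M \<tau>"
    and close: "\<And>h. h \<in> H \<Longrightarrow> 3 / 4 \<le> coincide G M \<sigma> \<tau> h \<one>\<^bsub>G\<^esub>"
  shows "conjugate_on H M \<sigma> \<tau>"
proof -
  let ?L = "G\<lparr>carrier := H\<rparr>"
  have sub: "H \<subseteq> carrier G" by (rule subgroup.subset[OF H])
  interpret G: action_pair M \<U> G \<sigma> \<tau>
    by (intro action_pair.intro action_pair_axioms.intro separated_prob_axioms G act)
  interpret L: action_pair M \<U> ?L \<sigma> \<tau>
    by (intro action_pair.intro action_pair_axioms.intro separated_prob_axioms
        subgroup.subgroup_is_group[OF H G(1)] pmp_action_subgroup act H)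
  have "conjugate_on (carrier ?L) M \<sigma> \<tau>"
  proof (rule L.conjugate_if_close)
    show "countable (carrier ?L)" using countable_subset[OF sub G(2)] by simp
    show "ergodic_action ?L M \<sigma>" "ergodic_action ?L M \<tau>" using erg by (simp_all add: ergodic_on_def)
    fix h assume "h \<in> carrier ?L"
    then have h: "h \<in> H" "h \<in> carrier G" using sub by auto
    show "3 / 4 \<le> coincide ?L M \<sigma> \<tau> h \<one>\<^bsub>?L\<^esub>"
      using close[OF h(1)] L.co_one[of h] G.co_one[OF h(2)] h by simp
  qed
  then show ?thesis by simp
qed

theorem lemma1p3:
  fixes G :: "('g, 'b) monoid_scheme"
    and H :: "'g set"
    and M :: "'x measure"
    and \<F> :: "('g \<Rightarrow> 'x \<Rightarrow> 'x) set"
  assumes "group G" and "countable (carrier G)"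
    and "subgroup H G" and "infinite H"
    and "relative_property_T TYPE(nat \<Rightarrow> complex) G H"
    and "standard_borel M" and "prob_space M"
    and "\<And>\<sigma>. \<sigma> \<in> \<F> \<Longrightarrow> mp_action G M \<sigma>"
    and "\<And>\<sigma>. \<sigma> \<in> \<F> \<Longrightarrow> ergodic_on G H M \<sigma>"
    and "\<And>\<sigma> \<tau>. \<sigma> \<in> \<F> \<Longrightarrow> \<tau> \<in> \<F> \<Longrightarrow> orbit_equivalent G M \<sigma> \<tau>"
    and "\<And>\<sigma> \<tau>. \<sigma> \<in> \<F> \<Longrightarrow> \<tau> \<in> \<F> \<Longrightarrow> (\<sigma>, \<tau>) \<notin> ae_equal_actions G M \<Longrightarrow> \<not> conjugate_on H M \<sigma> \<tau>"
  shows "countable (\<F> // ae_equal_actions G M)"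
proof (cases "\<F> = {}")
  case True then show ?thesis by simp
next
  case False
  then obtain \<sigma>0 where \<sigma>0: "\<sigma>0 \<in> \<F>" by blast
  interpret G: group G by fact
  obtain \<U> where "separated_prob M \<U>" using standard_borel_separated[OF assms(6,7)] by blast
  then interpret separated_prob M \<U> .
  have HG: "H \<subseteq> carrier G" by (rule subgroup.subset[OF assms(3)])
  obtain Q \<epsilon> where Q: "finite Q" "Q \<subseteq> carrier G" "(0::real) < \<epsilon>"
    and close: "\<And>\<sigma> \<tau> h. pmp_action G M \<sigma> \<Longrightarrow> pmp_action G M \<tau> \<Longrightarrow>
       (\<And>g. g \<in> Q \<Longrightarrow> 1 - coincide G M \<sigma> \<tau> g \<one>\<^bsub>G\<^esub> < \<epsilon>) \<Longrightarrow> h \<in> H \<Longrightarrow> 3 / 4 \<le> coincide G M \<sigma> \<tau> h \<one>\<^bsub>G\<^esub>"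
  proof (rule relative_property_T_close[OF assms(5,1,2) HG])
    fix Q and \<epsilon> :: real
    assume "finite Q" "Q \<subseteq> carrier G" "\<epsilon> > 0"
      "\<And>\<sigma> \<tau> h. pmp_action G M \<sigma> \<Longrightarrow> pmp_action G M \<tau> \<Longrightarrow>
         (\<And>g. g \<in> Q \<Longrightarrow> 1 - coincide G M \<sigma> \<tau> g \<one>\<^bsub>G\<^esub> < \<epsilon>) \<Longrightarrow> h \<in> H \<Longrightarrow> 3 / 4 \<le> coincide G M \<sigma> \<tau> h \<one>\<^bsub>G\<^esub>"
    then show thesis by (rule that)
  qed
  have act: "pmp_action G M \<sigma>" if "\<sigma> \<in> \<F>" for \<sigma> using mp_action_pmp assms(8)[OF that] by blast
  \<comment> \<open>Each action is replaced by a conjugate \<open>m \<sigma>\<close>, via \<open>T \<sigma>\<close>, that respects the orbits of \<open>\<sigma>0\<close>.\<close>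
  define model where "model \<sigma> p \<longleftrightarrow> fst p \<in> mp_aut M \<and> pmp_action G M (snd p) \<and>
      (\<forall>g\<in>carrier G. \<forall>x\<in>space M. snd p g (fst p x) = fst p (\<sigma> g x)) \<and>
      (\<forall>g\<in>carrier G. AE x in M. \<exists>k\<in>carrier G. snd p g x = \<sigma>0 k x)"
    for \<sigma> and p :: "('x \<Rightarrow> 'x) \<times> ('g \<Rightarrow> 'x \<Rightarrow> 'x)"
  have "\<exists>p. model \<sigma> p" if "\<sigma> \<in> \<F>" for \<sigma>
  proof (rule orbit_equivalent_model[OF assms(1) act[OF that] assms(10)[OF that \<sigma>0]])
    fix T \<sigma>'
    assume "T \<in> mp_aut M" "pmp_action G M \<sigma>'"
      "\<And>g x. g \<in> carrier G \<Longrightarrow> x \<in> space M \<Longrightarrow> \<sigma>' g (T x) = T (\<sigma> g x)"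
      "\<And>g. g \<in> carrier G \<Longrightarrow> AE x in M. \<exists>k\<in>carrier G. \<sigma>' g x = \<sigma>0 k x"
    then have "model \<sigma> (T, \<sigma>')" by (simp add: model_def)
    then show "\<exists>p. model \<sigma> p" by (rule exI)
  qed
  then obtain p where p: "\<And>\<sigma>. \<sigma> \<in> \<F> \<Longrightarrow> model \<sigma> (p \<sigma>)"
    using bchoice[of \<F> model] by blast
  define T where "T \<sigma> = fst (p \<sigma>)" for \<sigma>
  define m where "m \<sigma> = snd (p \<sigma>)" for \<sigma>
  have T: "T \<sigma> \<in> mp_aut M" and m: "pmp_action G M (m \<sigma>)" if "\<sigma> \<in> \<F>" for \<sigma>
    using p[OF that] by (simp_all add: model_def T_def m_def)
  have conj: "m \<sigma> g (T \<sigma> x) = T \<sigma> (\<sigma> g x)" if "\<sigma> \<in> \<F>" "g \<in> carrier G" "x \<in> space M" for \<sigma> g x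
    using p[OF that(1)] that(2,3) by (simp add: model_def T_def m_def)
  have orb: "AE x in M. \<exists>k\<in>carrier G. m \<sigma> g x = \<sigma>0 k x" if "\<sigma> \<in> \<F>" "g \<in> carrier G" for \<sigma> g
    using p[OF that(1)] that(2) by (simp add: model_def m_def)
  define c where "c n = \<sigma>0 (from_nat_into (carrier G) n)" for n
  have c: "c n \<in> M \<rightarrow>\<^sub>M M" for n
  proof -
    have "from_nat_into (carrier G) n \<in> carrier G" by (rule from_nat_into) auto
    then show ?thesis unfolding c_def using act[OF \<sigma>0] by (intro mp_autD(1)) (simp add: pmp_action_def)
  qed
  obtain code and \<C> :: "'x set list set" where "countable \<C>"
    and code_in: "\<And>S. S \<in> M \<rightarrow>\<^sub>M M \<Longrightarrow> AE x in M. \<exists>n. S x = c n x \<Longrightarrow> code S \<in> \<C>"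
    and code_eq: "\<And>S S'. S \<in> M \<rightarrow>\<^sub>M M \<Longrightarrow> AE x in M. \<exists>n. S x = c n x \<Longrightarrow> S' \<in> M \<rightarrow>\<^sub>M M \<Longrightarrow>
       AE x in M. \<exists>n. S' x = c n x \<Longrightarrow> code S = code S' \<Longrightarrow> measure M {x \<in> space M. S x \<noteq> S' x} < \<epsilon>"
  proof (rule separable_full_group[of c \<epsilon>])
    fix code and \<C> :: "'x set list set"
    assume "countable \<C>"
      "\<And>S. S \<in> M \<rightarrow>\<^sub>M M \<Longrightarrow> AE x in M. \<exists>n. S x = c n x \<Longrightarrow> code S \<in> \<C>"
      "\<And>S S'. S \<in> M \<rightarrow>\<^sub>M M \<Longrightarrow> AE x in M. \<exists>n. S x = c n x \<Longrightarrow> S' \<in> M \<rightarrow>\<^sub>M M \<Longrightarrow>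
         AE x in M. \<exists>n. S' x = c n x \<Longrightarrow> code S = code S' \<Longrightarrow> measure M {x \<in> space M. S x \<noteq> S' x} < \<epsilon>"
    then show thesis by (rule that)
  qed (rule c, rule Q(3))
  have m_meas: "m \<sigma> g \<in> M \<rightarrow>\<^sub>M M" if "\<sigma> \<in> \<F>" "g \<in> carrier G" for \<sigma> g
    using m[OF that(1)] that(2) by (intro mp_autD(1)) (simp add: pmp_action_def)
  have m_c: "AE x in M. \<exists>n. m \<sigma> g x = c n x" if "\<sigma> \<in> \<F>" "g \<in> carrier G" for \<sigma> g
    using orb[OF that]
  proof eventually_elim
    fix x assume "\<exists>k\<in>carrier G. m \<sigma> g x = \<sigma>0 k x"
    then obtain k where k: "k \<in> carrier G" "m \<sigma> g x = \<sigma>0 k x" by blast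
    obtain n where "from_nat_into (carrier G) n = k" using from_nat_into_surj[OF assms(2) k(1)] by blast
    then show "\<exists>n. m \<sigma> g x = c n x" using k by (auto simp: c_def)
  qed
  obtain qs where qs: "set qs = Q" using finite_list[OF Q(1)] by blast
  define codes where "codes \<sigma> = map (\<lambda>g. code (m \<sigma> g)) qs" for \<sigma>
  have "codes ` \<F> \<subseteq> lists \<C>"
  proof
    fix z assume "z \<in> codes ` \<F>"
    then obtain \<sigma> where \<sigma>: "\<sigma> \<in> \<F>" "z = codes \<sigma>" by blast
    have "code (m \<sigma> g) \<in> \<C>" if "g \<in> Q" for g
    proof -
      have g: "g \<in> carrier G" using that Q(2) by blast
      show ?thesis by (rule code_in[OF m_meas[OF \<sigma>(1) g] m_c[OF \<sigma>(1) g]])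
    qed
    then show "z \<in> lists \<C>" unfolding \<sigma>(2) codes_def using qs by auto
  qed
  then have count: "countable (codes ` \<F>)"
    using countable_subset countable_lists[OF \<open>countable \<C>\<close>] by blast
  \<comment> \<open>Two actions with the same codes are close on \<open>Q\<close>, hence conjugate on \<open>H\<close>, hence identified.\<close>
  have key: "(\<sigma>, \<tau>) \<in> ae_equal_actions G M" if \<sigma>: "\<sigma> \<in> \<F>" and \<tau>: "\<tau> \<in> \<F>" and eq: "codes \<sigma> = codes \<tau>" for \<sigma> \<tau>
  proof -
    interpret ap: action_pair M \<U> G "m \<sigma>" "m \<tau>"
      by (intro action_pair.intro action_pair_axioms.intro separated_prob_axioms assms(1) m \<sigma> \<tau>)
    have near: "1 - coincide G M (m \<sigma>) (m \<tau>) g \<one>\<^bsub>G\<^esub> < \<epsilon>" if "g \<in> Q" for g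
    proof -
      have g: "g \<in> carrier G" using Q(2) that by blast
      have "code (m \<sigma> g) = code (m \<tau> g)" using eq that qs by (auto simp: codes_def)
      then have lt: "measure M {x \<in> space M. m \<sigma> g x \<noteq> m \<tau> g x} < \<epsilon>"
        by (rule code_eq[OF m_meas[OF \<sigma> g] m_c[OF \<sigma> g] m_meas[OF \<tau> g] m_c[OF \<tau> g]])
      have "{x \<in> space M. m \<sigma> g x = m \<tau> g x} \<in> sets M"
        using measurable_eq[OF m_meas[OF \<sigma> g] m_meas[OF \<tau> g]] by (simp add: pred_def)
      moreover have "{x \<in> space M. m \<sigma> g x \<noteq> m \<tau> g x} = space M - {x \<in> space M. m \<sigma> g x = m \<tau> g x}" by blast
      ultimately show ?thesis using lt prob_compl ap.co_one[OF g] by simp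
    qed
    have erg: "ergodic_on G H M (m \<rho>)" if "\<rho> \<in> \<F>" for \<rho>
      unfolding ergodic_on_def
    proof (rule ergodic_conjugate[OF T[OF that]])
      show "ergodic_action (G\<lparr>carrier := H\<rparr>) M \<rho>" using assms(9)[OF that] by (simp add: ergodic_on_def)
      show "\<rho> g x \<in> space M" if "g \<in> carrier (G\<lparr>carrier := H\<rparr>)" "x \<in> space M" for g x
        using act[OF \<open>\<rho> \<in> \<F>\<close>] that HG mp_aut_space[of "\<rho> g" M x] by (auto simp: pmp_action_def)
      show "m \<rho> g (T \<rho> x) = T \<rho> (\<rho> g x)" if "g \<in> carrier (G\<lparr>carrier := H\<rparr>)" "x \<in> space M" for g x
        using conj[OF \<open>\<rho> \<in> \<F>\<close>] that HG by auto
    qed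
    have "conjugate_on H M (m \<sigma>) (m \<tau>)"
      by (rule conjugate_on_subgroup_if_close[OF assms(1-3) m[OF \<sigma>] m[OF \<tau>] erg[OF \<sigma>] erg[OF \<tau>]])
        (rule close[OF m[OF \<sigma>] m[OF \<tau>] near])
    then have "conjugate_on H M \<sigma> \<tau>"
    proof (rule conjugate_on_transfer[OF T[OF \<sigma>] T[OF \<tau>], rotated 4])
      fix h x assume hx: "h \<in> H" "x \<in> space M"
      then have h: "h \<in> carrier G" using HG by blast
      show "\<sigma> h x \<in> space M" "\<tau> h x \<in> space M"
        using act[OF \<sigma>] act[OF \<tau>] h hx(2) mp_aut_space[of _ M x] by (auto simp: pmp_action_def)
      show "m \<sigma> h (T \<sigma> x) = T \<sigma> (\<sigma> h x)" "m \<tau> h (T \<tau> x) = T \<tau> (\<tau> h x)"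
        using conj[OF \<sigma> h hx(2)] conj[OF \<tau> h hx(2)] by auto
    qed
    then show ?thesis using assms(11)[OF \<sigma> \<tau>] by blast
  qed
  let ?R = "ae_equal_actions G M"
  have R_eq: "?R `` {\<sigma>} = ?R `` {\<tau>}" if "(\<sigma>, \<tau>) \<in> ?R" for \<sigma> \<tau>
  proof -
    have st: "AE x in M. \<sigma> g x = \<tau> g x" if "g \<in> carrier G" for g
      using \<open>(\<sigma>, \<tau>) \<in> ?R\<close> that by (simp add: ae_equal_actions_def)
    have "(AE x in M. \<sigma> g x = \<rho> g x) \<longleftrightarrow> (AE x in M. \<tau> g x = \<rho> g x)" if "g \<in> carrier G" for g \<rho>
    proof
      assume "AE x in M. \<sigma> g x = \<rho> g x"
      then show "AE x in M. \<tau> g x = \<rho> g x" using st[OF that] by eventually_elim simp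
    next
      assume "AE x in M. \<tau> g x = \<rho> g x"
      then show "AE x in M. \<sigma> g x = \<rho> g x" using st[OF that] by eventually_elim simp
    qed
    then have "(\<forall>g\<in>carrier G. AE x in M. \<sigma> g x = \<rho> g x) \<longleftrightarrow> (\<forall>g\<in>carrier G. AE x in M. \<tau> g x = \<rho> g x)" for \<rho>
      by (rule ball_cong[OF refl])
    then show ?thesis by (simp add: ae_equal_actions_def Image_singleton)
  qed
  have "\<F> // ?R \<subseteq> (\<lambda>z. ?R `` {SOME \<sigma>. \<sigma> \<in> \<F> \<and> codes \<sigma> = z}) ` (codes ` \<F>)"
  proof
    fix E assume "E \<in> \<F> // ?R"
    then obtain \<tau> where \<tau>: "\<tau> \<in> \<F>" "E = ?R `` {\<tau>}" by (auto simp: quotient_def)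
    let ?s = "SOME \<sigma>. \<sigma> \<in> \<F> \<and> codes \<sigma> = codes \<tau>"
    have "?s \<in> \<F> \<and> codes ?s = codes \<tau>"
      by (rule someI[where P="\<lambda>\<sigma>. \<sigma> \<in> \<F> \<and> codes \<sigma> = codes \<tau>" and x=\<tau>]) (use \<tau> in simp)
    then have "?R `` {?s} = ?R `` {\<tau>}" using \<tau>(1) by (intro R_eq key) simp_all
    then show "E \<in> (\<lambda>z. ?R `` {SOME \<sigma>. \<sigma> \<in> \<F> \<and> codes \<sigma> = z}) ` (codes ` \<F>)"
      using \<tau> by (intro image_eqI[of _ _ "codes \<tau>"]) simp_all
  qed
  then show ?thesis by (rule countable_subset) (rule countable_image[OF count])
qed

end
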